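(* Let $X$ be a topological group. (1) If $X$ is $\mathsf{e}{:}\mathsf{pTG}$-closed, then the center $Z(X)$ has compact exponent. (2) If $X$ is $\mathsf{e}{:}\mathsf{TS}$-closed, then for any closed normal subgroup $N\subset X$ the center $Z(X/N)$ of the quotient topological group $X/N$ has precompact exponent. (3) If $X$ is $\mathsf{i}{:}\mathsf{TG}$-closed or $\mathsf{e}{:}\mathsf{sTS}$-closed, then the center $Z(X)$ of $X$ is compact. (4) If $X$ is $\mathsf{h}{:}\mathsf{TG}$-closed, then for any closed normal subgroup $N\subset X$ the center $Z(X/N)$ is compact; in particular, the Abelization $X/X^{[1]}$ of $X$ is compact, where $X^{[1]}=\overline{[X,X]}$ is the closure of the commutator subgroup.
   Context: All topological groups and topologized semigroups are assumed Hausdorff. A topologized semigroup is a topological space with an associative binary operation; it is a topological semigroup if the operation is jointly continuous, and a semitopological semigroup if it is separately continuous. A paratopological group is a group with a topology making it a topological semigroup. Let $\mathsf{TG}$, $\mathsf{pTG}$, $\mathsf{TS}$, $\mathsf{sTS}$ be the classes of all Hausdorff topological groups, paratopological groups, topological semigroups, semitopological semigroups, respectively. For a class $\mathcal C$ of topologized semigroups, a topological group $X$ is called: $\mathsf{e}{:}\mathcal C$-closed if $f(X)$ is closed in $Y$ for every $Y\in\mathcal C$ and every homomorphism $f:X\to Y$ that is a topological embedding; $\mathsf{i}{:}\mathcal C$-closed if $f(X)$ is closed in $Y$ for every $Y\in\mathcal C$ and every injective continuous homomorphism $f:X\to Y$; $\mathsf{h}{:}\mathcal C$-closed if $f(X)$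 is closed in $Y$ for every $Y\in\mathcal C$ and every continuous homomorphism $f:X\to Y$. A topological group $G$ has compact exponent (resp. precompact exponent) if for some $n\in\mathbb N$ (with $n\ge 1$) the set $\{x^n:x\in G\}$ has compact closure in $G$ (resp. is totally bounded in $G$). A subset $A\subset G$ is totally bounded (precompact) if for every neighborhood $U\subset G$ of the unit there is a finite $F\subset G$ with $A\subset FU\cap UF$. *)

theory Defs
  imports "HOL-Analysis.Analysis" "HOL-Algebra.Generated_Groups"
begin

text \<open>Keep \<open>closure_of\<close> for the topological closure.\<close>
no_notation eq_closure_of (\<open>closure'_of\<index>\<close>)

section \<open>Topologized semigroups and groups\<close>

text \<open>A topologized semigroup is a pair of an algebraic record \<open>Y\<close> and an abstract topology \<open>S\<close> on
  its carrier. For semigroups the field \<open>one\<close> of the record carries no information: neither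
  the semigroup axioms below nor \<open>hom\<close> refer to it.\<close>

definition topologized_semigroup :: "('b, 'm) monoid_scheme \<Rightarrow> 'b topology \<Rightarrow> bool" where
  "topologized_semigroup Y S \<longleftrightarrow>
     topspace S = carrier Y \<and>
     (\<forall>x\<in>carrier Y. \<forall>y\<in>carrier Y. x \<otimes>\<^bsub>Y\<^esub> y \<in> carrier Y) \<and>
     (\<forall>x\<in>carrier Y. \<forall>y\<in>carrier Y. \<forall>z\<in>carrier Y.
        (x \<otimes>\<^bsub>Y\<^esub> y) \<otimes>\<^bsub>Y\<^esub> z = x \<otimes>\<^bsub>Y\<^esub> (y \<otimes>\<^bsub>Y\<^esub> z))"

definition semitopological_semigroup :: "('b, 'm) monoid_scheme \<Rightarrow> 'b topology \<Rightarrow> bool" where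
  "semitopological_semigroup Y S \<longleftrightarrow>
     topologized_semigroup Y S \<and> Hausdorff_space S \<and>
     (\<forall>a\<in>carrier Y. continuous_map S S (\<lambda>x. a \<otimes>\<^bsub>Y\<^esub> x) \<and> continuous_map S S (\<lambda>x. x \<otimes>\<^bsub>Y\<^esub> a))"

definition topological_semigroup :: "('b, 'm) monoid_scheme \<Rightarrow> 'b topology \<Rightarrow> bool" where
  "topological_semigroup Y S \<longleftrightarrow>
     topologized_semigroup Y S \<and> Hausdorff_space S \<and>
     continuous_map (prod_topology S S) S (\<lambda>(x, y). x \<otimes>\<^bsub>Y\<^esub> y)"

definition paratopological_group :: "('b, 'm) monoid_scheme \<Rightarrow> 'b topology \<Rightarrow> bool" where
  "paratopological_group Y S \<longleftrightarrow> group Y \<and> topological_semigroup Y S"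

definition topological_group :: "('b, 'm) monoid_scheme \<Rightarrow> 'b topology \<Rightarrow> bool" where
  "topological_group Y S \<longleftrightarrow>
     paratopological_group Y S \<and> continuous_map S S (\<lambda>x. inv\<^bsub>Y\<^esub> x)"

section \<open>Closedness in a class of topologized semigroups\<close>

text \<open>HOL has no quantification over types inside a formula, so the targets \<open>Y\<close> range over all
  members of the class whose carrier lies in a type \<open>'a target\<close> of cardinality
  \<open>max |'a| \<aleph>\<^sub>0\<close>. This is no restriction: if \<open>f(X)\<close> is not closed in \<open>Y\<close>, neither is it closed in
  the subsemigroup (subgroup) of \<open>Y\<close> generated by \<open>f(X)\<close> and one point of its closure outside \<open>f(X)\<close>,
  and each element of the latter is a word over \<open>'a + nat\<close>. The lemmas
  \<open>e_closed_universal\<close>, \<open>i_closed_universal\<close> and \<open>h_closed_universal\<close>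
  below extend the defining property to targets over an arbitrary type, for each of the
  four classes above.\<close>

type_synonym 'a target = "('a + nat) list"

definition e_closed ::
  "('a target monoid \<Rightarrow> 'a target topology \<Rightarrow> bool) \<Rightarrow> ('a, 'm) monoid_scheme \<Rightarrow> 'a topology \<Rightarrow> bool" where
  "e_closed C X T \<longleftrightarrow>
     (\<forall>Y S f. C Y S \<and> f \<in> hom X Y \<and> embedding_map T S f \<longrightarrow> closedin S (f ` carrier X))"

definition i_closed ::
  "('a target monoid \<Rightarrow> 'a target topology \<Rightarrow> bool) \<Rightarrow> ('a, 'm) monoid_scheme \<Rightarrow> 'a topology \<Rightarrow> bool" where
  "i_closed C X T \<longleftrightarrow>
     (\<forall>Y S f. C Y S \<and> f \<in> hom X Y \<and> continuous_map T S f \<and> inj_on f (carrier X)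
        \<longrightarrow> closedin S (f ` carrier X))"

definition h_closed ::
  "('a target monoid \<Rightarrow> 'a target topology \<Rightarrow> bool) \<Rightarrow> ('a, 'm) monoid_scheme \<Rightarrow> 'a topology \<Rightarrow> bool" where
  "h_closed C X T \<longleftrightarrow>
     (\<forall>Y S f. C Y S \<and> f \<in> hom X Y \<and> continuous_map T S f \<longrightarrow> closedin S (f ` carrier X))"

section \<open>Center, quotient groups, exponents\<close>

definition center :: "('a, 'm) monoid_scheme \<Rightarrow> 'a set" where
  "center G = {z \<in> carrier G. \<forall>x\<in>carrier G. z \<otimes>\<^bsub>G\<^esub> x = x \<otimes>\<^bsub>G\<^esub> z}"

abbreviation center_group :: "('a, 'm) monoid_scheme \<Rightarrow> ('a, 'm) monoid_scheme" where
  "center_group G \<equiv> G\<lparr>carrier := center G\<rparr>"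

abbreviation center_topology :: "('a, 'm) monoid_scheme \<Rightarrow> 'a topology \<Rightarrow> 'a topology" where
  "center_topology G T \<equiv> subtopology T (center G)"

definition quotient_topology :: "'a topology \<Rightarrow> ('a \<Rightarrow> 'b) \<Rightarrow> 'b topology" where
  "quotient_topology T q =
     topology (\<lambda>U. U \<subseteq> q ` topspace T \<and> openin T {x \<in> topspace T. q x \<in> U})"

lemma openin_quotient_topology:
  "openin (quotient_topology T q) U \<longleftrightarrow>
     U \<subseteq> q ` topspace T \<and> openin T {x \<in> topspace T. q x \<in> U}"
proof -
  have "istopology (\<lambda>U. U \<subseteq> q ` topspace T \<and> openin T {x \<in> topspace T. q x \<in> U})"
    unfolding istopology_def
  proof (intro conjI allI impI)
    fix A B
    assume A: "A \<subseteq> q ` topspace T \<and> openin T {x \<in> topspace T. q x \<in> A}"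
      and B: "B \<subseteq> q ` topspace T \<and> openin T {x \<in> topspace T. q x \<in> B}"
    have "{x \<in> topspace T. q x \<in> A \<inter> B} = {x \<in> topspace T. q x \<in> A} \<inter> {x \<in> topspace T. q x \<in> B}"
      by blast
    then show "openin T {x \<in> topspace T. q x \<in> A \<inter> B}"
      using A B by (simp only: openin_Int)
    show "A \<inter> B \<subseteq> q ` topspace T" using A by blast
  next
    fix K
    assume K: "\<forall>A\<in>K. A \<subseteq> q ` topspace T \<and> openin T {x \<in> topspace T. q x \<in> A}"
    have "openin T (\<Union>A\<in>K. {x \<in> topspace T. q x \<in> A})"
      by (rule openin_Union) (use K in blast)
    moreover have "(\<Union>A\<in>K. {x \<in> topspace T. q x \<in> A}) = {x \<in> topspace T. q x \<in> \<Union>K}"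
      by blast
    ultimately show "openin T {x \<in> topspace T. q x \<in> \<Union>K}" by (rule back_subst)
    show "\<Union>K \<subseteq> q ` topspace T" using K by blast
  qed
  then show ?thesis unfolding quotient_topology_def by simp
qed

lemma topspace_quotient_topology: "topspace (quotient_topology T q) = q ` topspace T"
proof
  show "topspace (quotient_topology T q) \<subseteq> q ` topspace T"
    by (metis openin_quotient_topology openin_topspace)
  have "{x \<in> topspace T. q x \<in> q ` topspace T} = topspace T" by blast
  then show "q ` topspace T \<subseteq> topspace (quotient_topology T q)"
    by (intro openin_subset) (simp add: openin_quotient_topology)
qed

lemma quotient_map_quotient_topology: "quotient_map T (quotient_topology T q) q"
  by (auto simp: quotient_map_def topspace_quotient_topology openin_quotient_topology)

abbreviation quotient_group_topology ::
  "('a, 'm) monoid_scheme \<Rightarrow> 'a topology \<Rightarrow> 'a set \<Rightarrow> 'a set topology" where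
  "quotient_group_topology X T N \<equiv> quotient_topology T (\<lambda>x. N #>\<^bsub>X\<^esub> x)"

definition compact_exponent :: "('a, 'm) monoid_scheme \<Rightarrow> 'a topology \<Rightarrow> bool" where
  "compact_exponent G T \<longleftrightarrow>
     (\<exists>n::nat. n \<ge> 1 \<and> compactin T (T closure_of ((\<lambda>x. x [^]\<^bsub>G\<^esub> n) ` carrier G)))"

text \<open>Neighborhoods of the unit need not be open.\<close>

definition totally_bounded_in :: "('a, 'm) monoid_scheme \<Rightarrow> 'a topology \<Rightarrow> 'a set \<Rightarrow> bool" where
  "totally_bounded_in G T A \<longleftrightarrow>
     A \<subseteq> carrier G \<and>
     (\<forall>U. U \<subseteq> carrier G \<and> (\<exists>V. openin T V \<and> \<one>\<^bsub>G\<^esub> \<in> V \<and> V \<subseteq> U) \<longrightarrow>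
        (\<exists>F. finite F \<and> F \<subseteq> carrier G \<and> A \<subseteq> (F <#>\<^bsub>G\<^esub> U) \<inter> (U <#>\<^bsub>G\<^esub> F)))"

definition precompact_exponent :: "('a, 'm) monoid_scheme \<Rightarrow> 'a topology \<Rightarrow> bool" where
  "precompact_exponent G T \<longleftrightarrow>
     (\<exists>n::nat. n \<ge> 1 \<and> totally_bounded_in G T ((\<lambda>x. x [^]\<^bsub>G\<^esub> n) ` carrier G))"

section \<open>Independence of the target type\<close>

locale transport =
  fixes Y :: "'b monoid" and S :: "'b topology" and Z :: "'b set" and j :: "'b \<Rightarrow> 'c"
  assumes ts: "topologized_semigroup Y S"
    and Z: "Z \<subseteq> carrier Y"
    and Zm: "\<And>x y. x \<in> Z \<Longrightarrow> y \<in> Z \<Longrightarrow> x \<otimes>\<^bsub>Y\<^esub> y \<in> Z"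
    and inj: "inj_on j Z"
begin

definition i where "i = inv_into Z j"
definition Y' where
  "Y' = \<lparr>carrier = j ` Z, mult = (\<lambda>a b. j (i a \<otimes>\<^bsub>Y\<^esub> i b)), one = j \<one>\<^bsub>Y\<^esub>\<rparr>"
definition S' where "S' = pullback_topology (j ` Z) i S"

lemma ij [simp]: "z \<in> Z \<Longrightarrow> i (j z) = z"
  by (simp add: i_def inj)

lemma carr [simp]: "carrier Y' = j ` Z" and mult': "x \<otimes>\<^bsub>Y'\<^esub> y = j (i x \<otimes>\<^bsub>Y\<^esub> i y)"
  and one': "\<one>\<^bsub>Y'\<^esub> = j \<one>\<^bsub>Y\<^esub>"
  by (simp_all add: Y'_def)

lemma topS: "topspace S = carrier Y" using ts by (simp add: topologized_semigroup_def)

lemma topS' [simp]: "topspace S' = j ` Z"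
  using Z by (auto simp: S'_def topspace_pullback_topology topS)

lemma cont_i: "continuous_map S' S i"
  unfolding S'_def using continuous_map_pullback[of S S id "j ` Z" i] by simp

lemma cont_into:
  assumes "continuous_map R S h" "h ` topspace R \<subseteq> Z"
  shows "continuous_map R S' (\<lambda>x. j (h x))"
  unfolding S'_def
proof (rule continuous_map_pullback')
  show "topspace R \<subseteq> (\<lambda>x. j (h x)) -` (j ` Z)" using assms by auto
  show "continuous_map R S (i \<circ> (\<lambda>x. j (h x)))"
    by (rule continuous_map_eq[OF assms(1)]) (use assms(2) in auto)
qed

lemma haus: "Hausdorff_space S \<Longrightarrow> Hausdorff_space S'"
  by (rule Hausdorff_space_injective_preimage[OF _ cont_i]) (auto simp: inj_on_def)

lemma ts': "topologized_semigroup Y' S'"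
  using ts Z Zm unfolding topologized_semigroup_def
  by (auto simp: mult' subset_iff)

lemma semitopological: "semitopological_semigroup Y S \<Longrightarrow> semitopological_semigroup Y' S'"
proof -
  assume a: "semitopological_semigroup Y S"
  have "continuous_map S' S' (\<lambda>x. j (b \<otimes>\<^bsub>Y\<^esub> i x))" "continuous_map S' S' (\<lambda>x. j (i x \<otimes>\<^bsub>Y\<^esub> b))"
    if "b \<in> Z" for b
  proof -
    have c: "continuous_map S S (\<lambda>x. b \<otimes>\<^bsub>Y\<^esub> x)" "continuous_map S S (\<lambda>x. x \<otimes>\<^bsub>Y\<^esub> b)"
      using a that Z by (auto simp: semitopological_semigroup_def)
    show "continuous_map S' S' (\<lambda>x. j (b \<otimes>\<^bsub>Y\<^esub> i x))"
      by (rule cont_into[OF continuous_map_compose[OF cont_i c(1), unfolded o_def]])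
        (use that Zm in auto)
    show "continuous_map S' S' (\<lambda>x. j (i x \<otimes>\<^bsub>Y\<^esub> b))"
      by (rule cont_into[OF continuous_map_compose[OF cont_i c(2), unfolded o_def]])
        (use that Zm in auto)
  qed
  moreover have "(\<otimes>\<^bsub>Y'\<^esub>) (j b) = (\<lambda>x. j (b \<otimes>\<^bsub>Y\<^esub> i x))" if "b \<in> Z" for b
    using that by (simp add: mult' fun_eq_iff)
  ultimately show ?thesis
    using a ts' haus unfolding semitopological_semigroup_def by (auto simp: mult')
qed

lemma topological: "topological_semigroup Y S \<Longrightarrow> topological_semigroup Y' S'"
proof -
  assume a: "topological_semigroup Y S"
  then have c: "continuous_map (prod_topology S S) S (\<lambda>(x, y). x \<otimes>\<^bsub>Y\<^esub> y)"
    by (simp add: topological_semigroup_def)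
  have p: "continuous_map (prod_topology S' S') (prod_topology S S) (\<lambda>p. (i (fst p), i (snd p)))"
    by (intro continuous_map_pairedI
        continuous_map_compose[OF continuous_map_fst cont_i, unfolded o_def]
        continuous_map_compose[OF continuous_map_snd cont_i, unfolded o_def])
  have "continuous_map (prod_topology S' S') S' (\<lambda>p. j (i (fst p) \<otimes>\<^bsub>Y\<^esub> i (snd p)))"
    by (rule cont_into) (use continuous_map_compose[OF p c] Zm in \<open>auto simp: o_def\<close>)
  with a ts' haus show ?thesis
    unfolding topological_semigroup_def by (simp add: mult' case_prod_unfold)
qed

context
  assumes grp: "group Y" and sub: "subgroup Z Y"
begin

lemma group': "group Y'"
proof (rule groupI)
  interpret group Y by (rule grp)
  have one: "\<one>\<^bsub>Y\<^esub> \<in> Z" using sub by (rule subgroup.one_closed)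
  show "\<one>\<^bsub>Y'\<^esub> \<in> carrier Y'" using one by (simp add: one')
  show "x \<otimes>\<^bsub>Y'\<^esub> y \<in> carrier Y'" if "x \<in> carrier Y'" "y \<in> carrier Y'" for x y
    using that Zm by (auto simp: mult')
  show "x \<otimes>\<^bsub>Y'\<^esub> y \<otimes>\<^bsub>Y'\<^esub> z = x \<otimes>\<^bsub>Y'\<^esub> (y \<otimes>\<^bsub>Y'\<^esub> z)"
    if "x \<in> carrier Y'" "y \<in> carrier Y'" "z \<in> carrier Y'" for x y z
    using that ts' unfolding topologized_semigroup_def by blast
  show "\<one>\<^bsub>Y'\<^esub> \<otimes>\<^bsub>Y'\<^esub> x = x" if "x \<in> carrier Y'" for x
    using that one Z by (auto simp: mult' one' subset_iff)
  show "\<exists>y\<in>carrier Y'. y \<otimes>\<^bsub>Y'\<^esub> x = \<one>\<^bsub>Y'\<^esub>" if x: "x \<in> carrier Y'" for x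
  proof -
    obtain z where z: "z \<in> Z" "x = j z" using x by auto
    then have "inv\<^bsub>Y\<^esub> z \<in> Z" using sub by (metis subgroup.m_inv_closed)
    then show ?thesis using z Z by (intro bexI[of _ "j (inv\<^bsub>Y\<^esub> z)"]) (auto simp: mult' one' subset_iff)
  qed
qed

lemma inv': "z \<in> Z \<Longrightarrow> inv\<^bsub>Y'\<^esub> (j z) = j (inv\<^bsub>Y\<^esub> z)"
proof -
  assume z: "z \<in> Z"
  interpret group Y by (rule grp)
  interpret g: group Y' by (rule group')
  have m: "inv\<^bsub>Y\<^esub> z \<in> Z" using sub z by (metis subgroup.m_inv_closed)
  show ?thesis by (rule g.inv_equality) (use z m Z in \<open>auto simp: mult' one' subset_iff\<close>)
qed

lemma paratop: "paratopological_group Y S \<Longrightarrow> paratopological_group Y' S'"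
  using group' topological by (simp add: paratopological_group_def)

lemma topgroup: "topological_group Y S \<Longrightarrow> topological_group Y' S'"
proof -
  assume a: "topological_group Y S"
  then have c: "continuous_map S S (\<lambda>x. inv\<^bsub>Y\<^esub> x)" by (simp add: topological_group_def)
  have m: "inv\<^bsub>Y\<^esub> z \<in> Z" if "z \<in> Z" for z using sub that by (metis subgroup.m_inv_closed)
  have "continuous_map S' S' (\<lambda>x. j (inv\<^bsub>Y\<^esub> (i x)))"
    by (rule cont_into[OF continuous_map_compose[OF cont_i c, unfolded o_def]]) (use m in auto)
  then have "continuous_map S' S' (\<lambda>x. inv\<^bsub>Y'\<^esub> x)"
    by (rule continuous_map_eq) (auto simp: inv')
  with a paratop show ?thesis by (simp add: topological_group_def)
qed

end

context
  fixes X :: "('a, 'm) monoid_scheme" and T :: "'a topology" and f :: "'a \<Rightarrow> 'b"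
  assumes TX: "topspace T = carrier X" and f: "f \<in> hom X Y" and fZ: "f ` carrier X \<subseteq> Z"
begin

lemma hom': "(\<lambda>x. j (f x)) \<in> hom X Y'"
proof (rule homI)
  fix x y assume xy: "x \<in> carrier X" "y \<in> carrier X"
  then have Z: "f x \<in> Z" "f y \<in> Z" using fZ by auto
  then show "j (f x) \<in> carrier Y'" by simp
  show "j (f (x \<otimes>\<^bsub>X\<^esub> y)) = j (f x) \<otimes>\<^bsub>Y'\<^esub> j (f y)"
    using Z hom_mult[OF f xy] by (simp add: mult')
qed

lemma cont': "continuous_map T S f \<Longrightarrow> continuous_map T S' (\<lambda>x. j (f x))"
  by (rule cont_into) (use fZ TX in auto)

lemma inj': "inj_on f (carrier X) \<Longrightarrow> inj_on (\<lambda>x. j (f x)) (carrier X)"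
  using comp_inj_on[of f "carrier X" j] inj_on_subset[OF inj fZ] by (simp add: o_def)

lemma emb': "embedding_map T S f \<Longrightarrow> embedding_map T S' (\<lambda>x. j (f x))"
proof -
  assume a: "embedding_map T S f"
  then obtain g where g: "homeomorphic_maps T (subtopology S (f ` topspace T)) f g"
    unfolding embedding_map_def homeomorphic_map_maps by blast
  then have g': "continuous_map (subtopology S (f ` topspace T)) T g"
      "\<And>x. x \<in> topspace T \<Longrightarrow> g (f x) = x" and cf: "continuous_map T S f"
    by (auto simp: homeomorphic_maps_def continuous_map_in_subtopology)
  have ifx: "i (j (f x)) = f x" if "x \<in> topspace T" for x using that fZ TX by auto
  let ?U = "subtopology S' ((\<lambda>x. j (f x)) ` topspace T)"
  have "continuous_map ?U (subtopology S (f ` topspace T)) i"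
    using ifx by (auto simp: continuous_map_in_subtopology intro: continuous_map_from_subtopology[OF cont_i])
  from continuous_map_compose[OF this g'(1)] have "continuous_map ?U T (g \<circ> i)" .
  moreover have "continuous_map T ?U (\<lambda>x. j (f x))"
    using cont'[OF cf] by (auto simp: continuous_map_in_subtopology)
  ultimately have "homeomorphic_maps T ?U (\<lambda>x. j (f x)) (g \<circ> i)"
    using ifx g'(2) by (auto simp: homeomorphic_maps_def)
  then show "embedding_map T S' (\<lambda>x. j (f x))"
    unfolding embedding_map_def homeomorphic_map_maps by blast
qed

lemma not_closed':
  assumes y: "y \<in> Z" "y \<in> S closure_of (f ` carrier X)" "y \<notin> f ` carrier X"
  shows "\<not> closedin S' ((\<lambda>x. j (f x)) ` carrier X)"
proof
  let ?A = "(\<lambda>x. j (f x)) ` carrier X"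
  assume "closedin S' ?A"
  then have "openin S' (topspace S' - ?A)" by (rule openin_diff[OF openin_topspace])
  then obtain U where U: "openin S U" "j ` Z - ?A = i -` U \<inter> j ` Z"
    unfolding topS' unfolding S'_def openin_pullback_topology by blast
  have "j y \<notin> ?A"
  proof
    assume "j y \<in> ?A"
    then obtain x where x: "x \<in> carrier X" "j y = j (f x)" by blast
    then have "y = f x" using inj_onD[OF inj x(2)] y(1) fZ by blast
    then show False using x(1) y(3) by blast
  qed
  then have "j y \<in> j ` Z - ?A" using y(1) by blast
  then have "i (j y) \<in> U" unfolding U(2) by blast
  then have "y \<in> U" using y(1) by simp
  then obtain z where "z \<in> f ` carrier X" "z \<in> U" using y(2) U(1) unfolding in_closure_of by blast
  then obtain x where x: "x \<in> carrier X" "f x \<in> U" by blast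
  then have fx: "f x \<in> Z" using fZ by blast
  then have "j (f x) \<in> i -` U \<inter> j ` Z" using x(2) by simp
  then have "j (f x) \<in> j ` Z - ?A" unfolding U(2) .
  then show False using x(1) by blast
qed

end
end

fun word :: "('b, 'm) monoid_scheme \<Rightarrow> ('l \<Rightarrow> 'b) \<Rightarrow> 'l list \<Rightarrow> 'b" where
  "word Y l [] = \<one>\<^bsub>Y\<^esub>"
| "word Y l [a] = l a"
| "word Y l (a # b # w) = l a \<otimes>\<^bsub>Y\<^esub> word Y l (b # w)"

lemma word_Cons: "w \<noteq> [] \<Longrightarrow> word Y l (a # w) = l a \<otimes>\<^bsub>Y\<^esub> word Y l w"
  by (cases w) auto

lemma generated:
  fixes Y :: "'b monoid" and l :: "'l \<Rightarrow> 'b"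
  assumes ts: "topologized_semigroup Y S" and l: "range l \<subseteq> carrier Y"
  obtains Z j where "transport Y S Z (j :: 'b \<Rightarrow> 'l list)" "range l \<subseteq> Z"
    "group Y \<Longrightarrow> (\<And>a. inv\<^bsub>Y\<^esub> (l a) \<in> range l) \<Longrightarrow> subgroup Z Y"
proof -
  let ?W = "{w :: 'l list. w \<noteq> []}"
  define Z where "Z = word Y l ` ?W"
  define j where "j = inv_into ?W (word Y l)"
  have cl: "word Y l w \<in> carrier Y" if "w \<noteq> []" for w
    using that
  proof (induction w)
    case (Cons a w)
    then show ?case using l ts
      by (cases "w = []") (auto simp: word_Cons topologized_semigroup_def)
  qed simp
  have app: "word Y l (u @ v) = word Y l u \<otimes>\<^bsub>Y\<^esub> word Y l v" if "u \<noteq> []" "v \<noteq> []" for u v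
    using that
  proof (induction u)
    case (Cons a u)
    have "l a \<in> carrier Y" using l by auto
    then show ?case using Cons ts cl
      by (cases "u = []") (auto simp: word_Cons topologized_semigroup_def)
  qed simp
  have m: "x \<otimes>\<^bsub>Y\<^esub> y \<in> Z" if "x \<in> Z" "y \<in> Z" for x y
  proof -
    from that(1) obtain u where "x = word Y l u" "u \<in> ?W" unfolding Z_def by (rule imageE)
    moreover from that(2) obtain v where "y = word Y l v" "v \<in> ?W" unfolding Z_def by (rule imageE)
    ultimately have "x \<otimes>\<^bsub>Y\<^esub> y = word Y l (u @ v)" "u @ v \<in> ?W" by (simp_all add: app)
    then show ?thesis unfolding Z_def by (rule image_eqI)
  qed
  have lZ: "l a \<in> Z" for a
    unfolding Z_def by (rule image_eqI[of _ _ "[a]"]) auto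
  have t: "transport Y S Z j"
  proof
    show "topologized_semigroup Y S" by (rule ts)
    show "Z \<subseteq> carrier Y" using cl by (auto simp: Z_def)
    show "inj_on j Z" unfolding j_def Z_def by (rule inj_on_inv_into) simp
  qed (rule m)
  have "subgroup Z Y" if g: "group Y" and inv: "\<And>a. inv\<^bsub>Y\<^esub> (l a) \<in> range l"
  proof -
    interpret group Y by (rule g)
    have w: "inv\<^bsub>Y\<^esub> (word Y l w) \<in> Z" if "w \<noteq> []" for w
      using that
    proof (induction w)
      case (Cons a w)
      have a: "inv\<^bsub>Y\<^esub> (l a) \<in> Z" "l a \<in> carrier Y" using inv[of a] lZ l by auto
      show ?case
      proof (cases "w = []")
        case False
        then have "inv\<^bsub>Y\<^esub> (word Y l (a # w)) = inv\<^bsub>Y\<^esub> (word Y l w) \<otimes>\<^bsub>Y\<^esub> inv\<^bsub>Y\<^esub> (l a)"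
          using a cl by (simp add: word_Cons inv_mult_group)
        then show ?thesis using Cons False a m by simp
      qed (use a in simp)
    qed simp
    show ?thesis
    proof (rule subgroupI)
      show "Z \<subseteq> carrier Y" using cl by (auto simp: Z_def)
      show "Z \<noteq> {}" using lZ by blast
      show "inv\<^bsub>Y\<^esub> a \<in> Z" if "a \<in> Z" for a using that w by (auto simp: Z_def)
    qed (rule m)
  qed
  with t lZ show ?thesis by (intro that[of Z j]) auto
qed

lemma small_target:
  fixes X :: "('a, 'm) monoid_scheme" and Y :: "'b monoid"
  assumes X: "topological_group X T" and ts: "topologized_semigroup Y S"
    and f: "f \<in> hom X Y" and nc: "\<not> closedin S (f ` carrier X)"
  obtains Y' :: "'a target monoid" and S' f' where
    "f' \<in> hom X Y'" "\<not> closedin S' (f' ` carrier X)"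
    "continuous_map T S f \<Longrightarrow> continuous_map T S' f'"
    "inj_on f (carrier X) \<Longrightarrow> inj_on f' (carrier X)"
    "embedding_map T S f \<Longrightarrow> embedding_map T S' f'"
    "semitopological_semigroup Y S \<Longrightarrow> semitopological_semigroup Y' S'"
    "topological_semigroup Y S \<Longrightarrow> topological_semigroup Y' S'"
    "paratopological_group Y S \<Longrightarrow> paratopological_group Y' S'"
    "topological_group Y S \<Longrightarrow> topological_group Y' S'"
proof -
  have gX: "group X" and TX: "topspace T = carrier X"
    using X by (auto simp: topological_group_def paratopological_group_def
        topological_semigroup_def topologized_semigroup_def)
  have TY: "topspace S = carrier Y" using ts by (simp add: topologized_semigroup_def)
  have fY: "f ` carrier X \<subseteq> carrier Y" using f by (auto simp: hom_def)
  obtain y where y: "y \<in> S closure_of (f ` carrier X)" "y \<notin> f ` carrier X"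
    using nc fY TY closure_of_subset_eq[of "f ` carrier X" S] by auto
  have yY: "y \<in> carrier Y" using y(1) TY by (metis in_closure_of)
  define l :: "'a + nat \<Rightarrow> 'b" where "l = case_sum (\<lambda>x. if x \<in> carrier X then f x else y)
      (\<lambda>n. if n = 0 \<or> \<not> group Y then y else inv\<^bsub>Y\<^esub> y)"
  have l: "range l \<subseteq> carrier Y"
  proof -
    have "l a \<in> carrier Y" for a
      using yY fY group.inv_closed[of Y y] by (cases a) (auto simp: l_def)
    then show ?thesis by blast
  qed
  have lf: "f x \<in> range l" if "x \<in> carrier X" for x
    by (rule range_eqI[of _ _ "Inl x"]) (simp add: l_def that)
  have ly: "y \<in> range l" by (rule range_eqI[of _ _ "Inr 0"]) (simp add: l_def)
  have linv: "inv\<^bsub>Y\<^esub> (l a) \<in> range l" if g: "group Y" for a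
  proof -
    interpret group Y by (rule g)
    interpret h: group_hom X Y f using gX g f by (simp add: group_hom_def group_hom_axioms_def)
    have iy: "inv\<^bsub>Y\<^esub> y \<in> range l" by (rule range_eqI[of _ _ "Inr 1"]) (simp add: l_def g)
    have fx: "inv\<^bsub>Y\<^esub> (f x) \<in> range l" if "x \<in> carrier X" for x
      using lf[of "inv\<^bsub>X\<^esub> x"] that by simp
    have "l a \<in> f ` carrier X \<or> l a = y \<or> l a = inv\<^bsub>Y\<^esub> y"
      by (auto simp: l_def split: sum.splits)
    then show ?thesis
    proof (elim disjE imageE)
      fix x assume x: "l a = f x" "x \<in> carrier X"
      show ?thesis unfolding x(1) by (rule fx[OF x(2)])
    next
      assume *: "l a = y"
      show ?thesis unfolding * by (rule iy)
    next
      assume *: "l a = inv\<^bsub>Y\<^esub> y"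
      show ?thesis unfolding * inv_inv[OF yY] by (rule ly)
    qed
  qed
  obtain Z and j :: "'b \<Rightarrow> 'a target" where t: "transport Y S Z j" and lZ: "range l \<subseteq> Z"
    and sub: "group Y \<Longrightarrow> (\<And>a. inv\<^bsub>Y\<^esub> (l a) \<in> range l) \<Longrightarrow> subgroup Z Y"
    using generated[OF ts l] by blast
  interpret transport Y S Z j by (rule t)
  have fZ: "f ` carrier X \<subseteq> Z" using lf lZ by blast
  have yZ: "y \<in> Z" using ly lZ by blast
  have sg: "subgroup Z Y" if "group Y" using sub that linv by blast
  show ?thesis
  proof (rule that)
    show "(\<lambda>x. j (f x)) \<in> hom X Y'" by (rule hom'[OF TX f fZ])
    show "\<not> closedin S' ((\<lambda>x. j (f x)) ` carrier X)" by (rule not_closed'[OF TX f fZ yZ y])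
  next
    assume "continuous_map T S f"
    then show "continuous_map T S' (\<lambda>x. j (f x))" by (rule cont'[OF TX f fZ])
  next
    assume "inj_on f (carrier X)"
    then show "inj_on (\<lambda>x. j (f x)) (carrier X)" by (rule inj'[OF TX f fZ])
  next
    assume "embedding_map T S f"
    then show "embedding_map T S' (\<lambda>x. j (f x))" by (rule emb'[OF TX f fZ])
  next
    assume "semitopological_semigroup Y S"
    then show "semitopological_semigroup Y' S'" by (rule semitopological)
  next
    assume "topological_semigroup Y S"
    then show "topological_semigroup Y' S'" by (rule topological)
  next
    assume a: "paratopological_group Y S"
    then have "group Y" by (simp add: paratopological_group_def)
    then show "paratopological_group Y' S'" using paratop sg a by blast
  next
    assume a: "topological_group Y S"
    then have "group Y" by (simp add: topological_group_def paratopological_group_def)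
    then show "topological_group Y' S'" using topgroup sg a by blast
  qed
qed

lemma class_topologized:
  "semitopological_semigroup Y S \<Longrightarrow> topologized_semigroup Y S"
  "topological_semigroup Y S \<Longrightarrow> topologized_semigroup Y S"
  "paratopological_group Y S \<Longrightarrow> topologized_semigroup Y S"
  "topological_group Y S \<Longrightarrow> topologized_semigroup Y S"
  by (simp_all add: semitopological_semigroup_def topological_semigroup_def
      paratopological_group_def topological_group_def)

lemma e_closed_universal:
  fixes Y :: "'b monoid"
  assumes X: "topological_group X T" and f: "f \<in> hom X Y" "embedding_map T S f"
    and C: "e_closed semitopological_semigroup X T \<and> semitopological_semigroup Y S \<or>
       e_closed topological_semigroup X T \<and> topological_semigroup Y S \<or>
       e_closed paratopological_group X T \<and> paratopological_group Y S \<or>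
       e_closed topological_group X T \<and> topological_group Y S"
  shows "closedin S (f ` carrier X)"
proof (rule ccontr)
  assume nc: "\<not> ?thesis"
  have "topologized_semigroup Y S" using C by (elim disjE conjE) (rule class_topologized, assumption)+
  then show False
  proof (rule small_target[OF X _ f(1) nc])
    fix Y' :: "'a target monoid" and S' f'
    assume *: "f' \<in> hom X Y'" "\<not> closedin S' (f' ` carrier X)"
      "continuous_map T S f \<Longrightarrow> continuous_map T S' f'"
      "inj_on f (carrier X) \<Longrightarrow> inj_on f' (carrier X)"
      "embedding_map T S f \<Longrightarrow> embedding_map T S' f'"
      "semitopological_semigroup Y S \<Longrightarrow> semitopological_semigroup Y' S'"
      "topological_semigroup Y S \<Longrightarrow> topological_semigroup Y' S'"
      "paratopological_group Y S \<Longrightarrow> paratopological_group Y' S'"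
      "topological_group Y S \<Longrightarrow> topological_group Y' S'"
    have "embedding_map T S' f'" by (rule *(5)[OF f(2)])
    then have N: "\<not> C Y' S'" if "e_closed C X T" for C
      using that *(1,2) unfolding e_closed_def by metis
    show False
      using C by (elim disjE conjE) (drule N, drule *(6-9), erule (1) notE)+
  qed
qed

lemma i_closed_universal:
  fixes Y :: "'b monoid"
  assumes X: "topological_group X T"
    and f: "f \<in> hom X Y" "continuous_map T S f" "inj_on f (carrier X)"
    and C: "i_closed semitopological_semigroup X T \<and> semitopological_semigroup Y S \<or>
       i_closed topological_semigroup X T \<and> topological_semigroup Y S \<or>
       i_closed paratopological_group X T \<and> paratopological_group Y S \<or>
       i_closed topological_group X T \<and> topological_group Y S"
  shows "closedin S (f ` carrier X)"
proof (rule ccontr)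
  assume nc: "\<not> ?thesis"
  have "topologized_semigroup Y S" using C by (elim disjE conjE) (rule class_topologized, assumption)+
  then show False
  proof (rule small_target[OF X _ f(1) nc])
    fix Y' :: "'a target monoid" and S' f'
    assume *: "f' \<in> hom X Y'" "\<not> closedin S' (f' ` carrier X)"
      "continuous_map T S f \<Longrightarrow> continuous_map T S' f'"
      "inj_on f (carrier X) \<Longrightarrow> inj_on f' (carrier X)"
      "embedding_map T S f \<Longrightarrow> embedding_map T S' f'"
      "semitopological_semigroup Y S \<Longrightarrow> semitopological_semigroup Y' S'"
      "topological_semigroup Y S \<Longrightarrow> topological_semigroup Y' S'"
      "paratopological_group Y S \<Longrightarrow> paratopological_group Y' S'"
      "topological_group Y S \<Longrightarrow> topological_group Y' S'"
    have "continuous_map T S' f' \<and> inj_on f' (carrier X)" by (rule conjI[OF *(3)[OF f(2)] *(4)[OF f(3)]])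
    then have N: "\<not> C Y' S'" if "i_closed C X T" for C
      using that *(1,2) unfolding i_closed_def by metis
    show False
      using C by (elim disjE conjE) (drule N, drule *(6-9), erule (1) notE)+
  qed
qed

lemma h_closed_universal:
  fixes Y :: "'b monoid"
  assumes X: "topological_group X T" and f: "f \<in> hom X Y" "continuous_map T S f"
    and C: "h_closed semitopological_semigroup X T \<and> semitopological_semigroup Y S \<or>
       h_closed topological_semigroup X T \<and> topological_semigroup Y S \<or>
       h_closed paratopological_group X T \<and> paratopological_group Y S \<or>
       h_closed topological_group X T \<and> topological_group Y S"
  shows "closedin S (f ` carrier X)"
proof (rule ccontr)
  assume nc: "\<not> ?thesis"
  have "topologized_semigroup Y S" using C by (elim disjE conjE) (rule class_topologized, assumption)+
  then show False
  proof (rule small_target[OF X _ f(1) nc])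
    fix Y' :: "'a target monoid" and S' f'
    assume *: "f' \<in> hom X Y'" "\<not> closedin S' (f' ` carrier X)"
      "continuous_map T S f \<Longrightarrow> continuous_map T S' f'"
      "inj_on f (carrier X) \<Longrightarrow> inj_on f' (carrier X)"
      "embedding_map T S f \<Longrightarrow> embedding_map T S' f'"
      "semitopological_semigroup Y S \<Longrightarrow> semitopological_semigroup Y' S'"
      "topological_semigroup Y S \<Longrightarrow> topological_semigroup Y' S'"
      "paratopological_group Y S \<Longrightarrow> paratopological_group Y' S'"
      "topological_group Y S \<Longrightarrow> topological_group Y' S'"
    have "continuous_map T S' f'" by (rule *(3)[OF f(2)])
    then have N: "\<not> C Y' S'" if "h_closed C X T" for C
      using that *(1,2) unfolding h_closed_def by metis
    show False
      using C by (elim disjE conjE) (drule N, drule *(6-9), erule (1) notE)+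
  qed
qed

end

theory Submission
  imports Defs "HOL-Algebra.FiniteProduct" "HOL-Algebra.Elementary_Groups"
begin

text \<open>
  Let \<open>Z\<close> be the center of a topological group \<open>G\<close>, and suppose that \<open>Z\<close>, or the set of its \<open>n\<close>-th
  powers for every \<open>n \<ge> 1\<close>, is too large. Then \<open>G\<close> is not closed in a group generated by \<open>G\<close> and
  one new element \<open>y\<close>, the limit of elements \<open>z k\<close> of \<open>Z\<close> along an ultrafilter \<open>p\<close>. As \<open>y\<close> commutes with
  \<open>G\<close>, this group is an image of \<open>G \<times> \<int>\<close> with \<open>y = (\<one>, 1)\<close>. It is topologized by prenorms \<open>L\<close>, that
  is, by nonnegative subadditive functions which are continuous on \<open>G\<close> and for which \<open>L (z k, -1)\<close> tends to \<open>0\<close>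
  along \<open>p\<close>. All prenorms together give a paratopological group in which \<open>G\<close> is embedded; the symmetric
  ones give a topological group topology, in general after division by the common null elements.
  What matters is that there are enough symmetric prenorms (seminorms) to separate points. This is
  the content of \<open>separating_extension\<close>: one can choose \<open>z\<close> and \<open>p\<close> so that \<open>(g, d) \<noteq> (\<one>, 0)\<close> is separated
  from the unit if \<open>d = 0\<close> or the \<open>d\<close>-th powers of central elements are not totally bounded.

  The seminorms are quotients of the seminorms \<open>(e, u) \<mapsto> (\<Sum>k. \<bar>e k\<bar> * w k) + N u\<close> on the product of the free
  abelian group over the indices \<open>k\<close> with \<open>G\<close> (\<open>word_norm\<close>), where the weights \<open>w k\<close> tend to \<open>0\<close> along \<open>p\<close>. One vanishes at
  \<open>(g, d)\<close> only if \<open>g\<close> is approximated by cheap words in the \<open>z k\<close> with exponent sum \<open>- d\<close>. For a seminorm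
  \<open>l\<close> on \<open>Z\<close> the exponents \<open>e\<close> for which the \<open>e\<close>-th powers are totally bounded form an ideal, generated
  by some \<open>n \<ge> 0\<close>. If the sequence is chosen generically, then a word is small only if \<open>n\<close>
  divides its exponents (\<open>independent_sequence\<close>). Words of this kind with exponent sum zero are products of quotients
  of members of the totally bounded family \<open>z k [^] n\<close>, which is Cauchy along \<open>p\<close>; so they are small if the weights are suitable
  (\<open>word_oscillation\<close>). Both facts together give separation (\<open>word_norm_positive\<close>).

  The generic choice needs one scale that is good for all exponents outside of the ideal. This is
  called tameness here. The difficult case is a group in which every neighborhood \<open>U\<close> of the
  unit has a finite union of translates that contains all \<open>m\<close>-th powers for some \<open>m \<ge> 1\<close> depending on \<open>U\<close>. Then an argument
  of Sanders (\<open>syndetic_small_power\<close>), carried out with an invariant mean, refines the covering of the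
  \<open>m\<close>-th powers to a totally bounded group topology on them, and by the construction of Birkhoff and Kakutani
  (\<open>seminorm_of_chain\<close>) to a tame seminorm with a small unit ball (\<open>tame_of_chain\<close>).

  Closedness in paratopological groups thus gives a bound for some set of powers. For topological semigroups
  the extension of \<open>X/N\<close> is used without its elements of negative degree, and with \<open>X\<close> in place of
  degree zero (\<open>non_closed_semigroup_extension\<close>). For injective homomorphisms to topological groups degree 1 alone matters and the
  center itself is bounded. For semitopological semigroups the center is bounded because otherwise a
  zero element can be added (\<open>non_closed_one_point_extension\<close>). Finally, each of the hypotheses that lead to
  compactness makes central Cauchy ultrafilters converge, since otherwise their limits could be added
  (\<open>central_ultrafilter_converges\<close>).
\<close>

section \<open>Ultrafilters\<close>

definition ultrafilter :: "'k filter \<Rightarrow> bool" where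
  "ultrafilter p \<longleftrightarrow> p \<noteq> bot \<and> (\<forall>P. eventually P p \<or> eventually (\<lambda>x. \<not> P x) p)"

text \<open>A minimal element among the proper filters below \<open>F\<close> decides every predicate \<open>P\<close>, because its
  meet with \<open>P\<close>, if proper, is again such a filter.\<close>
lemma ultrafilter_below:
  fixes F :: "'k filter"
  assumes "F \<noteq> bot"
  obtains p where "ultrafilter p" "p \<le> F"
proof -
  define A where "A = {G. G \<noteq> bot \<and> G \<le> F}"
  have po: "partial_order_on A (relation_of (\<lambda>x y. y \<le> x) A)"
    by (rule partial_order_on_relation_ofI) auto
  have "\<exists>m\<in>A. \<forall>a\<in>A. a \<le> m \<longrightarrow> a = m"
  proof (rule predicate_Zorn[OF po])
    fix C assume C: "C \<in> Chains (relation_of (\<lambda>x y. y \<le> x) A)"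
    then have CA: "C \<subseteq> A" and lin: "\<And>x y. x \<in> C \<Longrightarrow> y \<in> C \<Longrightarrow> x \<le> y \<or> y \<le> x"
      unfolding Chains_def relation_of_def by auto
    show "\<exists>u\<in>A. \<forall>a\<in>C. u \<le> a"
    proof (cases "C = {}")
      case True
      then show ?thesis using assms by (auto simp: A_def)
    next
      case False
      have "eventually P (Inf C) \<longleftrightarrow> (\<exists>b\<in>C. eventually P b)" for P
        by (rule eventually_Inf_base[OF False]) (use lin in \<open>fastforce simp: le_inf_iff\<close>)
      then have "Inf C \<noteq> bot"
        using CA unfolding trivial_limit_def A_def by auto
      moreover have "Inf C \<le> F"
        using False CA by (metis (mono_tags, lifting) A_def Inf_lower2 all_not_in_conv in_mono mem_Collect_eq)
      ultimately show ?thesis by (intro bexI[of _ "Inf C"]) (auto simp: A_def Inf_lower)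
    qed
  qed
  then obtain m where m: "m \<in> A" "\<And>a. a \<in> A \<Longrightarrow> a \<le> m \<Longrightarrow> a = m" by blast
  have "eventually P m \<or> eventually (\<lambda>x. \<not> P x) m" for P
  proof (rule disjCI)
    assume n: "\<not> eventually (\<lambda>x. \<not> P x) m"
    have "inf m (principal {x. P x}) \<noteq> bot"
      using n by (simp add: trivial_limit_def eventually_inf_principal)
    then have "inf m (principal {x. P x}) = m"
      using m(1) by (intro m(2)) (auto simp: A_def intro: le_infI1)
    then show "eventually P m" by (metis inf_le2 le_principal mem_Collect_eq eventually_mono)
  qed
  with m(1) show ?thesis by (intro that) (auto simp: ultrafilter_def A_def)
qed

lemma ultrafilter_finite_cover:
  assumes p: "ultrafilter p" and "finite F" and "eventually (\<lambda>x. \<exists>f\<in>F. P f x) p"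
  obtains f where "f \<in> F" "eventually (P f) p"
proof -
  have "\<exists>f\<in>F. eventually (P f) p"
  proof (rule ccontr)
    assume "\<not> ?thesis"
    then have "\<forall>f\<in>F. eventually (\<lambda>x. \<not> P f x) p" using p by (auto simp: ultrafilter_def)
    then have "eventually (\<lambda>x. \<forall>f\<in>F. \<not> P f x) p" using assms(2) by (simp add: eventually_ball_finite)
    with assms(3) have "eventually (\<lambda>x. False) p" by (rule eventually_elim2) auto
    with p show False by (auto simp: ultrafilter_def trivial_limit_def)
  qed
  with that show ?thesis by blast
qed

lemma ultrafilter_bounded_limit:
  fixes f :: "'k \<Rightarrow> real"
  assumes p: "ultrafilter p" and f: "\<And>i. f i \<in> {a..b}"
  obtains l where "(f \<longlongrightarrow> l) p"
proof -
  have "filtermap f p \<noteq> bot" using p by (simp add: ultrafilter_def filtermap_bot_iff)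
  moreover have "eventually (\<lambda>x. x \<in> {a..b}) (filtermap f p)" using f by (simp add: eventually_filtermap)
  ultimately obtain l where l: "inf (nhds l) (filtermap f p) \<noteq> bot"
    using compact_Icc[of a b] unfolding compact_filter by blast
  have "eventually (\<lambda>i. f i \<in> S) p" if "open S" "l \<in> S" for S
  proof (rule ccontr)
    assume "\<not> ?thesis"
    then have "eventually (\<lambda>i. f i \<notin> S) p" using p by (auto simp: ultrafilter_def)
    moreover have "eventually (\<lambda>x. x \<in> S) (nhds l)" using that by (auto simp: eventually_nhds)
    ultimately have "eventually (\<lambda>x. False) (inf (nhds l) (filtermap f p))"
      unfolding eventually_inf by (intro exI[of _ "\<lambda>x. x \<in> S"] exI[of _ "\<lambda>x. x \<notin> S"]) (auto simp: eventually_filtermap)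
    with l show False by (simp add: trivial_limit_def)
  qed
  then show ?thesis by (intro that[of l]) (simp add: tendsto_def)
qed

section \<open>Invariant means on abelian groups\<close>

text \<open>The average of the indicator of \<open>A\<close> over the box of all products of powers \<open>x [^] j\<close>, \<open>j < n\<close>, of
  the entries \<open>x\<close> of the list, counted with multiplicity.\<close>
primrec (in comm_group) box_average :: "nat \<Rightarrow> 'a list \<Rightarrow> 'a set \<Rightarrow> real" where
  "box_average n [] A = of_bool (\<one> \<in> A)"
| "box_average n (x # xs) A = (\<Sum>j<n. box_average n xs {y \<in> carrier G. x [^] j \<otimes> y \<in> A}) / n"

context comm_group
begin

lemma box_average_bounds: "0 \<le> box_average n xs A \<and> box_average n xs A \<le> 1"
proof (induction xs arbitrary: A)
  case (Cons x xs)
  have "(\<Sum>j<n. box_average n xs {y \<in> carrier G. x [^] j \<otimes> y \<in> A}) \<le> (\<Sum>j<n. 1)"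
    by (rule sum_mono) (use Cons in blast)
  then show ?case
    using Cons by (auto simp: divide_le_eq_1 intro!: divide_nonneg_nonneg sum_nonneg)
qed auto

lemma box_average_carrier: "n \<ge> 1 \<Longrightarrow> set xs \<subseteq> carrier G \<Longrightarrow> box_average n xs (carrier G) = 1"
proof (induction xs)
  case (Cons x xs)
  have "{y \<in> carrier G. x [^] j \<otimes> y \<in> carrier G} = carrier G" for j :: nat
    using Cons.prems by auto
  then show ?case using Cons by simp
qed auto

lemma box_average_Un:
  "A \<inter> B = {} \<Longrightarrow> box_average n xs (A \<union> B) = box_average n xs A + box_average n xs B"
proof (induction xs arbitrary: A B)
  case (Cons x xs)
  have "{y \<in> carrier G. x [^] j \<otimes> y \<in> A \<union> B} =
      {y \<in> carrier G. x [^] j \<otimes> y \<in> A} \<union> {y \<in> carrier G. x [^] j \<otimes> y \<in> B}" for j :: nat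
    by auto
  moreover have "box_average n xs ({y \<in> carrier G. x [^] j \<otimes> y \<in> A} \<union> {y \<in> carrier G. x [^] j \<otimes> y \<in> B}) =
      box_average n xs {y \<in> carrier G. x [^] j \<otimes> y \<in> A} + box_average n xs {y \<in> carrier G. x [^] j \<otimes> y \<in> B}" for j :: nat
    by (rule Cons.IH) (use Cons.prems in blast)
  ultimately show ?case by (simp add: sum.distrib add_divide_distrib)
qed auto

text \<open>A translation by an entry of the list moves the box by one step in one coordinate, so that only
  the two faces orthogonal to that coordinate matter. Commutativity moves the translation past the
  other coordinates.\<close>
lemma box_average_shift:
  assumes "x \<in> set xs" "set xs \<subseteq> carrier G" "n \<ge> 1"
  shows "\<bar>box_average n xs {y \<in> carrier G. x \<otimes> y \<in> A} - box_average n xs A\<bar> \<le> 1 / n"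
  using assms
proof (induction xs arbitrary: A)
  case (Cons a xs)
  define g where "g j B = box_average n xs {y \<in> carrier G. a [^] (j::nat) \<otimes> y \<in> B}" for j B
  have a: "a \<in> carrier G" and x: "x \<in> carrier G" using Cons.prems by auto
  have shift: "{y \<in> carrier G. a [^] j \<otimes> y \<in> {y \<in> carrier G. x \<otimes> y \<in> A}}
      = {y \<in> carrier G. x \<otimes> y \<in> {y \<in> carrier G. a [^] j \<otimes> y \<in> A}}" for j :: nat
    using a x by (auto simp: m_lcomm)
  show ?case
  proof (cases "x = a")
    case True
    have "{y \<in> carrier G. a [^] j \<otimes> y \<in> {y \<in> carrier G. x \<otimes> y \<in> A}}
        = {y \<in> carrier G. a [^] Suc j \<otimes> y \<in> A}" for j :: nat
      using a True by (auto simp: m_assoc m_lcomm)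
    then have "g j {y \<in> carrier G. x \<otimes> y \<in> A} = g (Suc j) A" for j unfolding g_def by metis
    then have "box_average n (a # xs) {y \<in> carrier G. x \<otimes> y \<in> A} - box_average n (a # xs) A
        = (\<Sum>j<n. g (Suc j) A - g j A) / n"
      unfolding box_average.simps g_def[symmetric] by (simp add: sum_subtractf diff_divide_distrib)
    also have "\<dots> = (g n A - g 0 A) / n" by (subst sum_lessThan_telescope) (rule refl)
    finally have "\<bar>box_average n (a # xs) {y \<in> carrier G. x \<otimes> y \<in> A} - box_average n (a # xs) A\<bar>
        = \<bar>g n A - g 0 A\<bar> / n" by simp
    moreover have "\<bar>g n A - g 0 A\<bar> \<le> 1"
      using box_average_bounds[of n xs] unfolding g_def by (smt (verit))
    ultimately show ?thesis by (metis divide_right_mono of_nat_0_le_iff)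
  next
    case False
    then have "x \<in> set xs" "set xs \<subseteq> carrier G" using Cons.prems by auto
    then have IH: "\<bar>g j {y \<in> carrier G. x \<otimes> y \<in> A} - g j A\<bar> \<le> 1 / n" for j
      unfolding g_def shift using Cons.IH Cons.prems(3) by blast
    have "box_average n (a # xs) {y \<in> carrier G. x \<otimes> y \<in> A} - box_average n (a # xs) A
        = (\<Sum>j<n. g j {y \<in> carrier G. x \<otimes> y \<in> A} - g j A) / n"
      unfolding box_average.simps g_def[symmetric] by (simp add: sum_subtractf diff_divide_distrib)
    moreover have "\<bar>\<Sum>j<n. g j {y \<in> carrier G. x \<otimes> y \<in> A} - g j A\<bar> \<le> (\<Sum>j<n. 1 / n)"
      by (rule order_trans[OF sum_abs sum_mono]) (rule IH)
    moreover have "(\<Sum>j<n. 1 / real n) = 1" using Cons.prems(3) by simp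
    ultimately show ?thesis by (simp add: divide_right_mono)
  qed
qed auto

end

locale invariant_mean = comm_group +
  fixes \<mu> :: "'a set \<Rightarrow> real"
  assumes nonneg: "0 \<le> \<mu> A"
    and total: "\<mu> (carrier G) = 1"
    and additive: "A \<inter> B = {} \<Longrightarrow> \<mu> (A \<union> B) = \<mu> A + \<mu> B"
    and invariant: "x \<in> carrier G \<Longrightarrow> \<mu> {y \<in> carrier G. x \<otimes> y \<in> A} = \<mu> A"

text \<open>Limits of box averages along an ultrafilter that eventually contains every element in the list and
  makes the boxes arbitrarily long. Finite sets of pairs are used as indices so that the side length
  \<open>card E\<close> tends to infinity even if the group is finite.\<close>
lemma (in comm_group) invariant_mean_exists:
  obtains \<mu> where "invariant_mean G \<mu>"
proof -
  define F where "F = finite_subsets_at_top (UNIV :: ('a \<times> nat) set)"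
  have "F \<noteq> bot" by (simp add: F_def)
  then obtain p where p: "ultrafilter p" "p \<le> F" by (rule ultrafilter_below)
  then have pb: "p \<noteq> bot" by (simp add: ultrafilter_def)
  define xs :: "('a \<times> nat) set \<Rightarrow> 'a list" where "xs E = (SOME l. set l = fst ` E \<inter> carrier G)" for E
  have xs: "set (xs E) = fst ` E \<inter> carrier G" if "finite E" for E
    unfolding xs_def by (rule someI_ex) (use that in \<open>simp add: finite_list\<close>)
  define f where "f A E = box_average (card E) (xs E) A" for A and E :: "('a \<times> nat) set"
  have "\<exists>l. (f A \<longlongrightarrow> l) p" for A
    by (rule ultrafilter_bounded_limit[OF p(1), of "f A" 0 1]) (auto simp: f_def box_average_bounds)
  then obtain \<mu> where \<mu>: "\<And>A. (f A \<longlongrightarrow> \<mu> A) p" by metis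
  have large: "eventually (\<lambda>E. finite E \<and> E0 \<subseteq> E) p" if "finite E0" for E0
    by (rule filter_leD[OF p(2)]) (use that in \<open>auto simp: F_def eventually_finite_subsets_at_top\<close>)
  have ev: "eventually (\<lambda>E. finite E \<and> n \<le> card E \<and> x \<in> fst ` E) p" for n x
  proof (rule eventually_mono[OF large[of "{x} \<times> {..n}"]])
    fix E assume E: "finite E \<and> {x} \<times> {..n} \<subseteq> E"
    then have "card ({x} \<times> {..n}) \<le> card E" by (intro card_mono) auto
    then show "finite E \<and> n \<le> card E \<and> x \<in> fst ` E" using E by force
  qed simp
  have "invariant_mean G \<mu>"
  proof
    show "0 \<le> \<mu> A" for A
      by (rule tendsto_lowerbound[OF \<mu> _ pb]) (simp add: f_def box_average_bounds)
    have "eventually (\<lambda>E. f (carrier G) E = 1) p"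
      by (rule eventually_mono[OF ev[of 1 \<one>]]) (auto simp: f_def xs intro!: box_average_carrier)
    then show "\<mu> (carrier G) = 1"
      by (rule tendsto_unique[OF pb \<mu> tendsto_eventually])
    show "\<mu> (A \<union> B) = \<mu> A + \<mu> B" if "A \<inter> B = {}" for A B
    proof (rule tendsto_unique[OF pb \<mu>])
      have "(\<lambda>E. f A E + f B E) = f (A \<union> B)" unfolding f_def using box_average_Un[OF that] by auto
      then show "(f (A \<union> B) \<longlongrightarrow> \<mu> A + \<mu> B) p" using tendsto_add[OF \<mu>[of A] \<mu>[of B]] by simp
    qed
    show "\<mu> {y \<in> carrier G. x \<otimes> y \<in> A} = \<mu> A" if x: "x \<in> carrier G" for x A
    proof -
      define B where "B = {y \<in> carrier G. x \<otimes> y \<in> A}"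
      have "((\<lambda>E. f B E - f A E) \<longlongrightarrow> \<mu> B - \<mu> A) p" by (intro tendsto_diff \<mu>)
      moreover have "((\<lambda>E. f B E - f A E) \<longlongrightarrow> 0) p"
      proof (rule tendstoI)
        fix e :: real assume "e > 0"
        then obtain n :: nat where n: "1 / e < n" using reals_Archimedean2 by blast
        show "eventually (\<lambda>E. dist (f B E - f A E) 0 < e) p"
        proof (rule eventually_mono[OF ev[of "Suc n" x]])
          fix E :: "('a \<times> nat) set" assume E: "finite E \<and> Suc n \<le> card E \<and> x \<in> fst ` E"
          then have "\<bar>f B E - f A E\<bar> \<le> 1 / card E"
            unfolding f_def B_def by (intro box_average_shift) (auto simp: xs x)
          also have "\<dots> < e"
          proof -
            have "1 / e < card E" using n E by linarith
            then show ?thesis using \<open>e > 0\<close> E by (simp add: divide_less_eq mult.commute)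
          qed
          finally show "dist (f B E - f A E) 0 < e" by simp
        qed
      qed
      ultimately show ?thesis unfolding B_def using tendsto_unique[OF pb] by fastforce
    qed
  qed
  then show ?thesis by (rule that)
qed

section \<open>Powers of syndetic sets\<close>

no_notation subset_mset  (infix \<open><#\<close> 50)

context monoid
begin

primrec set_pow :: "'a set \<Rightarrow> nat \<Rightarrow> 'a set" where
  "set_pow S 0 = {\<one>}"
| "set_pow S (Suc k) = S <#> set_pow S k"

lemma set_pow_closed: "S \<subseteq> carrier G \<Longrightarrow> set_pow S k \<subseteq> carrier G"
  by (induction k) (auto simp: set_mult_def)

end

context group
begin

lemma set_multI: "a \<in> A \<Longrightarrow> b \<in> B \<Longrightarrow> a \<otimes> b \<in> A <#> B"
  by (auto simp: set_mult_def)

lemma set_multE: "x \<in> A <#> B \<Longrightarrow> (\<And>a b. a \<in> A \<Longrightarrow> b \<in> B \<Longrightarrow> x = a \<otimes> b \<Longrightarrow> thesis) \<Longrightarrow> thesis"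
  by (auto simp: set_mult_def)

lemma mult_inv_mult_cancel: "c \<in> carrier G \<Longrightarrow> x \<in> carrier G \<Longrightarrow> c \<otimes> (inv c \<otimes> x) = x"
  by (simp add: m_assoc[symmetric])

lemma set_pow_add: "S \<subseteq> carrier G \<Longrightarrow> set_pow S (k + l) = set_pow S k <#> set_pow S l"
proof (induction k)
  case 0
  then show ?case using set_pow_closed[of S l] by (force simp: set_mult_def)
next
  case (Suc k)
  then show ?case by (simp add: set_mult_assoc set_pow_closed)
qed

lemma set_pow_mult: "S \<subseteq> carrier G \<Longrightarrow> set_pow (set_pow S k) l = set_pow S (l * k)"
  by (induction l) (simp_all add: set_pow_add)

lemma set_pow_one: "S \<subseteq> carrier G \<Longrightarrow> set_pow S 1 = S"
  by (force simp: set_mult_def)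

lemma one_set_pow: "\<one> \<in> S \<Longrightarrow> \<one> \<in> set_pow S k"
  by (induction k) (use set_multI in fastforce)+

lemma set_pow_mono: "S \<subseteq> S' \<Longrightarrow> set_pow S k \<subseteq> set_pow S' k"
  by (induction k) (auto simp: set_mult_def)

end

lemma (in comm_group) set_pow_inv:
  assumes "S \<subseteq> carrier G" "\<And>x. x \<in> S \<Longrightarrow> inv x \<in> S"
  shows "x \<in> set_pow S k \<Longrightarrow> inv x \<in> set_pow S k"
proof (induction k arbitrary: x)
  case (Suc k)
  then obtain a b where ab: "a \<in> S" "b \<in> set_pow S k" "x = a \<otimes> b" by (auto elim: set_multE)
  then have "inv x = inv a \<otimes> inv b" using assms(1) set_pow_closed[OF assms(1), of k] by (simp add: inv_mult subset_iff)
  then show ?case using ab Suc.IH assms(2) by (auto intro: set_multI)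
qed auto

definition (in group) syndetic :: "'a set \<Rightarrow> bool" where
  "syndetic D \<longleftrightarrow> (\<exists>F. finite F \<and> F \<subseteq> carrier G \<and> carrier G \<subseteq> F <#> D)"

text \<open>Greedy choice: each new point avoids the finitely many translates of \<open>D\<close> by the earlier ones.\<close>
lemma (in group) not_syndetic_separated:
  assumes "\<not> syndetic D"
  obtains x :: "nat \<Rightarrow> 'a" where "\<And>i. i < n \<Longrightarrow> x i \<in> carrier G"
    "\<And>i j. i < j \<Longrightarrow> j < n \<Longrightarrow> inv (x i) \<otimes> x j \<notin> D"
proof -
  have "\<exists>x :: nat \<Rightarrow> 'a. (\<forall>i<n. x i \<in> carrier G) \<and> (\<forall>i j. i < j \<longrightarrow> j < n \<longrightarrow> inv (x i) \<otimes> x j \<notin> D)"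
  proof (induction n)
    case (Suc n)
    then obtain x where x: "\<forall>i<n. x i \<in> carrier G" "\<forall>i j. i < j \<longrightarrow> j < n \<longrightarrow> inv (x i) \<otimes> x j \<notin> D"
      by blast
    have "\<not> carrier G \<subseteq> (x ` {..<n}) <#> D"
      using assms x(1) unfolding syndetic_def by (metis finite_imageI finite_lessThan image_subsetI lessThan_iff)
    then obtain y where y: "y \<in> carrier G" "y \<notin> (x ` {..<n}) <#> D" by blast
    have "inv (x i) \<otimes> y \<notin> D" if "i < n" for i
    proof
      assume "inv (x i) \<otimes> y \<in> D"
      then have "x i \<otimes> (inv (x i) \<otimes> y) \<in> (x ` {..<n}) <#> D" using that by (intro set_multI) auto
      then show False using y x(1) that by (simp add: m_assoc[symmetric])
    qed
    then show ?case using x y by (intro exI[of _ "x(n := y)"]) (auto simp: less_Suc_eq)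
  qed auto
  then show ?thesis using that by blast
qed

context invariant_mean
begin

lemma mean_mono: assumes "A \<subseteq> B" shows "\<mu> A \<le> \<mu> B"
  using additive[of A "B - A"] nonneg[of "B - A"] assms by (simp add: Un_absorb1)

lemma mean_diff: "\<mu> (A - B) = \<mu> A - \<mu> (A \<inter> B)"
  using additive[of "A - B" "A \<inter> B"] by (simp add: Un_Diff_Int Diff_Int_distrib2 Int_Diff disjoint_iff)

lemma mean_Un: "\<mu> (A \<union> B) = \<mu> A + \<mu> B - \<mu> (A \<inter> B)"
  using additive[of A "B - A"] mean_diff[of B A] by (simp add: Int_commute)

lemma mean_empty: "\<mu> {} = 0"
  using additive[of "{}" "{}"] by simp

lemma mean_le_1: "A \<subseteq> carrier G \<Longrightarrow> \<mu> A \<le> 1"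
  using mean_mono total by metis

lemma mean_UN_le:
  "finite I \<Longrightarrow> \<mu> (\<Union>i\<in>I. A i) \<le> (\<Sum>i\<in>I. \<mu> (A i))"
proof (induction I rule: finite_induct)
  case (insert i I)
  then show ?case using mean_Un[of "A i" "\<Union>i\<in>I. A i"] nonneg[of "A i \<inter> (\<Union>i\<in>I. A i)"] by simp
qed (simp add: mean_empty)

lemma l_coset_alt: "x \<in> carrier G \<Longrightarrow> A \<subseteq> carrier G \<Longrightarrow> x <# A = {y \<in> carrier G. inv x \<otimes> y \<in> A}"
proof (intro equalityI subsetI)
  assume c: "x \<in> carrier G" "A \<subseteq> carrier G"
  show "y \<in> {y \<in> carrier G. inv x \<otimes> y \<in> A}" if "y \<in> x <# A" for y
    using that c by (auto simp: l_coset_def inv_solve_left' m_assoc[symmetric] subset_iff)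
  show "y \<in> x <# A" if "y \<in> {y \<in> carrier G. inv x \<otimes> y \<in> A}" for y
  proof -
    have "y = x \<otimes> (inv x \<otimes> y)" using that c by (simp add: m_assoc[symmetric])
    then show ?thesis using that unfolding l_coset_def by blast
  qed
qed

lemma mean_l_coset: "x \<in> carrier G \<Longrightarrow> A \<subseteq> carrier G \<Longrightarrow> \<mu> (x <# A) = \<mu> A"
  using invariant[of "inv x" A] l_coset_alt by simp

text \<open>A crude Bonferroni inequality. It forces two of many sets of mean at least \<open>t\<close> to have a large
  intersection.\<close>
lemma mean_UN_ge:
  fixes n :: nat and s t :: real
  assumes "\<And>i. i < n \<Longrightarrow> t \<le> \<mu> (A i)" "\<And>i j. i < j \<Longrightarrow> j < n \<Longrightarrow> \<mu> (A i \<inter> A j) \<le> s" "0 \<le> s"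
  shows "n * t - n ^ 2 * s \<le> \<mu> (\<Union>i<n. A i)"
  using assms
proof (induction n)
  case (Suc n)
  have "\<mu> ((\<Union>i<n. A i) \<inter> A n) = \<mu> (\<Union>i<n. A i \<inter> A n)" by (rule arg_cong[of _ _ \<mu>]) auto
  also have "\<dots> \<le> (\<Sum>i<n. \<mu> (A i \<inter> A n))" by (rule mean_UN_le) simp
  also have "\<dots> \<le> (\<Sum>i<n. s)" by (rule sum_mono) (use Suc.prems in auto)
  finally have i: "\<mu> ((\<Union>i<n. A i) \<inter> A n) \<le> n * s" by simp
  have "(\<Union>i<Suc n. A i) = (\<Union>i<n. A i) \<union> A n" by (auto simp: lessThan_Suc)
  then have "\<mu> (\<Union>i<Suc n. A i) = \<mu> (\<Union>i<n. A i) + \<mu> (A n) - \<mu> ((\<Union>i<n. A i) \<inter> A n)"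
    by (simp only: mean_Un)
  moreover have "n * t - n ^ 2 * s \<le> \<mu> (\<Union>i<n. A i)" by (rule Suc.IH) (use Suc.prems in auto)
  moreover have "t \<le> \<mu> (A n)" by (rule Suc.prems) simp
  ultimately have "\<mu> (\<Union>i<Suc n. A i) \<ge> (n * t - n ^ 2 * s) + t - n * s" using i by linarith
  moreover have "(n * t - n ^ 2 * s) + t - n * s \<ge> Suc n * t - (Suc n) ^ 2 * s"
    using Suc.prems(3) mult_nonneg_nonneg[of "real n" s] by (simp add: algebra_simps power2_eq_square)
  ultimately show ?case by linarith
qed (simp add: mean_empty)

lemma l_coset_closed: "x \<in> carrier G \<Longrightarrow> A \<subseteq> carrier G \<Longrightarrow> x <# A \<subseteq> carrier G"
  by (auto simp: l_coset_def)

lemma l_coset_Int: "x \<in> carrier G \<Longrightarrow> A \<subseteq> carrier G \<Longrightarrow> B \<subseteq> carrier G \<Longrightarrow> x <# (A \<inter> B) = (x <# A) \<inter> (x <# B)"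
  by (auto simp: l_coset_alt le_infI1)

lemma l_coset_comp: "x \<in> carrier G \<Longrightarrow> y \<in> carrier G \<Longrightarrow> A \<subseteq> carrier G \<Longrightarrow> x <# (y <# A) = (x \<otimes> y) <# A"
  by (rule lcos_m_assoc)

lemma syndetic_mean_pos: assumes "syndetic S" "S \<subseteq> carrier G" shows "0 < \<mu> S"
proof -
  obtain F where F: "finite F" "F \<subseteq> carrier G" "carrier G \<subseteq> F <#> S" using assms by (auto simp: syndetic_def)
  have "carrier G \<subseteq> (\<Union>f\<in>F. f <# S)" using F(3) by (auto simp: set_mult_def l_coset_def)
  then have "1 \<le> \<mu> (\<Union>f\<in>F. f <# S)" using mean_mono total by metis
  also have "\<dots> \<le> (\<Sum>f\<in>F. \<mu> (f <# S))" by (rule mean_UN_le[OF F(1)])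
  also have "\<dots> = card F * \<mu> S" using F(2) assms(2) by (simp add: mean_l_coset subset_iff)
  finally have "\<mu> S \<noteq> 0" by auto
  then show ?thesis using nonneg[of S] by linarith
qed

text \<open>A non-syndetic set of return times would give \<open>n\<close> translates of \<open>B\<close> with pairwise intersections
  of mean below \<open>t\<^sup>2 / 16\<close>; with \<open>n\<close> between \<open>2 / t\<close> and \<open>3 / t\<close> their union would have mean
  at least \<open>2 - 9 / 16 > 1\<close>.\<close>
lemma syndetic_returns:
  assumes B: "B \<subseteq> carrier G" and t: "0 < t" "t \<le> \<mu> B"
  shows "syndetic {x \<in> carrier G. t\<^sup>2 / 16 \<le> \<mu> (B \<inter> (x <# B))}" (is "syndetic ?T")
proof (rule ccontr)
  assume ns: "\<not> ?thesis"
  define n where "n = nat \<lceil>2 / t\<rceil>"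
  have t1: "t \<le> 1" using t(2) mean_le_1[OF B] by linarith
  have n: "2 / t \<le> n" "n \<le> 3 / t"
  proof -
    show "2 / t \<le> n" unfolding n_def by (rule real_nat_ceiling_ge)
    have "real n \<le> 2 / t + 1" unfolding n_def using t by simp
    also have "\<dots> \<le> 3 / t" using t t1 by (simp add: field_simps)
    finally show "n \<le> 3 / t" .
  qed
  obtain x where x: "\<And>i. i < n \<Longrightarrow> x i \<in> carrier G" "\<And>i j. i < j \<Longrightarrow> j < n \<Longrightarrow> inv (x i) \<otimes> x j \<notin> ?T"
    by (rule not_syndetic_separated[OF ns, of n]) (use that in blast)
  have "n * t - n ^ 2 * (t\<^sup>2 / 16) \<le> \<mu> (\<Union>i<n. x i <# B)"
  proof (rule mean_UN_ge)
    show "t \<le> \<mu> (x i <# B)" if "i < n" for i using x(1)[OF that] B t by (simp add: mean_l_coset)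
    show "\<mu> ((x i <# B) \<inter> (x j <# B)) \<le> t\<^sup>2 / 16" if ij: "i < j" "j < n" for i j
    proof -
      have c: "x i \<in> carrier G" "x j \<in> carrier G" using ij x(1) by auto
      have "x i <# (B \<inter> ((inv (x i) \<otimes> x j) <# B)) = (x i <# B) \<inter> (x j <# B)"
        using c B by (simp add: l_coset_Int l_coset_closed l_coset_comp m_assoc[symmetric])
      then have "\<mu> ((x i <# B) \<inter> (x j <# B)) = \<mu> (B \<inter> ((inv (x i) \<otimes> x j) <# B))"
        using c B by (metis mean_l_coset le_infI1)
      then show ?thesis using x(2)[OF ij] c by auto
    qed
  qed simp
  also have "\<mu> (\<Union>i<n. x i <# B) \<le> 1" by (rule mean_le_1) (use x(1) B l_coset_closed in blast)
  finally have "n * t - (n * t) ^ 2 / 16 \<le> 1" by (simp add: power_mult_distrib)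
  moreover have "2 \<le> n * t" "n * t \<le> 3" using n t by (simp_all add: field_simps)
  moreover have "(n * t) ^ 2 \<le> 3 ^ 2" by (rule power_mono) (use \<open>2 \<le> n * t\<close> \<open>n * t \<le> 3\<close> in auto)
  ultimately show False by simp
qed

lemma mean_pow_diff:
  assumes T: "T \<subseteq> carrier G" and A: "A \<subseteq> carrier G" and d: "\<And>x. x \<in> T \<Longrightarrow> \<mu> (A - (x <# A)) \<le> d"
  shows "x \<in> set_pow T k \<Longrightarrow> \<mu> (A - (x <# A)) \<le> k * d"
proof (induction k arbitrary: x)
  case 0
  then show ?case using A by (simp add: lcos_mult_one mean_empty)
next
  case (Suc k)
  then obtain a y where y: "a \<in> T" "y \<in> set_pow T k" "x = a \<otimes> y" by (auto elim: set_multE)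
  have c: "a \<in> carrier G" "y \<in> carrier G" using y T set_pow_closed[OF T, of k] by auto
  have "A - (x <# A) \<subseteq> (A - (a <# A)) \<union> (a <# (A - (y <# A)))"
  proof
    fix u assume u: "u \<in> A - (x <# A)"
    then have uc: "u \<in> carrier G" "inv x \<otimes> u \<notin> A" using c A by (auto simp: l_coset_alt y(3))
    have e: "inv x \<otimes> u = inv y \<otimes> (inv a \<otimes> u)" using c uc by (simp add: y(3) inv_mult_group m_assoc)
    show "u \<in> (A - (a <# A)) \<union> (a <# (A - (y <# A)))"
    proof (cases "inv a \<otimes> u \<in> A")
      case True
      then have "inv a \<otimes> u \<in> A - (y <# A)" using uc e c A by (simp add: l_coset_alt)
      then show ?thesis using l_coset_alt[of a "A - (y <# A)"] c A uc by blast
    next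
      case False
      then show ?thesis using u c A by (simp add: l_coset_alt)
    qed
  qed
  then have "\<mu> (A - (x <# A)) \<le> \<mu> ((A - (a <# A)) \<union> (a <# (A - (y <# A))))" by (rule mean_mono)
  also have "\<dots> \<le> \<mu> (A - (a <# A)) + \<mu> (a <# (A - (y <# A)))"
    using mean_Un nonneg by (metis add_increasing2 diff_ge_0_iff_ge le_diff_eq order_refl diff_add_cancel)
  also have "\<dots> \<le> d + k * d"
    using d[OF y(1)] Suc.IH[OF y(2)] mean_l_coset[of a "A - (y <# A)"] c(1) A
    by (simp add: Diff_subset[THEN order_trans])
  finally show ?case by (simp add: algebra_simps)
qed

text \<open>An argument of Sanders on approximate groups, with an invariant mean in place of cardinality. Let
  \<open>f r\<close> be the infimum of \<open>\<mu> (B <#> S)\<close> over all \<open>B \<subseteq> S\<close> with \<open>\<mu> B \<ge> r\<close>. Since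
  \<open>f\<close> is bounded below by \<open>\<mu> S\<close>, along the sequence \<open>t (Suc j) = (t j)\<^sup>2 / 16\<close> it cannot drop by the
  factor \<open>24 / 25\<close> at every step. At a step without such a drop take an almost optimal \<open>B\<close>, and let
  \<open>T\<close> consist of the \<open>x\<close> for which \<open>B \<inter> x B\<close> is as large as the next level. Then
  \<open>(B \<inter> x B) S\<close> fills almost all of \<open>B S\<close>, that is, \<open>x\<close> moves little of \<open>B S\<close>. Twelve such
  translations still do not make \<open>B S\<close> disjoint from itself, which puts their product into
  \<open>B S S\<inverse> B\<inverse>\<close>. The exponent 12 is what allows iteration: \<open>T\<^sup>4\<close> multiplied three times by itself stays
  in \<open>S\<^sup>4\<close>.\<close>
lemma syndetic_small_power:
  assumes S: "S \<subseteq> carrier G" "\<And>x. x \<in> S \<Longrightarrow> inv x \<in> S" "syndetic S"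
  obtains T where "T \<subseteq> carrier G" "\<one> \<in> T" "\<And>x. x \<in> T \<Longrightarrow> inv x \<in> T" "syndetic T"
    "set_pow T 12 \<subseteq> set_pow S 4"
proof -
  define c :: real where "c = 24 / 25"
  define t where "t = rec_nat (\<mu> S) (\<lambda>_ r. r\<^sup>2 / 16)"
  have t_simps: "t 0 = \<mu> S" "t (Suc j) = (t j)\<^sup>2 / 16" for j by (simp_all add: t_def)
  have S0: "0 < \<mu> S" and S1: "\<mu> S \<le> 1" using syndetic_mean_pos S mean_le_1 by auto
  have t: "0 < t j \<and> t j \<le> \<mu> S" for j
  proof (induction j)
    case (Suc j)
    have "(t j)\<^sup>2 \<le> t j" using Suc S1 by (simp add: power2_eq_square mult_left_le)
    then show ?case using Suc by (simp add: t_simps)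
  qed (use S0 in \<open>simp add: t_simps\<close>)
  define R where "R r = {\<mu> (B <#> S) |B. B \<subseteq> S \<and> r \<le> \<mu> B}" for r
  define f where "f r = Inf (R r)" for r
  have BS: "\<mu> S \<le> \<mu> (B <#> S)" if "B \<subseteq> S" "0 < \<mu> B" for B
  proof -
    obtain b where b: "b \<in> B" using \<open>0 < \<mu> B\<close> mean_empty by (metis all_not_in_conv less_irrefl)
    then have "b <# S \<subseteq> B <#> S" by (auto simp: l_coset_def set_mult_def)
    then show ?thesis using mean_mono mean_l_coset S b that by (metis subsetD)
  qed
  have bdd: "bdd_below (R r)" for r unfolding R_def using nonneg by (intro bdd_belowI[of _ 0]) auto
  have Rne: "\<mu> (S <#> S) \<in> R (t j)" for j using t unfolding R_def by blast
  have f_ge: "\<mu> S \<le> f (t j)" for j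
    unfolding f_def
  proof (rule cInf_greatest)
    show "R (t j) \<noteq> {}" using Rne by blast
    fix r assume "r \<in> R (t j)"
    then obtain B where "B \<subseteq> S" "t j \<le> \<mu> B" "r = \<mu> (B <#> S)" by (auto simp: R_def)
    then show "\<mu> S \<le> r" using BS[of B] t[of j] by linarith
  qed
  have f_le: "f r \<le> \<mu> (B <#> S)" if "B \<subseteq> S" "r \<le> \<mu> B" for B r
    unfolding f_def by (rule cInf_lower[OF _ bdd]) (use that in \<open>auto simp: R_def\<close>)
  have "\<exists>j. c * f (t j) \<le> f (t (Suc j))"
  proof (rule ccontr)
    assume "\<not> ?thesis"
    then have lt: "f (t (Suc j)) \<le> c * f (t j)" for j by (meson linorder_le_cases)
    have "f (t j) \<le> c ^ j" for j
    proof (induction j)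
      case 0
      have "f (t 0) \<le> \<mu> (S <#> S)" by (rule f_le) (auto simp: t_simps)
      also have "\<dots> \<le> 1" by (rule mean_le_1) (use S in \<open>auto simp: set_mult_def\<close>)
      finally show ?case by simp
    next
      case (Suc j)
      then show ?case using lt[of j] mult_left_mono[OF Suc, of c] by (simp add: c_def)
    qed
    moreover obtain j where "c ^ j < \<mu> S" using real_arch_pow_inv[OF S0, of c] by (auto simp: c_def)
    ultimately show False using f_ge[of j] by (smt (verit))
  qed
  then obtain j where j: "c * f (t j) \<le> f (t (Suc j))" by blast
  have fpos: "0 < f (t j)" using f_ge[of j] S0 by linarith
  then have "f (t j) < f (t j) / c" by (simp add: c_def)
  then obtain B where B: "B \<subseteq> S" "t j \<le> \<mu> B" "\<mu> (B <#> S) < f (t j) / c"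
  proof -
    obtain r where r: "r \<in> R (t j)" "r < f (t j) / c"
      using cInf_lessD[of "R (t j)" "f (t j) / c"] Rne \<open>f (t j) < f (t j) / c\<close>
      unfolding f_def by (metis empty_iff)
    then show ?thesis using that by (auto simp: R_def)
  qed
  define A where "A = B <#> S"
  have Bc: "B \<subseteq> carrier G" and A: "A \<subseteq> carrier G" using B S by (auto simp: A_def set_mult_def)
  have Apos: "0 < \<mu> A" using BS[OF B(1)] B(2) t S0 less_le_trans unfolding A_def by metis
  define T where "T = {x \<in> carrier G. (t j)\<^sup>2 / 16 \<le> \<mu> (B \<inter> (x <# B))}"
  have Tc: "T \<subseteq> carrier G" by (auto simp: T_def)
  have move: "\<mu> (A - (x <# A)) \<le> (1 - c\<^sup>2) * \<mu> A" if x: "x \<in> T" for x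
  proof -
    have xc: "x \<in> carrier G" using x Tc by auto
    have "c * (c * \<mu> A) \<le> c * f (t j)"
      using B(3) by (simp add: A_def c_def field_simps)
    also note j
    also have "f (t (Suc j)) \<le> \<mu> ((B \<inter> (x <# B)) <#> S)"
      by (rule f_le) (use B x in \<open>auto simp: T_def t_simps\<close>)
    also have "\<dots> \<le> \<mu> (A \<inter> (x <# A))"
    proof (rule mean_mono)
      have "b \<otimes> s \<in> x <# A" if bs: "b \<in> x <# B" "s \<in> S" for b s
      proof -
        obtain b' where b': "b' \<in> B" "b = x \<otimes> b'" using bs by (auto simp: l_coset_def)
        then have "b \<otimes> s = x \<otimes> (b' \<otimes> s)" using xc Bc S bs by (auto simp: m_assoc subset_iff)
        then show ?thesis using b' bs unfolding l_coset_def A_def by (auto intro: set_multI)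
      qed
      then show "(B \<inter> (x <# B)) <#> S \<subseteq> A \<inter> (x <# A)" by (auto simp: A_def elim!: set_multE intro: set_multI)
    qed
    finally show ?thesis using mean_diff[of A "x <# A"] by (simp add: power2_eq_square algebra_simps)
  qed
  show ?thesis
  proof (rule that)
    show "T \<subseteq> carrier G" by (rule Tc)
    have "(t j)\<^sup>2 / 16 \<le> t j" using t[of j] t[of "Suc j"] S1
      by (simp add: power2_eq_square mult_left_le divide_le_eq)
    then show "\<one> \<in> T" using B(2) Bc by (auto simp: T_def lcos_mult_one)
    show "inv x \<in> T" if x: "x \<in> T" for x
    proof -
      have xc: "x \<in> carrier G" using x Tc by auto
      have "inv x <# (B \<inter> (x <# B)) = (inv x <# B) \<inter> B"
        using xc Bc by (simp add: l_coset_Int l_coset_closed l_coset_comp lcos_mult_one)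
      then have "\<mu> (B \<inter> (inv x <# B)) = \<mu> (B \<inter> (x <# B))"
        using mean_l_coset[of "inv x" "B \<inter> (x <# B)"] xc Bc by (simp add: Int_commute le_infI1)
      then show ?thesis using x by (simp add: T_def)
    qed
    show "syndetic T" unfolding T_def by (rule syndetic_returns[OF Bc _ B(2)]) (use t in blast)
    show "set_pow T 12 \<subseteq> set_pow S 4"
    proof
      fix x assume x: "x \<in> set_pow T 12"
      then have xc: "x \<in> carrier G" using set_pow_closed[OF Tc] by blast
      have "\<mu> (A - (x <# A)) \<le> (12 :: nat) * ((1 - c\<^sup>2) * \<mu> A)"
        by (rule mean_pow_diff[OF Tc A move x])
      also have "\<dots> < \<mu> A" using Apos by (simp add: c_def power2_eq_square)
      finally have "A \<inter> (x <# A) \<noteq> {}" by (metis Diff_triv less_irrefl)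
      then obtain b s b' s' where e: "b \<in> B" "s \<in> S" "b' \<in> B" "s' \<in> S" "b \<otimes> s = x \<otimes> (b' \<otimes> s')"
        by (auto simp: A_def l_coset_def set_mult_def)
      then have cc: "b \<in> carrier G" "s \<in> carrier G" "b' \<in> carrier G" "s' \<in> carrier G" using Bc S by auto
      have "x = (b \<otimes> s) \<otimes> inv (b' \<otimes> s')" using e(5) cc xc by (metis inv_solve_right m_closed)
      also have "\<dots> = b \<otimes> (s \<otimes> (inv b' \<otimes> (inv s' \<otimes> \<one>)))" using cc by (simp add: inv_mult m_assoc)
      also have "\<dots> \<in> set_pow S 4"
        using e B(1) S(2) by (auto simp: numeral_eq_Suc intro!: set_multI)
      finally show "x \<in> set_pow S 4" .
    qed
  qed
qed

end

section \<open>Prenorms and seminorms\<close>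

text \<open>A prenorm induces a left-invariant quasi-metric, and thus a topology whose inversion need not be
  continuous. Seminorms are the symmetric case.\<close>
definition prenorm :: "('a, 'm) monoid_scheme \<Rightarrow> ('a \<Rightarrow> real) \<Rightarrow> bool" where
  "prenorm G L \<longleftrightarrow> L \<one>\<^bsub>G\<^esub> = 0 \<and> (\<forall>x\<in>carrier G. 0 \<le> L x) \<and>
     (\<forall>x\<in>carrier G. \<forall>y\<in>carrier G. L (x \<otimes>\<^bsub>G\<^esub> y) \<le> L x + L y)"

definition seminorm :: "('a, 'm) monoid_scheme \<Rightarrow> ('a \<Rightarrow> real) \<Rightarrow> bool" where
  "seminorm G L \<longleftrightarrow> prenorm G L \<and> (\<forall>x\<in>carrier G. L (inv\<^bsub>G\<^esub> x) = L x)"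

text \<open>The Birkhoff--Kakutani construction. An element of \<open>Q i\<close> costs at most \<open>(1/2) ^ i\<close>, and \<open>L x\<close> is the
  infimum of the total costs of factorizations of \<open>x\<close>. A factorization of cost below \<open>(1/2) ^ i\<close>
  is cut at half of its cost into two parts of cost below \<open>(1/2) ^ Suc i\<close> and a single factor between
  them; all three lie in \<open>Q (Suc i)\<close> by induction.\<close>
lemma (in group) seminorm_of_chain:
  fixes Q :: "nat \<Rightarrow> 'a set"
  assumes Q: "\<And>i. Q i \<subseteq> carrier G" "\<And>i. \<one> \<in> Q i" "\<And>i x. x \<in> Q i \<Longrightarrow> inv x \<in> Q i"
    and chain: "\<And>i x y z. x \<in> Q (Suc i) \<Longrightarrow> y \<in> Q (Suc i) \<Longrightarrow> z \<in> Q (Suc i) \<Longrightarrow> x \<otimes> y \<otimes> z \<in> Q i"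
  obtains L where "seminorm G L" "\<And>x. x \<in> carrier G \<Longrightarrow> L x \<le> 1"
    "\<And>i x. x \<in> Q i \<Longrightarrow> L x \<le> (1/2) ^ i"
    "\<And>i x. x \<in> carrier G \<Longrightarrow> L x < (1/2) ^ i \<Longrightarrow> x \<in> Q i"
proof -
  define P where "P ys = foldr (\<otimes>) ys \<one>" for ys
  have P_simps [simp]: "P [] = \<one>" "P (y # ys) = y \<otimes> P ys" for y ys by (simp_all add: P_def)
  have P_closed: "set ys \<subseteq> carrier G \<Longrightarrow> P ys \<in> carrier G" for ys by (induction ys) auto
  have P_append: "set (ys @ zs) \<subseteq> carrier G \<Longrightarrow> P (ys @ zs) = P ys \<otimes> P zs" for ys zs
    by (induction ys) (auto simp: P_closed m_assoc)
  have P_inv: "set ys \<subseteq> carrier G \<Longrightarrow> P (rev (map (\<lambda>y. inv y) ys)) = inv (P ys)" for ys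
  proof (induction ys)
    case (Cons y ys)
    have "P (rev (map (\<lambda>y. inv y) ys) @ [inv y]) = P (rev (map (\<lambda>y. inv y) ys)) \<otimes> P [inv y]"
      by (rule P_append) (use Cons.prems in auto)
    then show ?case using Cons by (simp add: inv_mult_group P_closed)
  qed auto
  have dec: "Q j \<subseteq> Q i" if "i \<le> j" for i j
    using that
  proof (induction rule: dec_induct)
    case (step n)
    have "Q (Suc n) \<subseteq> Q n"
      using chain[of _ n \<one> \<one>] Q by (metis r_one subsetD subsetI)
    then show ?case using step by blast
  qed simp
  \<comment> \<open>The value 1 keeps the cost defined outside of \<open>Q 0\<close>, whatever these sets generate.\<close>
  define C where "C y = insert 1 {(1/2 :: real) ^ i |i. y \<in> Q i}" for y
  define c where "c y = Inf (C y)" for y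
  have C_bdd: "bdd_below (C y)" for y by (rule bdd_belowI[of _ 0]) (auto simp: C_def)
  have C_ne: "C y \<noteq> {}" for y by (simp add: C_def)
  have c0: "0 \<le> c y" for y unfolding c_def by (rule cInf_greatest) (auto simp: C_def)
  have c1: "c y \<le> 1" for y unfolding c_def by (rule cInf_lower[OF _ C_bdd]) (simp add: C_def)
  have cQ: "c y \<le> (1/2) ^ i" if "y \<in> Q i" for y i
    unfolding c_def by (rule cInf_lower[OF _ C_bdd]) (use that in \<open>auto simp: C_def\<close>)
  have cD: "y \<in> Q (Suc i)" if lt: "c y < (1/2) ^ i" for y i
  proof -
    obtain r where r: "r \<in> C y" "r < (1/2) ^ i" using cInf_lessD[OF C_ne] lt unfolding c_def by metis
    have "(1/2 :: real) ^ i \<le> 1" by (simp add: power_le_one)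
    with r obtain j where j: "y \<in> Q j" "(1/2 :: real) ^ j < (1/2) ^ i" by (auto simp: C_def)
    then have "Suc i \<le> j" by (simp add: power_strict_decreasing_iff)
    then show ?thesis using dec j by blast
  qed
  have c_inv: "c (inv y) = c y" if "y \<in> carrier G" for y
  proof -
    have "inv y \<in> Q i \<longleftrightarrow> y \<in> Q i" for i using Q(3)[of "inv y" i] Q(3)[of y i] that by auto
    then show ?thesis by (simp add: c_def C_def)
  qed
  define \<sigma> where "\<sigma> ys = sum_list (map c ys)" for ys
  have \<sigma>_simps [simp]: "\<sigma> [] = 0" "\<sigma> (y # ys) = c y + \<sigma> ys" "\<sigma> (ys @ zs) = \<sigma> ys + \<sigma> zs" for y ys zs
    by (simp_all add: \<sigma>_def)
  have \<sigma>0: "0 \<le> \<sigma> ys" for ys by (induction ys) (auto simp: c0)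
  have split: "\<exists>as b cs. ys = as @ b # cs \<and> \<sigma> as \<le> s \<and> \<sigma> ys - \<sigma> as - c b \<le> \<sigma> ys - s" if "ys \<noteq> []" "0 \<le> s" "s \<le> \<sigma> ys" for ys s
    using that
  proof (induction ys arbitrary: s)
    case (Cons y ys)
    show ?case
    proof (cases "ys = [] \<or> s \<le> c y")
      case True
      then show ?thesis using Cons.prems by (intro exI[of _ "[]"] exI[of _ y] exI[of _ ys]) auto
    next
      case False
      have "\<exists>as b cs. ys = as @ b # cs \<and> \<sigma> as \<le> s - c y \<and> \<sigma> ys - \<sigma> as - c b \<le> \<sigma> ys - (s - c y)"
        by (rule Cons.IH) (use False Cons.prems in auto)
      then obtain as b cs where a: "ys = as @ b # cs" "\<sigma> as \<le> s - c y" "\<sigma> ys - \<sigma> as - c b \<le> \<sigma> ys - (s - c y)"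
        by blast
      then show ?thesis by (intro exI[of _ "y # as"] exI[of _ b] exI[of _ cs]) auto
    qed
  qed simp
  have key: "P ys \<in> Q i" if "set ys \<subseteq> carrier G" "\<sigma> ys < (1/2) ^ i" for ys i
    using that
  proof (induction "length ys" arbitrary: ys i rule: less_induct)
    case less
    show ?case
    proof (cases "ys = []")
      case False
      obtain as b cs where a: "ys = as @ b # cs" "\<sigma> as \<le> \<sigma> ys / 2" "\<sigma> ys - \<sigma> as - c b \<le> \<sigma> ys - \<sigma> ys / 2"
      proof -
        have "\<exists>as b cs. ys = as @ b # cs \<and> \<sigma> as \<le> \<sigma> ys / 2 \<and> \<sigma> ys - \<sigma> as - c b \<le> \<sigma> ys - \<sigma> ys / 2"
          by (rule split[OF False]) (use \<sigma>0[of ys] in auto)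
        then show ?thesis using that by blast
      qed
      have "\<sigma> ys = \<sigma> as + c b + \<sigma> cs" using a(1) by simp
      then have cs: "\<sigma> cs \<le> \<sigma> ys / 2" and b: "c b \<le> \<sigma> ys"
        using a(2,3) \<sigma>0[of as] \<sigma>0[of cs] by linarith+
      have h: "\<sigma> ys / 2 < (1/2) ^ Suc i" using less.prems(2) by simp
      have "P as \<in> Q (Suc i)" by (rule less.hyps) (use a less.prems h in auto)
      moreover have "P cs \<in> Q (Suc i)" by (rule less.hyps) (use a cs less.prems h in auto)
      moreover have "b \<in> Q (Suc i)" using cD b less.prems(2) by fastforce
      ultimately have "P as \<otimes> b \<otimes> P cs \<in> Q i" by (intro chain)
      moreover have "P ys = P as \<otimes> (b \<otimes> P cs)" using P_append[of as "b # cs"] less.prems(1) a(1) by simp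
      ultimately show ?thesis using less.prems(1) a(1) P_closed by (simp add: m_assoc)
    qed (simp add: Q)
  qed
  define W where "W x = {\<sigma> ys |ys. set ys \<subseteq> carrier G \<and> P ys = x}" for x
  define L where "L x = Inf (W x)" for x
  have W_bdd: "bdd_below (W x)" for x by (rule bdd_belowI[of _ 0]) (use \<sigma>0 in \<open>auto simp: W_def\<close>)
  have W1: "c x \<in> W x" if "x \<in> carrier G" for x
    unfolding W_def by (rule CollectI, rule exI[of _ "[x]"]) (use that in simp)
  have Lc: "L x \<le> c x" if "x \<in> carrier G" for x
    unfolding L_def by (rule cInf_lower[OF W1[OF that] W_bdd])
  have L0: "0 \<le> L x" if "x \<in> carrier G" for x
    unfolding L_def by (rule cInf_greatest) (use W1[OF that] \<sigma>0 in \<open>auto simp: W_def\<close>)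
  have LD: "\<exists>ys. set ys \<subseteq> carrier G \<and> P ys = x \<and> \<sigma> ys < r" if "x \<in> carrier G" "L x < r" for x r
    using cInf_lessD[of "W x" r] W1[OF that(1)] that(2) by (auto simp: L_def W_def)
  have LI: "L (P ys) \<le> \<sigma> ys" if "set ys \<subseteq> carrier G" for ys
    unfolding L_def by (rule cInf_lower[OF _ W_bdd]) (use that in \<open>auto simp: W_def\<close>)
  have Linv: "L (inv x) \<le> L x" if x: "x \<in> carrier G" for x
  proof (rule field_le_epsilon)
    fix e :: real assume "e > 0"
    then obtain ys where ys: "set ys \<subseteq> carrier G" "P ys = x" "\<sigma> ys < L x + e" using LD[OF x, of "L x + e"] by auto
    have "\<sigma> (rev (map (\<lambda>y. inv y) ys)) = \<sigma> ys" using ys(1) by (induction ys) (auto simp: c_inv)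
    then have "L (inv x) \<le> \<sigma> ys" using LI[of "rev (map (\<lambda>y. inv y) ys)"] P_inv[OF ys(1)] ys by auto
    then show "L (inv x) \<le> L x + e" using ys by linarith
  qed
  show ?thesis
  proof (rule that[of L])
    have "L (x \<otimes> y) \<le> L x + L y" if x: "x \<in> carrier G" and y: "y \<in> carrier G" for x y
    proof (rule field_le_epsilon)
      fix e :: real assume "e > 0"
      then obtain ys zs where "set ys \<subseteq> carrier G" "P ys = x" "\<sigma> ys < L x + e / 2"
        "set zs \<subseteq> carrier G" "P zs = y" "\<sigma> zs < L y + e / 2"
        using LD[OF x, of "L x + e / 2"] LD[OF y, of "L y + e / 2"] by auto
      then show "L (x \<otimes> y) \<le> L x + L y + e" using LI[of "ys @ zs"] P_append[of ys zs] by auto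
    qed
    moreover have "L \<one> = 0" using LI[of "[]"] L0[of \<one>] by simp
    moreover have "L (inv x) = L x" if "x \<in> carrier G" for x
      using Linv[OF that] Linv[of "inv x"] that by simp
    ultimately show "seminorm G L" using L0 by (auto simp: seminorm_def prenorm_def)
    show "L x \<le> 1" if "x \<in> carrier G" for x using Lc[OF that] c1[of x] by linarith
    show "L x \<le> (1/2) ^ i" if "x \<in> Q i" for x i using Lc[of x] cQ[OF that] Q(1) that by fastforce
    show "x \<in> Q i" if "x \<in> carrier G" "L x < (1/2) ^ i" for x i using LD[OF that] key by auto
  qed
qed

lemma seminormD:
  assumes "seminorm G L"
  shows "L \<one>\<^bsub>G\<^esub> = 0" "x \<in> carrier G \<Longrightarrow> 0 \<le> L x" "x \<in> carrier G \<Longrightarrow> L (inv\<^bsub>G\<^esub> x) = L x"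
    "x \<in> carrier G \<Longrightarrow> y \<in> carrier G \<Longrightarrow> L (x \<otimes>\<^bsub>G\<^esub> y) \<le> L x + L y"
  using assms by (auto simp: seminorm_def prenorm_def)

lemma (in group) seminorm_nat_pow:
  assumes "seminorm G L" "x \<in> carrier G"
  shows "L (x [^] (n::nat)) \<le> n * L x"
proof (induction n)
  case (Suc n)
  have "L (x [^] n \<otimes> x) \<le> L (x [^] n) + L x" by (rule seminormD(4)[OF assms(1)]) (use assms in auto)
  then show ?case using Suc by (simp add: algebra_simps)
qed (simp add: seminormD[OF assms(1)])

lemma (in group) seminorm_int_pow:
  assumes "seminorm G L" "x \<in> carrier G"
  shows "L (x [^] (e::int)) \<le> \<bar>e\<bar> * L x"
proof (cases e rule: int_cases2)
  case (nonneg n)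
  then show ?thesis using seminorm_nat_pow[OF assms, of n] by (simp add: int_pow_int)
next
  case (nonpos n)
  then show ?thesis using seminorm_nat_pow[OF assms, of n] assms
    by (simp add: int_pow_neg_int seminormD(3)[OF assms(1)])
qed

context comm_group
begin

lemma seminorm_finprod:
  assumes L: "seminorm G L" and "finite K" "\<And>k. k \<in> K \<Longrightarrow> x k \<in> carrier G"
  shows "L (finprod G x K) \<le> (\<Sum>k\<in>K. L (x k))"
  using assms(2,3)
proof (induction K rule: finite_induct)
  case (insert k K)
  have "L (x k \<otimes> finprod G x K) \<le> L (x k) + L (finprod G x K)"
    by (rule seminormD(4)[OF L]) (use insert in \<open>auto intro!: finprod_closed\<close>)
  then show ?case using insert by (simp add: Pi_def)
qed (simp add: seminormD[OF L])

lemma finprod_int_pow: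
  assumes "finite K" "\<And>k. k \<in> K \<Longrightarrow> x k \<in> carrier G"
  shows "finprod G (\<lambda>k. x k [^] (c::int)) K = finprod G x K [^] c"
  using assms
proof (induction K rule: finite_induct)
  case (insert k K)
  have "finprod G x K \<in> carrier G" by (rule finprod_closed) (use insert in auto)
  then show ?case using insert by (simp add: Pi_def int_pow_distrib)
qed simp

section \<open>Words and covered powers\<close>

text \<open>Exponent vectors \<open>e\<close> of finite support act as elements of the free abelian group over the index
  type; \<open>word z\<close> is the homomorphism that sends the generators to \<open>z\<close>.\<close>
definition word :: "('k \<Rightarrow> 'a) \<Rightarrow> ('k \<Rightarrow> int) \<Rightarrow> 'a" where
  "word z e = finprod G (\<lambda>k. z k [^] e k) {k. e k \<noteq> 0}"

lemma mult_mult_inv_cancel: "f \<in> carrier G \<Longrightarrow> x \<in> carrier G \<Longrightarrow> f \<otimes> (x \<otimes> inv f) = x"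
  by (metis inv_closed m_lcomm r_inv r_one)

lemma word_eq:
  assumes "\<And>k. z k \<in> carrier G" "finite K" "{k. e k \<noteq> 0} \<subseteq> K"
  shows "word z e = finprod G (\<lambda>k. z k [^] e k) K"
  unfolding word_def by (rule finprod_mono_neutral_cong_left) (use assms in auto)

lemma word_closed: "(\<And>k. z k \<in> carrier G) \<Longrightarrow> word z e \<in> carrier G"
  unfolding word_def by (rule finprod_closed) auto

lemma word_zero: "word z (\<lambda>k. 0) = \<one>"
  by (simp add: word_def)

lemma word_add:
  assumes z: "\<And>k. z k \<in> carrier G" and "finite {k. e k \<noteq> 0}" "finite {k. e' k \<noteq> 0}"
  shows "word z (\<lambda>k. e k + e' k) = word z e \<otimes> word z e'"
proof -
  let ?K = "{k. e k \<noteq> 0} \<union> {k. e' k \<noteq> 0}"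
  have "word z (\<lambda>k. e k + e' k) = finprod G (\<lambda>k. z k [^] (e k + e' k)) ?K"
    by (rule word_eq[OF z]) (use assms in auto)
  also have "\<dots> = finprod G (\<lambda>k. z k [^] e k \<otimes> z k [^] e' k) ?K"
    by (rule finprod_cong') (auto simp: z int_pow_mult)
  also have "\<dots> = finprod G (\<lambda>k. z k [^] e k) ?K \<otimes> finprod G (\<lambda>k. z k [^] e' k) ?K"
    by (rule finprod_multf) (auto simp: z)
  also have "\<dots> = word z e \<otimes> word z e'"
    using word_eq[OF z, of ?K e] word_eq[OF z, of ?K e'] assms by auto
  finally show ?thesis .
qed

lemma word_mult:
  assumes z: "\<And>k. z k \<in> carrier G" and "finite {k. e k \<noteq> 0}"
  shows "word z (\<lambda>k. e k * c) = word z e [^] c"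
proof -
  have "word z (\<lambda>k. e k * c) = finprod G (\<lambda>k. z k [^] (e k * c)) {k. e k \<noteq> 0}"
    by (rule word_eq[OF z]) (use assms in auto)
  also have "\<dots> = finprod G (\<lambda>k. (z k [^] e k) [^] c) {k. e k \<noteq> 0}"
    by (rule finprod_cong') (auto simp: z int_pow_pow)
  finally show ?thesis by (simp add: word_def finprod_int_pow assms)
qed

lemma word_minus:
  assumes z: "\<And>k. z k \<in> carrier G" and "finite {k. e k \<noteq> 0}"
  shows "word z (\<lambda>k. - e k) = inv (word z e)"
  using word_mult[OF assms, where c = "-1"] by (simp add: int_pow_neg word_closed[OF z])

lemma word_single: "z k \<in> carrier G \<Longrightarrow> word z (\<lambda>j. if j = k then c else 0) = z k [^] (c::int)"
proof (cases "c = 0")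
  case False
  assume "z k \<in> carrier G"
  moreover have "{j. (if j = k then c else 0) \<noteq> 0} = {k}" using False by auto
  ultimately show ?thesis unfolding word_def by (simp add: Pi_def)
qed (simp add: word_def)

text \<open>Total boundedness at scale \<open>\<epsilon>\<close> of the set of \<open>e\<close>-th powers. Integer exponents make the exponents that
  work for every \<open>\<epsilon>\<close> an ideal.\<close>
definition powers_covered :: "('a \<Rightarrow> real) \<Rightarrow> int \<Rightarrow> real \<Rightarrow> bool" where
  "powers_covered L e \<epsilon> \<longleftrightarrow> (\<exists>F. finite F \<and> F \<subseteq> carrier G \<and> (\<forall>z\<in>carrier G. \<exists>f\<in>F. L (z [^] e \<otimes> inv f) < \<epsilon>))"

text \<open>The ideal of the exponents \<open>e\<close> whose powers are totally bounded for \<open>L\<close> is generated by \<open>n\<close>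
  (with \<open>n = 0\<close> for the zero ideal), and one scale detects all exponents outside of the ideal.
  Uniformity of the scale is a restriction if \<open>n = 0\<close>: the powers could be totally bounded at
  each single scale for some positive exponent.\<close>
definition tame :: "('a \<Rightarrow> real) \<Rightarrow> nat \<Rightarrow> bool" where
  "tame L n \<longleftrightarrow> seminorm G L \<and> (\<forall>\<epsilon>>0. powers_covered L (int n) \<epsilon>) \<and>
     (\<exists>\<epsilon>>0. \<forall>e. \<not> int n dvd e \<longrightarrow> \<not> powers_covered L e \<epsilon>)"

lemma powers_covered_mono: "powers_covered L e \<epsilon> \<Longrightarrow> \<epsilon> \<le> \<epsilon>' \<Longrightarrow> powers_covered L e \<epsilon>'"
  unfolding powers_covered_def by (meson less_le_trans)

lemma powers_covered_dvd:
  assumes "powers_covered L e \<epsilon>" "e dvd d" shows "powers_covered L d \<epsilon>"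
proof -
  obtain F where F: "finite F" "F \<subseteq> carrier G" "\<And>z. z \<in> carrier G \<Longrightarrow> \<exists>f\<in>F. L (z [^] e \<otimes> inv f) < \<epsilon>"
    using assms(1) unfolding powers_covered_def by blast
  obtain c where c: "d = e * c" using assms(2) by blast
  have "\<exists>f\<in>F. L (z [^] d \<otimes> inv f) < \<epsilon>" if z: "z \<in> carrier G" for z
    using F(3)[of "z [^] c"] z by (simp add: c int_pow_pow mult.commute)
  then show ?thesis unfolding powers_covered_def using F by blast
qed

lemma powers_covered_diff:
  assumes L: "seminorm G L" and "powers_covered L e \<epsilon>" "powers_covered L e' \<epsilon>'"
  shows "powers_covered L (e - e') (\<epsilon> + \<epsilon>')"
proof -
  obtain F F' where F: "finite F" "F \<subseteq> carrier G" "\<And>z. z \<in> carrier G \<Longrightarrow> \<exists>f\<in>F. L (z [^] e \<otimes> inv f) < \<epsilon>"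
    "finite F'" "F' \<subseteq> carrier G" "\<And>z. z \<in> carrier G \<Longrightarrow> \<exists>f\<in>F'. L (z [^] e' \<otimes> inv f) < \<epsilon>'"
    using assms(2,3) unfolding powers_covered_def by metis
  let ?F = "(\<lambda>(f, f'). f \<otimes> inv f') ` (F \<times> F')"
  have "\<exists>f\<in>?F. L (z [^] (e - e') \<otimes> inv f) < \<epsilon> + \<epsilon>'" if z: "z \<in> carrier G" for z
  proof -
    obtain f f' where f: "f \<in> F" "L (z [^] e \<otimes> inv f) < \<epsilon>" "f' \<in> F'" "L (z [^] e' \<otimes> inv f') < \<epsilon>'"
      using F(3,6)[OF z] by blast
    have c: "f \<in> carrier G" "f' \<in> carrier G" using f F by auto
    have "z [^] (e - e') \<otimes> inv (f \<otimes> inv f') = (z [^] e \<otimes> inv f) \<otimes> inv (z [^] e' \<otimes> inv f')"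
      using z c by (simp add: int_pow_diff inv_mult m_ac)
    then have "L (z [^] (e - e') \<otimes> inv (f \<otimes> inv f')) \<le> L (z [^] e \<otimes> inv f) + L (z [^] e' \<otimes> inv f')"
      using seminormD(4)[OF L, of "z [^] e \<otimes> inv f" "inv (z [^] e' \<otimes> inv f')"]
        seminormD(3)[OF L, of "z [^] e' \<otimes> inv f'"] z c by simp
    then show ?thesis using f by (intro bexI[of _ "f \<otimes> inv f'"]) auto
  qed
  moreover have "finite ?F" "?F \<subseteq> carrier G" using F(1,2,4,5) by (auto simp: subset_iff)
  ultimately show ?thesis unfolding powers_covered_def by blast
qed

section \<open>Tame seminorms\<close>

text \<open>If no set of positive powers is covered by finitely many translates of \<open>U 0\<close>, the seminorm of the
  chain is tame with \<open>n = 0\<close>. Otherwise some group \<open>M\<close> of \<open>m\<close>-th powers is covered. Then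
  \<open>M \<inter> (U 0)\<^sup>2\<close> is syndetic in \<open>M\<close>, and iterating \<open>syndetic_small_power\<close> gives a chain of
  syndetic subsets \<open>Q i\<close> of \<open>M\<close>, that is, a totally bounded group topology on \<open>M\<close> in which
  \<open>(U 0)\<^sup>8\<close> is a neighborhood of the unit. The products \<open>Q i <#> U i\<close> form a chain in the whole
  group. For its seminorm the \<open>m\<close>-th powers are totally bounded, so that the ideal of exponents is not zero and
  only the finitely many exponents below its generator have to be detected by one scale.\<close>
lemma tame_of_chain:
  fixes U :: "nat \<Rightarrow> 'a set"
  assumes U: "\<And>i. U i \<subseteq> carrier G" "\<And>i. \<one> \<in> U i" "\<And>i x. x \<in> U i \<Longrightarrow> inv x \<in> U i"
    and chain: "\<And>i x y z. x \<in> U (Suc i) \<Longrightarrow> y \<in> U (Suc i) \<Longrightarrow> z \<in> U (Suc i) \<Longrightarrow> x \<otimes> y \<otimes> z \<in> U i"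
  obtains L n where "tame L n" "\<And>i x. x \<in> U i \<Longrightarrow> L x \<le> (1/2) ^ i"
    "\<And>x. x \<in> carrier G \<Longrightarrow> L x < 1 \<Longrightarrow> x \<in> set_pow (U 0) 9"
proof (cases "\<exists>m F. (m::nat) \<ge> 1 \<and> finite F \<and> F \<subseteq> carrier G \<and> (\<forall>z\<in>carrier G. z [^] m \<in> F <#> U 0)")
  case False
  obtain L where L: "seminorm G L" "\<And>i x. x \<in> U i \<Longrightarrow> L x \<le> (1/2) ^ i"
    "\<And>i x. x \<in> carrier G \<Longrightarrow> L x < (1/2) ^ i \<Longrightarrow> x \<in> U i"
    using seminorm_of_chain[of U] U chain by metis
  have "powers_covered L 0 \<epsilon>" if "\<epsilon> > 0" for \<epsilon>
    unfolding powers_covered_def by (rule exI[of _ "{\<one>}"]) (use that in \<open>simp add: seminormD[OF L(1)]\<close>)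
  moreover have "\<not> powers_covered L e 1" if "e \<noteq> 0" for e
  proof
    assume "powers_covered L e 1"
    then have "powers_covered L (int (nat \<bar>e\<bar>)) 1" by (rule powers_covered_dvd) simp
    then obtain F where F: "finite F" "F \<subseteq> carrier G"
      "\<And>z. z \<in> carrier G \<Longrightarrow> \<exists>f\<in>F. L (z [^] nat \<bar>e\<bar> \<otimes> inv f) < 1"
      unfolding powers_covered_def int_pow_int by metis
    have "z [^] nat \<bar>e\<bar> \<in> F <#> U 0" if z: "z \<in> carrier G" for z
    proof -
      obtain f where f: "f \<in> F" "L (z [^] nat \<bar>e\<bar> \<otimes> inv f) < 1" using F(3)[OF z] by blast
      then have c: "f \<in> carrier G" using F by auto
      then have "z [^] nat \<bar>e\<bar> \<otimes> inv f \<in> U 0" using L(3)[of _ 0] f z by simp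
      then have "f \<otimes> (z [^] nat \<bar>e\<bar> \<otimes> inv f) \<in> F <#> U 0" using f(1) by (rule set_multI[rotated])
      moreover have "f \<otimes> (z [^] nat \<bar>e\<bar> \<otimes> inv f) = z [^] nat \<bar>e\<bar>"
        using c z by (intro mult_mult_inv_cancel) auto
      ultimately show ?thesis by simp
    qed
    moreover have "nat \<bar>e\<bar> \<ge> 1" using that by simp
    ultimately show False using False F by blast
  qed
  ultimately have "tame L 0" unfolding tame_def using L(1) by (intro conjI exI[of _ 1]) auto
  moreover have "U 0 \<subseteq> set_pow (U 0) 9"
  proof -
    have "U 0 = set_pow (U 0) 1 <#> {\<one>}" using U(1)[of 0] set_pow_one[OF U(1)] by (force simp: set_mult_def)
    also have "\<dots> \<subseteq> set_pow (U 0) 1 <#> set_pow (U 0) 8"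
      by (rule mono_set_mult) (use one_set_pow[OF U(2)] in auto)
    also have "\<dots> = set_pow (U 0) (1 + 8)" by (rule set_pow_add[OF U(1), symmetric])
    finally show ?thesis by simp
  qed
  ultimately show ?thesis using L(2) L(3)[of _ 0] by (intro that) auto
next
  case True
  then obtain m F where m: "(m::nat) \<ge> 1" and F: "finite F" "F \<subseteq> carrier G"
    "\<And>z. z \<in> carrier G \<Longrightarrow> z [^] m \<in> F <#> U 0" by blast
  define M where "M = (\<lambda>z. z [^] m) ` carrier G"
  define H where "H = G\<lparr>carrier := M\<rparr>"
  have Mc: "M \<subseteq> carrier G" by (auto simp: M_def)
  have M: "subgroup M G"
  proof (rule subgroupI)
    show "M \<subseteq> carrier G" by (rule Mc)
    show "M \<noteq> {}" by (auto simp: M_def)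
    show "inv a \<in> M" if "a \<in> M" for a using that by (auto simp: M_def nat_pow_inv[symmetric])
    show "a \<otimes> b \<in> M" if "a \<in> M" "b \<in> M" for a b using that by (auto simp: M_def pow_mult_distrib[symmetric] m_comm)
  qed
  interpret H: comm_group H
  proof (rule group.group_comm_groupI)
    show "group H" unfolding H_def by (rule subgroup.subgroup_is_group[OF M is_group])
    show "x \<otimes>\<^bsub>H\<^esub> y = y \<otimes>\<^bsub>H\<^esub> x" if "x \<in> carrier H" "y \<in> carrier H" for x y
      using that Mc by (auto simp: H_def intro: m_comm)
  qed
  have Hs [simp]: "carrier H = M" "x \<otimes>\<^bsub>H\<^esub> y = x \<otimes> y" "\<one>\<^bsub>H\<^esub> = \<one>" for x y by (simp_all add: H_def)
  have Hinv: "inv\<^bsub>H\<^esub> x = inv x" if "x \<in> M" for x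
    unfolding H_def using M that by (simp add: m_inv_consistent)
  have Hset: "A <#>\<^bsub>H\<^esub> B = A <#> B" for A B by (simp add: set_mult_def)
  have Hpow: "H.set_pow A k = set_pow A k" for A k by (induction k) (simp_all add: Hset)
  obtain \<mu> where "invariant_mean H \<mu>" using H.invariant_mean_exists by blast
  then interpret \<mu>: invariant_mean H \<mu> .
  define S where "S = M \<inter> set_pow (U 0) 2"
  have U2: "set_pow (U 0) 2 = U 0 <#> U 0" using set_pow_add[OF U(1), of 0 1 1] set_pow_one[OF U(1)] by (simp add: numeral_2_eq_2)
  have S: "S \<subseteq> M" "\<And>x. x \<in> S \<Longrightarrow> inv x \<in> S" "\<one> \<in> S"
    using set_pow_inv[OF U(1) U(3)] subgroup.m_inv_closed[OF M] subgroup.one_closed[OF M] one_set_pow[OF U(2)]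
    by (auto simp: S_def)
  have "H.syndetic S"
  proof -
    define F0 where "F0 = {f \<in> F. \<exists>u\<in>U 0. f \<otimes> u \<in> M}"
    have "\<forall>f\<in>F0. \<exists>u. u \<in> U 0 \<and> f \<otimes> u \<in> M" by (auto simp: F0_def)
    then obtain u where u: "\<And>f. f \<in> F0 \<Longrightarrow> u f \<in> U 0 \<and> f \<otimes> u f \<in> M" by metis
    have "x \<in> (\<lambda>f. f \<otimes> u f) ` F0 <#> S" if x: "x \<in> M" for x
    proof -
      have "x \<in> F <#> U 0" using x F(3) by (auto simp: M_def)
      then obtain f v where fv: "f \<in> F" "v \<in> U 0" "x = f \<otimes> v" by (rule set_multE)
      then have f0: "f \<in> F0" using x by (auto simp: F0_def)
      have c: "f \<in> carrier G" "v \<in> carrier G" "u f \<in> carrier G" using fv F U u[OF f0] by auto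
      have "inv (f \<otimes> u f) \<otimes> x = inv (u f) \<otimes> v"
        using c fv by (simp add: inv_mult_group m_assoc) (simp add: m_assoc[symmetric])
      moreover have "inv (f \<otimes> u f) \<otimes> x \<in> M"
        using subgroup.m_closed[OF M] subgroup.m_inv_closed[OF M] u[OF f0] x by auto
      ultimately have "inv (f \<otimes> u f) \<otimes> x \<in> S" unfolding S_def U2 using fv u[OF f0] U(3) by (auto intro: set_multI)
      then have "(f \<otimes> u f) \<otimes> (inv (f \<otimes> u f) \<otimes> x) \<in> (\<lambda>f. f \<otimes> u f) ` F0 <#> S" using f0 by (intro set_multI) auto
      then show ?thesis using c fv by (simp add: m_assoc[symmetric])
    qed
    moreover have "finite F0" using F by (simp add: F0_def)
    ultimately show ?thesis unfolding H.syndetic_def using u by (intro exI[of _ "(\<lambda>f. f \<otimes> u f) ` F0"]) (auto simp: Hset)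
  qed
  define good where "good T \<longleftrightarrow> T \<subseteq> M \<and> \<one> \<in> T \<and> (\<forall>x\<in>T. inv x \<in> T) \<and> H.syndetic T" for T
  have "\<exists>T. \<forall>i. good (T i) \<and> (T 0 \<subseteq> S) \<and> set_pow (T (Suc i)) 12 \<subseteq> set_pow (T i) 4"
  proof -
    have "\<exists>T. \<forall>i. (good (T i) \<and> (i = 0 \<longrightarrow> T i \<subseteq> S)) \<and> set_pow (T (Suc i)) 12 \<subseteq> set_pow (T i) 4"
    proof (rule dependent_nat_choice)
      show "\<exists>x. good x \<and> ((0::nat) = 0 \<longrightarrow> x \<subseteq> S)" using S \<open>H.syndetic S\<close> by (auto simp: good_def)
      fix x and n :: nat assume x: "good x \<and> (n = 0 \<longrightarrow> x \<subseteq> S)"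
      then have xM: "x \<subseteq> M" "\<And>y. y \<in> x \<Longrightarrow> inv y \<in> x" "H.syndetic x" by (auto simp: good_def)
      then have "\<And>y. y \<in> x \<Longrightarrow> inv\<^bsub>H\<^esub> y \<in> x" using Hinv by (metis subsetD)
      with xM obtain T where "T \<subseteq> M" "\<one> \<in> T" "\<And>x. x \<in> T \<Longrightarrow> inv\<^bsub>H\<^esub> x \<in> T" "H.syndetic T"
        "set_pow T 12 \<subseteq> set_pow x 4"
        using \<mu>.syndetic_small_power[of x, unfolded Hpow Hs] by blast
      then show "\<exists>y. (good y \<and> (Suc n = 0 \<longrightarrow> y \<subseteq> S)) \<and> set_pow y 12 \<subseteq> set_pow x 4"
        using Hinv unfolding good_def by (intro exI[of _ T]) (metis nat.distinct(1) subsetD)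
    qed
    then show ?thesis by blast
  qed
  then obtain T where T: "\<And>i. good (T i)" "T 0 \<subseteq> S" "\<And>i. set_pow (T (Suc i)) 12 \<subseteq> set_pow (T i) 4" by blast
  have Tc: "T i \<subseteq> carrier G" for i using T(1) Mc by (auto simp: good_def)
  define Q where "Q i = set_pow (T i) 4" for i
  have Q: "Q i \<subseteq> carrier G" "\<one> \<in> Q i" "x \<in> Q i \<Longrightarrow> inv x \<in> Q i" for i x
    using set_pow_closed[OF Tc] one_set_pow set_pow_inv[OF Tc] T(1) by (auto simp: Q_def good_def)
  have Q3: "x \<otimes> y \<otimes> z \<in> Q i" if "x \<in> Q (Suc i)" "y \<in> Q (Suc i)" "z \<in> Q (Suc i)" for x y z i
  proof -
    have "x \<otimes> y \<otimes> z \<in> set_pow (T (Suc i)) (4 + 4 + 4)"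
      unfolding set_pow_add[OF Tc] using that by (auto simp: Q_def intro!: set_multI)
    then show ?thesis using T(3)[of i] by (auto simp: Q_def)
  qed
  have TQ: "T i \<subseteq> Q i" for i
  proof -
    have "T i = set_pow (T i) 1 <#> {\<one>}" using Tc[of i] set_pow_one[OF Tc] by (force simp: set_mult_def)
    also have "\<dots> \<subseteq> set_pow (T i) 1 <#> set_pow (T i) 3"
      by (rule mono_set_mult) (use one_set_pow T(1) in \<open>auto simp: good_def\<close>)
    also have "\<dots> = set_pow (T i) (1 + 3)" by (rule set_pow_add[OF Tc, symmetric])
    finally show ?thesis by (simp add: Q_def)
  qed
  define V where "V i = Q i <#> U i" for i
  have UV: "U i \<subseteq> V i" for i
  proof
    fix x assume "x \<in> U i"
    moreover from this have "x \<in> carrier G" using U(1) by blast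
    ultimately show "x \<in> V i" using set_multI[OF Q(2), of x "U i" i] by (simp add: V_def)
  qed
  have QV: "Q i \<subseteq> V i" for i
  proof
    fix x assume "x \<in> Q i"
    moreover from this have "x \<in> carrier G" using Q(1) by blast
    ultimately show "x \<in> V i" using set_multI[OF _ U(2), of x "Q i" i] by (simp add: V_def)
  qed
  obtain L where L: "seminorm G L" "\<And>i x. x \<in> V i \<Longrightarrow> L x \<le> (1/2) ^ i"
    "\<And>i x. x \<in> carrier G \<Longrightarrow> L x < (1/2) ^ i \<Longrightarrow> x \<in> V i"
  proof (rule seminorm_of_chain[of V])
    show "V i \<subseteq> carrier G" for i unfolding V_def by (rule set_mult_closed[OF Q(1) U(1)])
    show "\<one> \<in> V i" for i using UV U by blast
    show "inv x \<in> V i" if x: "x \<in> V i" for x i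
    proof -
      obtain q u where qu: "q \<in> Q i" "u \<in> U i" "x = q \<otimes> u" using x unfolding V_def by (rule set_multE)
      then have "inv x = inv q \<otimes> inv u" using Q U by (simp add: inv_mult subset_iff)
      then show ?thesis using qu Q(3) U(3) by (auto simp: V_def intro: set_multI)
    qed
    show "x \<otimes> y \<otimes> z \<in> V i" if x: "x \<in> V (Suc i)" "y \<in> V (Suc i)" "z \<in> V (Suc i)" for x y z i
    proof -
      obtain q1 u1 q2 u2 q3 u3 where qu: "q1 \<in> Q (Suc i)" "u1 \<in> U (Suc i)" "x = q1 \<otimes> u1"
        "q2 \<in> Q (Suc i)" "u2 \<in> U (Suc i)" "y = q2 \<otimes> u2" "q3 \<in> Q (Suc i)" "u3 \<in> U (Suc i)" "z = q3 \<otimes> u3"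
        using x unfolding V_def by (metis set_multE)
      then have "q1 \<in> carrier G" "u1 \<in> carrier G" "q2 \<in> carrier G" "u2 \<in> carrier G" "q3 \<in> carrier G" "u3 \<in> carrier G"
        using Q(1) U(1) by blast+
      then have "x \<otimes> y \<otimes> z = (q1 \<otimes> q2 \<otimes> q3) \<otimes> (u1 \<otimes> u2 \<otimes> u3)" using qu by (simp add: m_ac)
      then show ?thesis using Q3 chain qu by (auto simp: V_def intro!: set_multI)
    qed
  qed (use that in blast)
  have covered_m: "powers_covered L (int m) \<epsilon>" if "\<epsilon> > 0" for \<epsilon>
  proof -
    obtain i where i: "(1/2 :: real) ^ i < \<epsilon>" using real_arch_pow_inv[OF \<open>\<epsilon> > 0\<close>, of "1/2"] by auto
    obtain F' where F': "finite F'" "F' \<subseteq> M" "M \<subseteq> F' <#> T i" using T(1)[of i] by (auto simp: good_def H.syndetic_def Hset)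
    have "\<exists>f\<in>F'. L (z [^] m \<otimes> inv f) < \<epsilon>" if z: "z \<in> carrier G" for z
    proof -
      have "z [^] m \<in> F' <#> T i" using F'(3) z by (auto simp: M_def)
      then obtain f t where ft: "f \<in> F'" "t \<in> T i" "z [^] m = f \<otimes> t" by (rule set_multE)
      then have c: "f \<in> carrier G" "t \<in> carrier G" using F' Mc Tc[of i] by auto
      then have "z [^] m \<otimes> inv f = t" using ft by (simp add: m_assoc mult_mult_inv_cancel)
      moreover have "L t \<le> (1/2) ^ i" using L(2) QV TQ ft by blast
      ultimately show ?thesis using ft i by (intro bexI[of _ f]) auto
    qed
    then show ?thesis unfolding powers_covered_def int_pow_int using F' Mc by (intro exI[of _ F']) auto
  qed
  define n where "n = (LEAST n::nat. n \<ge> 1 \<and> (\<forall>\<epsilon>>0. powers_covered L (int n) \<epsilon>))"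
  have n: "n \<ge> 1" "\<And>\<epsilon>. \<epsilon> > 0 \<Longrightarrow> powers_covered L (int n) \<epsilon>"
    using LeastI[of "\<lambda>n. n \<ge> 1 \<and> (\<forall>\<epsilon>>0. powers_covered L (int n) \<epsilon>)" m] m covered_m unfolding n_def by blast+
  have "\<exists>\<epsilon>>0. \<not> powers_covered L (int b) \<epsilon>" if "b \<in> {1..<n}" for b
    using not_less_Least[of b "\<lambda>n. n \<ge> 1 \<and> (\<forall>\<epsilon>>0. powers_covered L (int n) \<epsilon>)"] that unfolding n_def by auto
  then obtain \<epsilon> where \<epsilon>: "\<And>b. b \<in> {1..<n} \<Longrightarrow> \<epsilon> b > 0 \<and> \<not> powers_covered L (int b) (\<epsilon> b)" by metis
  define \<delta> where "\<delta> = Min (insert 1 (\<epsilon> ` {1..<n}))"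
  have \<delta>: "\<delta> > 0" "\<And>b. b \<in> {1..<n} \<Longrightarrow> \<delta> \<le> \<epsilon> b"
  proof -
    show "\<delta> > 0" unfolding \<delta>_def by (subst Min_gr_iff) (use \<epsilon> in auto)
    show "\<delta> \<le> \<epsilon> b" if "b \<in> {1..<n}" for b unfolding \<delta>_def by (rule Min_le) (use that in auto)
  qed
  \<comment> \<open>Division with remainder reduces an exponent outside of the ideal to one below \<open>n\<close>.\<close>
  have nc: "\<not> powers_covered L e (\<delta> / 2)" if e: "\<not> int n dvd e" for e
  proof
    assume c: "powers_covered L e (\<delta> / 2)"
    define b where "b = nat (e mod int n)"
    have "0 \<le> e mod int n" "e mod int n < int n" "e mod int n \<noteq> 0"
      using n(1) e by (simp_all add: dvd_eq_mod_eq_0)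
    then have b: "int b = e mod int n" "b \<in> {1..<n}" unfolding b_def by auto
    have "powers_covered L (int n * (e div int n)) (\<delta> / 2)" by (rule powers_covered_dvd[OF n(2)]) (use \<delta> in auto)
    then have "powers_covered L (e - int n * (e div int n)) (\<delta> / 2 + \<delta> / 2)" by (rule powers_covered_diff[OF L(1) c])
    then have "powers_covered L (int b) \<delta>" by (simp add: b(1) minus_mult_div_eq_mod)
    then show False using \<epsilon>[OF b(2)] powers_covered_mono \<delta>(2)[OF b(2)] by blast
  qed
  have "tame L n" unfolding tame_def using L(1) n \<delta> nc by (intro conjI exI[of _ "\<delta> / 2"]) auto
  moreover have "V 0 \<subseteq> set_pow (U 0) 9"
  proof -
    have "Q 0 \<subseteq> set_pow (set_pow (U 0) 2) 4" unfolding Q_def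
      by (rule set_pow_mono) (use T(2) in \<open>auto simp: S_def\<close>)
    also have "\<dots> = set_pow (U 0) 8" using set_pow_mult[OF U(1), of 0 2 4] by simp
    finally have "V 0 \<subseteq> set_pow (U 0) 8 <#> set_pow (U 0) 1" unfolding V_def
      by (intro mono_set_mult) (use set_pow_one[OF U(1)] in auto)
    also have "\<dots> = set_pow (U 0) (8 + 1)" by (rule set_pow_add[OF U(1), symmetric])
    finally show ?thesis by simp
  qed
  moreover have "L x \<le> (1/2) ^ i" if "x \<in> U i" for i x using L(2) UV that by blast
  ultimately show ?thesis using L(3)[of _ 0] by (intro that[of L n]) auto
qed

section \<open>Independent sequences\<close>

lemma mult_inv_shift:
  assumes "a \<in> carrier G" "b \<in> carrier G" "c \<in> carrier G"
  shows "(a \<otimes> c) \<otimes> inv (b \<otimes> c) = a \<otimes> inv b"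
  using assms by (simp add: inv_mult_group m_assoc mult_inv_mult_cancel)

lemma mult_inv_shift_left:
  assumes "a \<in> carrier G" "u \<in> carrier G" "f \<in> carrier G"
  shows "(a \<otimes> u) \<otimes> inv (u \<otimes> inv f) = a \<otimes> f"
  using assms by (simp add: inv_mult m_assoc mult_inv_mult_cancel)

text \<open>For each constraint the set of bad \<open>z\<close> has infinitely many disjoint translates, since the
  \<open>e\<close>-th powers are not covered at scale \<open>\<epsilon>\<close>. Hence it has mean zero, and finitely many sets
  of mean zero do not cover the group.\<close>
lemma avoid_finitely_many:
  fixes C :: "'c set"
  assumes C: "finite C" and L: "\<And>c. c \<in> C \<Longrightarrow> seminorm G (L c)" and h: "\<And>c. c \<in> C \<Longrightarrow> h c \<in> carrier G"
    and nc: "\<And>c. c \<in> C \<Longrightarrow> \<not> powers_covered (L c) (e c) (\<epsilon> c)"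
  obtains z where "z \<in> carrier G" "\<And>c. c \<in> C \<Longrightarrow> \<epsilon> c / 2 \<le> L c (z [^] e c \<otimes> h c)"
proof -
  obtain \<mu> where "invariant_mean G \<mu>" using invariant_mean_exists by blast
  then interpret invariant_mean G \<mu> .
  define bad where "bad c = {z \<in> carrier G. L c (z [^] e c \<otimes> h c) < \<epsilon> c / 2}" for c
  have badc: "bad c \<subseteq> carrier G" for c by (auto simp: bad_def)
  have "\<mu> (bad c) = 0" if c: "c \<in> C" for c
  proof (rule ccontr)
    assume "\<mu> (bad c) \<noteq> 0"
    then have pos: "0 < \<mu> (bad c)" using nonneg[of "bad c"] by linarith
    define D where "D = {z \<in> carrier G. L c (z [^] e c) < \<epsilon> c}"
    have "\<not> syndetic D"
    proof
      assume "syndetic D"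
      then obtain F where F: "finite F" "F \<subseteq> carrier G" "carrier G \<subseteq> F <#> D" by (auto simp: syndetic_def)
      have "\<exists>f'\<in>(\<lambda>f. f [^] e c) ` F. L c (z [^] e c \<otimes> inv f') < \<epsilon> c" if z: "z \<in> carrier G" for z
      proof -
        obtain f d where f: "f \<in> F" "d \<in> D" "z = f \<otimes> d" using F(3) z by (auto simp: set_mult_def)
        then have c: "f \<in> carrier G" "d \<in> carrier G" using F by (auto simp: D_def)
        have "z [^] e c \<otimes> inv (f [^] e c) = d [^] e c"
          unfolding f(3) using c by (simp add: int_pow_distrib m_assoc mult_mult_inv_cancel)
        moreover have "L c (d [^] e c) < \<epsilon> c" using f(2) by (simp add: D_def)
        ultimately show ?thesis using f(1) by (intro bexI[of _ "f [^] e c"]) auto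
      qed
      then have "powers_covered (L c) (e c) (\<epsilon> c)" unfolding powers_covered_def using F
        by (intro exI[of _ "(\<lambda>f. f [^] e c) ` F"]) auto
      with nc[OF c] show False ..
    qed
    obtain n :: nat where n: "1 / \<mu> (bad c) < n" using reals_Archimedean2 by blast
    obtain x where x: "\<And>i. i < n \<Longrightarrow> x i \<in> carrier G" "\<And>i j. i < j \<Longrightarrow> j < n \<Longrightarrow> inv (x i) \<otimes> x j \<notin> D"
      by (rule not_syndetic_separated[OF \<open>\<not> syndetic D\<close>, of n]) (use that in blast)
    have "n * \<mu> (bad c) - n ^ 2 * (0 :: real) \<le> \<mu> (\<Union>i<n. x i <# bad c)"
    proof (rule mean_UN_ge)
      show "\<mu> (bad c) \<le> \<mu> (x i <# bad c)" if "i < n" for i using x(1)[OF that] badc by (simp add: mean_l_coset)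
      show "\<mu> ((x i <# bad c) \<inter> (x j <# bad c)) \<le> 0" if ij: "i < j" "j < n" for i j
      proof -
        have xc: "x i \<in> carrier G" "x j \<in> carrier G" using ij x(1) by auto
        have "(x i <# bad c) \<inter> (x j <# bad c) = {}"
        proof (rule ccontr)
          assume "\<not> ?thesis"
          then obtain b b' where b: "b \<in> bad c" "b' \<in> bad c" "x i \<otimes> b = x j \<otimes> b'"
            by (auto simp: l_coset_def)
          then have bc: "b \<in> carrier G" "b' \<in> carrier G" using badc by auto
          have "inv (x i) \<otimes> x j = b \<otimes> inv b'"
            using b(3) bc xc by (metis inv_solve_left inv_solve_right m_assoc inv_closed m_closed)
          then have e: "(inv (x i) \<otimes> x j) [^] e c = (b [^] e c \<otimes> h c) \<otimes> inv (b' [^] e c \<otimes> h c)"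
            using bc h[OF c] by (simp add: int_pow_distrib int_pow_inv mult_inv_shift)
          have "L c ((b [^] e c \<otimes> h c) \<otimes> inv (b' [^] e c \<otimes> h c)) \<le> L c (b [^] e c \<otimes> h c) + L c (b' [^] e c \<otimes> h c)"
            using seminormD(4)[OF L[OF c], of "b [^] e c \<otimes> h c" "inv (b' [^] e c \<otimes> h c)"]
              seminormD(3)[OF L[OF c], of "b' [^] e c \<otimes> h c"] bc h[OF c] by simp
          also have "\<dots> < \<epsilon> c" using b by (auto simp: bad_def)
          finally have "inv (x i) \<otimes> x j \<in> D" using e xc by (simp add: D_def)
          with x(2)[OF ij] show False ..
        qed
        then show ?thesis by (simp add: mean_empty)
      qed
    qed simp
    also have "\<dots> \<le> 1" by (rule mean_le_1) (use x(1) badc l_coset_closed in blast)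
    finally have "n * \<mu> (bad c) \<le> 1" by simp
    then show False using n pos by (simp add: field_simps)
  qed
  then have "\<mu> (\<Union>c\<in>C. bad c) \<le> 0" using mean_UN_le[OF C, of bad] by simp
  then have "\<not> carrier G \<subseteq> (\<Union>c\<in>C. bad c)" using mean_mono total by (metis not_one_le_zero order_trans)
  then obtain z where "z \<in> carrier G" "z \<notin> (\<Union>c\<in>C. bad c)" by blast
  then show ?thesis by (intro that[of z]) (auto simp: bad_def not_less)
qed

text \<open>The point \<open>z k\<close> is chosen after the finite set \<open>B k\<close> of the words in the earlier points with exponents
  bounded by the index. It avoids the relations that would put a word into a small ball: if \<open>k\<close> is the
  last index with \<open>\<not> int n dvd e k\<close>, then the later part of the word is an \<open>n\<close>-th power and therefore
  close to one of the finitely many points of \<open>F n\<close>, so that \<open>z k [^] e k\<close> would be close to one of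
  finitely many points known at stage \<open>k\<close>. At stage \<open>k\<close> only the \<open>n \<le> k\<close> are taken into account, which
  keeps the number of constraints finite.\<close>
lemma independent_sequence:
  fixes L :: "nat \<Rightarrow> 'a \<Rightarrow> real"
  assumes tame: "\<And>n. n \<in> I \<Longrightarrow> tame (L n) n"
  obtains z \<epsilon> where "\<And>k :: nat. z k \<in> carrier G" "\<And>n. n \<in> I \<Longrightarrow> 0 < \<epsilon> n"
    "\<And>n e k. n \<in> I \<Longrightarrow> finite {k. e k \<noteq> 0} \<Longrightarrow> (\<And>k. \<bar>e k\<bar> \<le> int k) \<Longrightarrow>
       L n (word z e) < \<epsilon> n \<Longrightarrow> n \<le> k \<Longrightarrow> int n dvd e k"
proof -
  have "\<forall>n. \<exists>\<epsilon>. n \<in> I \<longrightarrow> \<epsilon> > 0 \<and> (\<forall>e. \<not> int n dvd e \<longrightarrow> \<not> powers_covered (L n) e \<epsilon>)"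
    using tame unfolding tame_def by blast
  then obtain \<epsilon> where \<epsilon>: "\<And>n. n \<in> I \<Longrightarrow> \<epsilon> n > 0"
    "\<And>n e. n \<in> I \<Longrightarrow> \<not> int n dvd e \<Longrightarrow> \<not> powers_covered (L n) e (\<epsilon> n)" by metis
  have "\<forall>n. \<exists>F. n \<in> I \<longrightarrow> finite F \<and> F \<subseteq> carrier G \<and> (\<forall>z\<in>carrier G. \<exists>f\<in>F. L n (z [^] int n \<otimes> inv f) < \<epsilon> n / 4)"
    using tame \<epsilon>(1) unfolding tame_def powers_covered_def by (metis divide_pos_pos zero_less_numeral)
  then obtain F where F: "\<And>n. n \<in> I \<Longrightarrow> finite (F n)" "\<And>n. n \<in> I \<Longrightarrow> F n \<subseteq> carrier G"
    "\<And>n z. n \<in> I \<Longrightarrow> z \<in> carrier G \<Longrightarrow> \<exists>f\<in>F n. L n (z [^] int n \<otimes> inv f) < \<epsilon> n / 4" by metis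
  define ok where "ok k B z \<longleftrightarrow> z \<in> carrier G \<and> (\<forall>n\<in>I. n \<le> k \<longrightarrow> (\<forall>e. \<bar>e\<bar> \<le> int k \<longrightarrow> \<not> int n dvd e \<longrightarrow>
      (\<forall>b\<in>B. \<forall>f\<in>F n. \<epsilon> n / 2 \<le> L n (z [^] e \<otimes> (b \<otimes> f)))))" for k B z
  have ok_ex: "\<exists>z. ok k B z" if B: "finite B" "B \<subseteq> carrier G" for k B
  proof -
    define C where "C = {(n, e, b, f). n \<in> I \<inter> {..k} \<and> e \<in> {- int k..int k} \<and> \<not> int n dvd e \<and> b \<in> B \<and> f \<in> F n}"
    have "finite C"
    proof (rule finite_subset)
      show "C \<subseteq> (I \<inter> {..k}) \<times> {- int k..int k} \<times> B \<times> (\<Union>n\<in>I \<inter> {..k}. F n)" by (auto simp: C_def)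
      show "finite ((I \<inter> {..k}) \<times> {- int k..int k} \<times> B \<times> (\<Union>n\<in>I \<inter> {..k}. F n))" using B F by auto
    qed
    then obtain z where z: "z \<in> carrier G"
      "\<And>c. c \<in> C \<Longrightarrow> (\<lambda>(n, e, b, f). \<epsilon> n) c / 2 \<le> (\<lambda>(n, e, b, f). L n) c (z [^] (\<lambda>(n, e, b, f). e) c \<otimes> (\<lambda>(n, e, b, f). b \<otimes> f) c)"
    proof (rule avoid_finitely_many[where L = "\<lambda>(n, e, b, f). L n" and e = "\<lambda>(n, e, b, f). e"
          and \<epsilon> = "\<lambda>(n, e, b, f). \<epsilon> n" and h = "\<lambda>(n, e, b, f). b \<otimes> f"])
      show "seminorm G ((\<lambda>(n, e, b, f). L n) c)" if "c \<in> C" for c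
        using that tame by (auto simp: C_def tame_def)
      show "(\<lambda>(n, e, b, f). b \<otimes> f) c \<in> carrier G" if "c \<in> C" for c
        using that B F(2) by (auto simp: C_def subset_iff)
      show "\<not> powers_covered ((\<lambda>(n, e, b, f). L n) c) ((\<lambda>(n, e, b, f). e) c) ((\<lambda>(n, e, b, f). \<epsilon> n) c)" if "c \<in> C" for c
        using that \<epsilon>(2) by (auto simp: C_def)
    qed blast
    have "ok k B z" unfolding ok_def
    proof (intro conjI ballI allI impI z(1))
      fix n e b f assume "n \<in> I" "n \<le> k" "\<bar>e\<bar> \<le> int k" "\<not> int n dvd e" "b \<in> B" "f \<in> F n"
      then have "(n, e, b, f) \<in> C" by (auto simp: C_def)
      from z(2)[OF this] show "\<epsilon> n / 2 \<le> L n (z [^] e \<otimes> (b \<otimes> f))" by simp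
    qed
    then show ?thesis ..
  qed
  define B where "B = rec_nat {\<one>} (\<lambda>k B. (\<lambda>(b, j). b \<otimes> (SOME z. ok k B z) [^] (j::int)) ` (B \<times> {- int k..int k}))"
  define z where "z k = (SOME z. ok k (B k) z)" for k
  have B_simps: "B 0 = {\<one>}" "B (Suc k) = (\<lambda>(b, j). b \<otimes> z k [^] (j::int)) ` (B k \<times> {- int k..int k})" for k
    by (simp_all add: B_def z_def)
  have B: "finite (B k) \<and> B k \<subseteq> carrier G" for k
  proof (induction k)
    case (Suc k)
    then have "ok k (B k) (z k)" using ok_ex someI_ex unfolding z_def by metis
    then show ?case using Suc by (auto simp: B_simps ok_def subset_iff)
  qed (simp add: B_simps)
  have z: "ok k (B k) (z k)" for k using ok_ex B someI_ex unfolding z_def by metis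
  then have zc: "z k \<in> carrier G" for k by (simp add: ok_def)
  have prefix: "finprod G (\<lambda>j. z j [^] e j) {..<k} \<in> B k" if "\<And>k. \<bar>e k\<bar> \<le> int k" for e k
  proof (induction k)
    case (Suc k)
    have "finprod G (\<lambda>j. z j [^] e j) {..<Suc k} = z k [^] e k \<otimes> finprod G (\<lambda>j. z j [^] e j) {..<k}"
      unfolding lessThan_Suc by (rule finprod_insert) (auto simp: zc)
    also have "\<dots> = finprod G (\<lambda>j. z j [^] e j) {..<k} \<otimes> z k [^] e k"
      by (rule m_comm) (auto simp: zc intro!: finprod_closed)
    also have "\<dots> \<in> B (Suc k)" unfolding B_simps
      by (rule image_eqI[of _ _ "(_, e k)"]) (use Suc that[of k] in auto)
    finally show ?case .
  qed (simp add: B_simps)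
  show ?thesis
  proof (rule that[of z "\<lambda>n. \<epsilon> n / 4"])
    show "z k \<in> carrier G" for k by (rule zc)
    show "0 < \<epsilon> n / 4" if "n \<in> I" for n using \<epsilon>(1)[OF that] by simp
    fix n and e :: "nat \<Rightarrow> int" and k0
    assume n: "n \<in> I" and fin: "finite {k. e k \<noteq> 0}" and e: "\<And>k. \<bar>e k\<bar> \<le> int k"
      and small: "L n (word z e) < \<epsilon> n / 4" and k0: "n \<le> k0"
    show "int n dvd e k0"
    proof (rule ccontr)
      assume nd: "\<not> int n dvd e k0"
      define K where "K = {k. n \<le> k \<and> \<not> int n dvd e k}"
      have K: "finite K" "k0 \<in> K"
        using fin nd k0 by (auto simp: K_def intro: finite_subset[of K] elim!: rev_finite_subset)
      define k where "k = Max K"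
      have k: "n \<le> k" "\<not> int n dvd e k" using Max_in[OF K(1)] K(2) by (auto simp: k_def K_def)
      have above: "int n dvd e j" if "k < j" for j
      proof (rule ccontr)
        assume "\<not> ?thesis"
        then have "j \<in> K" using that k(1) by (simp add: K_def)
        then show False using Max_ge[OF K(1), of j] that by (simp add: k_def)
      qed
      obtain m where m: "\<And>j. e j \<noteq> 0 \<Longrightarrow> j < m" "k < m"
      proof -
        obtain m0 where "{j. e j \<noteq> 0} \<subseteq> {..<m0}" using fin finite_nat_iff_bounded by blast
        then show ?thesis using that[of "max m0 (Suc k)"] by (auto simp: subset_iff less_max_iff_disj)
      qed
      let ?x = "\<lambda>j. z j [^] e j"
      define b where "b = finprod G ?x {..<k}"
      define u where "u = finprod G ?x {k<..<m}"
      have bc: "b \<in> carrier G" and uc: "u \<in> carrier G" by (auto simp: b_def u_def zc intro!: finprod_closed)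
      have "{..<m} = insert k ({..<k} \<union> {k<..<m})" using m(2) by auto
      then have "finprod G ?x {..<m} = ?x k \<otimes> finprod G ?x ({..<k} \<union> {k<..<m})"
        by (simp only:) (rule finprod_insert, auto simp: zc)
      also have "finprod G ?x ({..<k} \<union> {k<..<m}) = b \<otimes> u" unfolding b_def u_def
        by (rule finprod_Un_disjoint) (auto simp: zc)
      also have "finprod G ?x {..<m} = word z e"
        by (rule word_eq[symmetric]) (use zc m in auto)
      finally have w: "word z e = ?x k \<otimes> (b \<otimes> u)" .
      define v where "v = finprod G (\<lambda>j. z j [^] (e j div int n)) {k<..<m}"
      have vc: "v \<in> carrier G" by (auto simp: v_def zc intro!: finprod_closed)
      have "u = finprod G (\<lambda>j. (z j [^] (e j div int n)) [^] int n) {k<..<m}" unfolding u_def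
        by (rule finprod_cong') (use above in \<open>auto simp: zc int_pow_pow\<close>)
      then have "u = v [^] int n" unfolding v_def using zc by (subst (asm) finprod_int_pow) auto
      then obtain f where f: "f \<in> F n" "L n (u \<otimes> inv f) < \<epsilon> n / 4" using F(3)[OF n vc] by auto
      have fc: "f \<in> carrier G" using f F(2)[OF n] by auto
      have Ln: "seminorm G (L n)" using tame[OF n] by (simp add: tame_def)
      have wc: "word z e \<in> carrier G" by (rule word_closed) (rule zc)
      have "?x k \<otimes> (b \<otimes> f) = word z e \<otimes> inv (u \<otimes> inv f)"
        unfolding w using zc bc uc fc by (simp add: m_assoc[symmetric] mult_inv_shift_left)
      then have "L n (?x k \<otimes> (b \<otimes> f)) \<le> L n (word z e) + L n (u \<otimes> inv f)"
        using seminormD(4)[OF Ln wc, of "inv (u \<otimes> inv f)"] seminormD(3)[OF Ln, of "u \<otimes> inv f"] uc fc by simp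
      also have "\<dots> < \<epsilon> n / 2" using small f by simp
      finally have "L n (?x k \<otimes> (b \<otimes> f)) < \<epsilon> n / 2" .
      moreover have "b \<in> B k" unfolding b_def by (rule prefix[OF e])
      then have "\<epsilon> n / 2 \<le> L n (?x k \<otimes> (b \<otimes> f))"
        using z[of k] n k e[of k] f(1) unfolding ok_def by blast
      ultimately show False by simp
    qed
  qed
qed

text \<open>Since the \<open>n\<close>-th powers are totally bounded, \<open>z k [^] n\<close> is a Cauchy family along the
  ultrafilter, and \<open>v k\<close> is the limit of its distances from the \<open>k\<close>-th member. In a word with exponent
  sum zero every \<open>z k [^] n\<close> may be divided by \<open>z l [^] n\<close> without any change; let \<open>l\<close> be far out.\<close>
lemma word_oscillation:
  fixes z :: "nat \<Rightarrow> 'a"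
  assumes p: "ultrafilter p" and tame: "tame L n" and z: "\<And>k. z k \<in> carrier G"
  obtains v :: "nat \<Rightarrow> real" where "\<And>k. 0 \<le> v k" "(v \<longlongrightarrow> 0) p"
    "\<And>e. finite {k. e k \<noteq> 0} \<Longrightarrow> (\<Sum>k | e k \<noteq> 0. e k) = 0 \<Longrightarrow>
      L (word z (\<lambda>k. e k * int n)) \<le> (\<Sum>k | e k \<noteq> 0. \<bar>e k\<bar> * v k)"
proof -
  have L: "seminorm G L" and powers_covered: "\<And>\<epsilon>. \<epsilon> > 0 \<Longrightarrow> powers_covered L (int n) \<epsilon>" using tame by (auto simp: tame_def)
  define x where "x k = z k [^] int n" for k
  have x: "x k \<in> carrier G" for k using z by (simp add: x_def)
  have xx: "x k \<otimes> inv x l \<in> carrier G" for k l using x by simp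
  define R where "R k = {r. 0 < r \<and> eventually (\<lambda>l. L (x k \<otimes> inv x l) < r) p}" for k
  define v where "v k = Inf (R k)" for k
  have center: "\<exists>f\<in>carrier G. eventually (\<lambda>l. L (x l \<otimes> inv f) < \<epsilon>) p" if "\<epsilon> > 0" for \<epsilon>
  proof -
    obtain F where F: "finite F" "F \<subseteq> carrier G" "\<And>z. z \<in> carrier G \<Longrightarrow> \<exists>f\<in>F. L (z [^] int n \<otimes> inv f) < \<epsilon>"
      using powers_covered[OF \<open>\<epsilon> > 0\<close>] unfolding powers_covered_def by blast
    obtain f where "f \<in> F" "eventually (\<lambda>l. L (x l \<otimes> inv f) < \<epsilon>) p"
      by (rule ultrafilter_finite_cover[OF p F(1), of "\<lambda>f l. L (x l \<otimes> inv f) < \<epsilon>"])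
        (use F(3) z in \<open>auto simp: x_def\<close>)
    then show ?thesis using F(2) by blast
  qed
  have tri: "L (a \<otimes> inv b) \<le> L (a \<otimes> inv f) + L (b \<otimes> inv f)"
    if "a \<in> carrier G" "b \<in> carrier G" "f \<in> carrier G" for a b f
  proof -
    have "a \<otimes> inv b = (a \<otimes> inv f) \<otimes> inv (b \<otimes> inv f)"
      using that by (simp add: mult_inv_shift)
    then show ?thesis
      using seminormD(4)[OF L, of "a \<otimes> inv f" "inv (b \<otimes> inv f)"] seminormD(3)[OF L, of "b \<otimes> inv f"] that by simp
  qed
  have bdd: "bdd_below (R k)" for k by (rule bdd_belowI[of _ 0]) (auto simp: R_def)
  have ne: "R k \<noteq> {}" for k
  proof -
    obtain f where f: "f \<in> carrier G" "eventually (\<lambda>l. L (x l \<otimes> inv f) < 1) p" using center[of 1] by auto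
    have "eventually (\<lambda>l. L (x k \<otimes> inv x l) < L (x k \<otimes> inv f) + 1) p"
    proof (rule eventually_mono[OF f(2)])
      show "L (x k \<otimes> inv x l) < L (x k \<otimes> inv f) + 1" if "L (x l \<otimes> inv f) < 1" for l
        using tri[OF x[of k] x[of l] f(1)] that by linarith
    qed
    moreover have "0 \<le> L (x k \<otimes> inv f)" by (rule seminormD(2)[OF L]) (use x f in auto)
    ultimately have "L (x k \<otimes> inv f) + 1 \<in> R k" by (simp add: R_def)
    then show ?thesis by blast
  qed
  have v0: "0 \<le> v k" for k unfolding v_def by (rule cInf_greatest[OF ne]) (auto simp: R_def)
  have ev: "eventually (\<lambda>l. L (x k \<otimes> inv x l) < v k + \<eta>) p" if "\<eta> > 0" for k \<eta>
  proof -
    obtain r where "r \<in> R k" "r < v k + \<eta>" using cInf_lessD[OF ne, of k "v k + \<eta>"] \<open>\<eta> > 0\<close> by (auto simp: v_def)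
    then show ?thesis by (auto simp: R_def elim: eventually_mono)
  qed
  have "(v \<longlongrightarrow> 0) p"
  proof (rule tendstoI)
    fix \<epsilon> :: real assume \<epsilon>: "\<epsilon> > 0"
    obtain f where f: "f \<in> carrier G" "eventually (\<lambda>l. L (x l \<otimes> inv f) < \<epsilon> / 4) p"
      using center[of "\<epsilon> / 4"] \<epsilon> by auto
    show "eventually (\<lambda>k. dist (v k) 0 < \<epsilon>) p"
    proof (rule eventually_mono[OF f(2)])
      fix k assume k: "L (x k \<otimes> inv f) < \<epsilon> / 4"
      have "eventually (\<lambda>l. L (x k \<otimes> inv x l) < \<epsilon> / 2) p"
      proof (rule eventually_mono[OF f(2)])
        show "L (x k \<otimes> inv x l) < \<epsilon> / 2" if "L (x l \<otimes> inv f) < \<epsilon> / 4" for l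
          using tri[OF x[of k] x[of l] f(1)] k that by linarith
      qed
      then have "v k \<le> \<epsilon> / 2" unfolding v_def using \<epsilon> by (intro cInf_lower[OF _ bdd]) (simp add: R_def)
      then show "dist (v k) 0 < \<epsilon>" using v0[of k] \<epsilon> by simp
    qed
  qed
  moreover have "L (word z (\<lambda>k. e k * int n)) \<le> (\<Sum>k | e k \<noteq> 0. \<bar>e k\<bar> * v k)"
    if fin: "finite {k. e k \<noteq> 0}" and s: "(\<Sum>k | e k \<noteq> 0. e k) = 0" for e :: "nat \<Rightarrow> int"
  proof (rule field_le_epsilon)
    fix \<epsilon> :: real assume \<epsilon>: "\<epsilon> > 0"
    let ?K = "{k. e k \<noteq> 0}"
    define s where "s = (\<Sum>k\<in>?K. \<bar>e k\<bar>)"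
    define \<eta> where "\<eta> = \<epsilon> / (1 + s)"
    have s0: "0 \<le> s" unfolding s_def by (rule sum_nonneg) auto
    then have \<eta>: "\<eta> > 0" using \<epsilon> by (simp add: \<eta>_def)
    have "eventually (\<lambda>l. \<forall>k\<in>?K. L (x k \<otimes> inv x l) < v k + \<eta>) p"
      by (rule eventually_ball_finite[OF fin]) (use ev[OF \<eta>] in blast)
    from eventually_happens[OF this] p
    obtain l where l: "\<And>k. k \<in> ?K \<Longrightarrow> L (x k \<otimes> inv x l) < v k + \<eta>"
      unfolding ultrafilter_def by blast
    have "word z (\<lambda>k. e k * int n) = finprod G (\<lambda>k. x k [^] e k) ?K"
    proof -
      have "word z (\<lambda>k. e k * int n) = finprod G (\<lambda>k. z k [^] (e k * int n)) ?K"
        by (rule word_eq[OF z fin]) auto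
      also have "\<dots> = finprod G (\<lambda>k. x k [^] e k) ?K"
        by (rule finprod_cong') (auto simp: x_def z int_pow_pow mult.commute)
      finally show ?thesis .
    qed
    also have "\<dots> = finprod G (\<lambda>k. x k [^] e k) ?K \<otimes> finprod G (\<lambda>k. inv x l [^] e k) ?K"
    proof -
      have "finprod G (\<lambda>k. inv x l [^] e k) K = inv x l [^] (\<Sum>k\<in>K. e k)" if "finite K" for K
        using that by (induction K rule: finite_induct) (auto simp: x int_pow_mult Pi_def)
      from this[OF fin] show ?thesis using s by (simp add: x)
    qed
    also have "\<dots> = finprod G (\<lambda>k. (x k \<otimes> inv x l) [^] e k) ?K"
      by (subst finprod_multf[symmetric]) (auto simp: x int_pow_distrib)
    also have "L \<dots> \<le> (\<Sum>k\<in>?K. L ((x k \<otimes> inv x l) [^] e k))"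
      by (rule seminorm_finprod[OF L fin]) (simp add: x)
    also have "\<dots> \<le> (\<Sum>k\<in>?K. \<bar>e k\<bar> * (v k + \<eta>))"
    proof (rule sum_mono)
      fix k assume "k \<in> ?K"
      then have "\<bar>e k\<bar> * L (x k \<otimes> inv x l) \<le> \<bar>e k\<bar> * (v k + \<eta>)"
        using l[of k] by (intro mult_left_mono) auto
      then show "L ((x k \<otimes> inv x l) [^] e k) \<le> \<bar>e k\<bar> * (v k + \<eta>)"
        using seminorm_int_pow[OF L xx, of k l "e k"] by linarith
    qed
    also have "\<dots> = (\<Sum>k\<in>?K. \<bar>e k\<bar> * v k) + s * \<eta>"
      by (simp add: distrib_left sum.distrib s_def sum_distrib_right)
    also have "s * \<eta> \<le> \<epsilon>" using s0 \<epsilon> by (simp add: \<eta>_def field_simps)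
    finally show "L (word z (\<lambda>k. e k * int n)) \<le> (\<Sum>k | e k \<noteq> 0. \<bar>e k\<bar> * v k) + \<epsilon>" by simp
  qed
  ultimately show ?thesis using v0 by (intro that[of v]) auto
qed

end

section \<open>Hausdorff topological groups\<close>

lemma continuous_prod_nhds:
  assumes "continuous_map (prod_topology S S) R f" "openin R W" "x \<in> topspace S" "y \<in> topspace S" "f (x, y) \<in> W"
  obtains A B where "openin S A" "x \<in> A" "openin S B" "y \<in> B" "\<And>a b. a \<in> A \<Longrightarrow> b \<in> B \<Longrightarrow> f (a, b) \<in> W"
proof -
  have "openin (prod_topology S S) {q \<in> topspace (prod_topology S S). f q \<in> W}" (is "openin _ ?P")
    by (rule openin_continuous_map_preimage[OF assms(1,2)])
  moreover have "(x, y) \<in> ?P" using assms by simp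
  ultimately obtain A B where "openin S A" "x \<in> A" "openin S B" "y \<in> B" "A \<times> B \<subseteq> ?P"
    unfolding openin_prod_topology_alt by blast
  then show ?thesis by (intro that[of A B]) auto
qed

lemma continuous_map_prodI:
  assumes "\<And>x y. x \<in> topspace S \<Longrightarrow> y \<in> topspace S \<Longrightarrow> f (x, y) \<in> topspace R"
    and "\<And>W x y. openin R W \<Longrightarrow> x \<in> topspace S \<Longrightarrow> y \<in> topspace S \<Longrightarrow> f (x, y) \<in> W \<Longrightarrow>
      \<exists>A B. openin S A \<and> x \<in> A \<and> openin S B \<and> y \<in> B \<and> (\<forall>a\<in>A. \<forall>b\<in>B. f (a, b) \<in> W)"
  shows "continuous_map (prod_topology S S) R f"
  unfolding continuous_map_def
proof (intro conjI allI impI)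
  show "f \<in> topspace (prod_topology S S) \<rightarrow> topspace R" using assms(1) by auto
  fix W assume W: "openin R W"
  show "openin (prod_topology S S) {q \<in> topspace (prod_topology S S). f q \<in> W}"
    unfolding openin_prod_topology_alt
  proof (intro allI impI)
    fix x y assume xy: "(x, y) \<in> {q \<in> topspace (prod_topology S S). f q \<in> W}"
    then obtain A B where AB: "openin S A" "x \<in> A" "openin S B" "y \<in> B" "\<forall>a\<in>A. \<forall>b\<in>B. f (a, b) \<in> W"
      using assms(2)[OF W, of x y] by auto
    moreover have "A \<times> B \<subseteq> {q \<in> topspace (prod_topology S S). f q \<in> W}"
      using AB openin_subset[of S A] openin_subset[of S B] by auto
    ultimately show "\<exists>U V. openin S U \<and> openin S V \<and> x \<in> U \<and> y \<in> V \<and>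
        U \<times> V \<subseteq> {q \<in> topspace (prod_topology S S). f q \<in> W}" by blast
  qed
qed

lemma continuous_mapI_nhds:
  assumes "\<And>x. x \<in> topspace S \<Longrightarrow> f x \<in> topspace R"
    and "\<And>W x. openin R W \<Longrightarrow> x \<in> topspace S \<Longrightarrow> f x \<in> W \<Longrightarrow> \<exists>A. openin S A \<and> x \<in> A \<and> (\<forall>a\<in>A. f a \<in> W)"
  shows "continuous_map S R f"
  unfolding continuous_map_def
proof (intro conjI allI impI)
  show "f \<in> topspace S \<rightarrow> topspace R" using assms(1) by auto
  fix W assume W: "openin R W"
  show "openin S {x \<in> topspace S. f x \<in> W}"
  proof (subst openin_subopen, intro ballI)
    fix x assume "x \<in> {x \<in> topspace S. f x \<in> W}"
    then obtain A where A: "openin S A" "x \<in> A" "\<forall>a\<in>A. f a \<in> W" using assms(2)[OF W] by auto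
    then show "\<exists>A. openin S A \<and> x \<in> A \<and> A \<subseteq> {x \<in> topspace S. f x \<in> W}"
      using openin_subset[of S A] by (intro exI[of _ A]) auto
  qed
qed

lemma embedding_mapI:
  assumes "continuous_map S R f" "inj_on f (topspace S)"
    and "\<And>A x. openin S A \<Longrightarrow> x \<in> A \<Longrightarrow> \<exists>W. openin R W \<and> f x \<in> W \<and> (\<forall>y\<in>topspace S. f y \<in> W \<longrightarrow> y \<in> A)"
  shows "embedding_map S R f"
  unfolding embedding_map_def
proof (rule bijective_open_imp_homeomorphic_map)
  show "continuous_map S (subtopology R (f ` topspace S)) f"
    using assms(1) by (simp add: continuous_map_in_subtopology image_subset_iff_funcset)
  have "f ` topspace S \<subseteq> topspace R" using assms(1) by (rule continuous_map_image_subset_topspace)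
  then show "f ` topspace S = topspace (subtopology R (f ` topspace S))" by auto
  show "inj_on f (topspace S)" by (rule assms(2))
  show "open_map S (subtopology R (f ` topspace S)) f" unfolding open_map_def
  proof (intro allI impI)
    fix A assume A: "openin S A"
    define W where "W = \<Union>{V. openin R V \<and> (\<forall>y\<in>topspace S. f y \<in> V \<longrightarrow> y \<in> A)}"
    have "openin R W" unfolding W_def by (rule openin_Union) auto
    moreover have "f ` A = W \<inter> f ` topspace S"
    proof (intro equalityI subsetI)
      show "y \<in> W \<inter> f ` topspace S" if y: "y \<in> f ` A" for y
      proof -
        obtain x where x: "x \<in> A" "y = f x" using y by blast
        then have "y \<in> W" using assms(3)[OF A x(1)] by (auto simp: W_def)
        then show ?thesis using x openin_subset[OF A] by blast
      qed
      show "y \<in> f ` A" if "y \<in> W \<inter> f ` topspace S" for y using that by (auto simp: W_def)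
    qed
    ultimately show "openin (subtopology R (f ` topspace S)) (f ` A)"
      unfolding openin_subtopology by blast
  qed
qed

locale hausdorff_group =
  fixes G :: "('a, 'm) monoid_scheme" (structure) and T :: "'a topology"
  assumes topological_group: "topological_group G T"

sublocale hausdorff_group \<subseteq> group G
  using topological_group by (simp add: topological_group_def paratopological_group_def)

context hausdorff_group
begin

lemma topspace_eq: "topspace T = carrier G"
  and hausdorff: "Hausdorff_space T"
  and continuous_mult: "continuous_map (prod_topology T T) T (\<lambda>(x, y). x \<otimes> y)"
  and continuous_inv: "continuous_map T T (\<lambda>x. inv x)"
  using topological_group by (auto simp: topological_group_def paratopological_group_def
      topological_semigroup_def topologized_semigroup_def)

lemma open_carrier: "openin T U \<Longrightarrow> U \<subseteq> carrier G"
  using openin_subset topspace_eq by metis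

lemma continuous_mult_left: "g \<in> carrier G \<Longrightarrow> continuous_map T T (\<lambda>x. g \<otimes> x)"
  using continuous_map_compose[OF _ continuous_mult, of T "\<lambda>x. (g, x)"]
  by (simp add: o_def continuous_map_pairedI topspace_eq)

lemma continuous_mult_right: "g \<in> carrier G \<Longrightarrow> continuous_map T T (\<lambda>x. x \<otimes> g)"
  using continuous_map_compose[OF _ continuous_mult, of T "\<lambda>x. (x, g)"]
  by (simp add: o_def continuous_map_pairedI topspace_eq)

lemma open_vimage: "continuous_map T T f \<Longrightarrow> openin T U \<Longrightarrow> openin T {x \<in> carrier G. f x \<in> U}"
  using openin_continuous_map_preimage topspace_eq by metis

lemma mult_nhds:
  assumes "openin T W" "x \<in> carrier G" "y \<in> carrier G" "x \<otimes> y \<in> W"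
  obtains A B where "openin T A" "x \<in> A" "openin T B" "y \<in> B" "\<And>a b. a \<in> A \<Longrightarrow> b \<in> B \<Longrightarrow> a \<otimes> b \<in> W"
  by (rule continuous_prod_nhds[OF continuous_mult assms(1)]) (use assms that in \<open>auto simp: topspace_eq\<close>)

definition nhd :: "'a set \<Rightarrow> bool" where
  "nhd U \<longleftrightarrow> openin T U \<and> \<one> \<in> U"

lemma nhd_carrier: "nhd U \<Longrightarrow> U \<subseteq> carrier G"
  by (simp add: nhd_def open_carrier)

lemma nhd_Int: "nhd U \<Longrightarrow> nhd V \<Longrightarrow> nhd (U \<inter> V)"
  by (simp add: nhd_def openin_Int)

lemma nhd_translate_left: "openin T A \<Longrightarrow> x \<in> A \<Longrightarrow> nhd {u \<in> carrier G. x \<otimes> u \<in> A}"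
proof -
  assume A: "openin T A" "x \<in> A"
  then have x: "x \<in> carrier G" using open_carrier by blast
  show ?thesis unfolding nhd_def using open_vimage[OF continuous_mult_left[OF x] A(1)] A(2) x by simp
qed

lemma nhd_mult:
  assumes "nhd W"
  obtains U where "nhd U" "\<And>x y. x \<in> U \<Longrightarrow> y \<in> U \<Longrightarrow> x \<otimes> y \<in> W"
proof -
  obtain A B where "openin T A" "\<one> \<in> A" "openin T B" "\<one> \<in> B" "\<And>a b. a \<in> A \<Longrightarrow> b \<in> B \<Longrightarrow> a \<otimes> b \<in> W"
    using mult_nhds[of W \<one> \<one>] assms by (auto simp: nhd_def)
  then show ?thesis by (intro that[of "A \<inter> B"]) (auto simp: nhd_def openin_Int)
qed

lemma nhd_inv: "nhd W \<Longrightarrow> nhd {x \<in> carrier G. inv x \<in> W}"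
  using open_vimage[OF continuous_inv] by (auto simp: nhd_def)

lemma nhd_cube:
  assumes "nhd W"
  obtains U where "nhd U" "\<And>x. x \<in> U \<Longrightarrow> inv x \<in> U"
    "\<And>x y z. x \<in> U \<Longrightarrow> y \<in> U \<Longrightarrow> z \<in> U \<Longrightarrow> x \<otimes> y \<otimes> z \<in> W"
proof -
  obtain A where A: "nhd A" "\<And>x y. x \<in> A \<Longrightarrow> y \<in> A \<Longrightarrow> x \<otimes> y \<in> W" using nhd_mult[OF assms] by blast
  obtain B where B: "nhd B" "\<And>x y. x \<in> B \<Longrightarrow> y \<in> B \<Longrightarrow> x \<otimes> y \<in> A" using nhd_mult[OF A(1)] by blast
  define U where "U = (A \<inter> B) \<inter> {x \<in> carrier G. inv x \<in> A \<inter> B}"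
  show ?thesis
  proof (rule that[of U])
    show "nhd U" unfolding U_def by (intro nhd_Int nhd_inv A B)
    show "inv x \<in> U" if "x \<in> U" for x using that nhd_carrier[OF A(1)] by (auto simp: U_def)
    show "x \<otimes> y \<otimes> z \<in> W" if "x \<in> U" "y \<in> U" "z \<in> U" for x y z using that A(2) B(2) by (auto simp: U_def)
  qed
qed

text \<open>The cube instead of the square is what \<open>seminorm_of_chain\<close> needs.\<close>
lemma nhd_chain:
  assumes "nhd W"
  obtains U :: "nat \<Rightarrow> 'a set" where "\<And>i. nhd (U i)" "\<And>i x. x \<in> U i \<Longrightarrow> inv x \<in> U i"
    "U 0 \<subseteq> W" "\<And>i x y z. x \<in> U (Suc i) \<Longrightarrow> y \<in> U (Suc i) \<Longrightarrow> z \<in> U (Suc i) \<Longrightarrow> x \<otimes> y \<otimes> z \<in> U i"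
proof -
  define good where "good U \<longleftrightarrow> nhd U \<and> (\<forall>x\<in>U. inv x \<in> U)" for U
  have step: "\<exists>V. good V \<and> (\<forall>x\<in>V. \<forall>y\<in>V. \<forall>z\<in>V. x \<otimes> y \<otimes> z \<in> U)" if "nhd U" for U
    using nhd_cube[OF that] unfolding good_def by metis
  have "\<exists>U. \<forall>i. (good (U i) \<and> ((i::nat) = 0 \<longrightarrow> U i \<subseteq> W)) \<and>
      (\<forall>x\<in>U (Suc i). \<forall>y\<in>U (Suc i). \<forall>z\<in>U (Suc i). x \<otimes> y \<otimes> z \<in> U i)"
  proof (rule dependent_nat_choice)
    obtain V where V: "good V" "\<forall>x\<in>V. \<forall>y\<in>V. \<forall>z\<in>V. x \<otimes> y \<otimes> z \<in> W" using step[OF assms] by blast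
    have "V \<subseteq> W"
    proof
      fix x assume x: "x \<in> V"
      then have "x \<otimes> \<one> \<otimes> \<one> \<in> W" "x \<in> carrier G"
        using V nhd_carrier[of V] by (auto simp: good_def nhd_def)
      then show "x \<in> W" by simp
    qed
    then show "\<exists>x. good x \<and> ((0::nat) = 0 \<longrightarrow> x \<subseteq> W)" using V by blast
    show "\<exists>V. (good V \<and> (Suc n = 0 \<longrightarrow> V \<subseteq> W)) \<and> (\<forall>x\<in>V. \<forall>y\<in>V. \<forall>z\<in>V. x \<otimes> y \<otimes> z \<in> U)"
      if "good U \<and> (n = 0 \<longrightarrow> U \<subseteq> W)" for U and n :: nat
      using step[of U] that by (auto simp: good_def)
  qed
  then obtain U where U: "\<forall>i. (good (U i) \<and> ((i::nat) = 0 \<longrightarrow> U i \<subseteq> W)) \<and>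
      (\<forall>x\<in>U (Suc i). \<forall>y\<in>U (Suc i). \<forall>z\<in>U (Suc i). x \<otimes> y \<otimes> z \<in> U i)" by (rule exE)
  show ?thesis
  proof (rule that[of U])
    show "nhd (U i)" "\<And>x. x \<in> U i \<Longrightarrow> inv x \<in> U i" for i using U by (simp_all add: good_def)
    show "U 0 \<subseteq> W" using U by blast
    show "x \<otimes> y \<otimes> z \<in> U i" if "x \<in> U (Suc i)" "y \<in> U (Suc i)" "z \<in> U (Suc i)" for i x y z
      using U that by blast
  qed
qed

definition continuous_at_one :: "('a \<Rightarrow> real) \<Rightarrow> bool" where
  "continuous_at_one L \<longleftrightarrow> (\<forall>\<epsilon>>0. \<exists>U. nhd U \<and> (\<forall>u\<in>U. L u < \<epsilon>))"

lemma continuous_seminorm_in_nhd: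
  assumes "nhd W"
  obtains L where "seminorm G L" "continuous_at_one L" "\<And>x. x \<in> carrier G \<Longrightarrow> L x \<le> 1"
    "\<And>x. x \<in> carrier G \<Longrightarrow> L x < 1 \<Longrightarrow> x \<in> W"
proof -
  obtain U where U: "\<And>i::nat. nhd (U i)" "\<And>i x. x \<in> U i \<Longrightarrow> inv x \<in> U i"
    "U 0 \<subseteq> W" "\<And>i x y z. x \<in> U (Suc i) \<Longrightarrow> y \<in> U (Suc i) \<Longrightarrow> z \<in> U (Suc i) \<Longrightarrow> x \<otimes> y \<otimes> z \<in> U i"
    by (rule nhd_chain[OF assms]) (rule that)
  obtain L where L: "seminorm G L" "\<And>x. x \<in> carrier G \<Longrightarrow> L x \<le> 1"
    "\<And>i x. x \<in> U i \<Longrightarrow> L x \<le> (1/2) ^ i" "\<And>i x. x \<in> carrier G \<Longrightarrow> L x < (1/2) ^ i \<Longrightarrow> x \<in> U i"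
  proof (rule seminorm_of_chain[of U])
    show "U i \<subseteq> carrier G" for i using U(1) nhd_carrier by blast
    show "\<one> \<in> U i" for i using U(1)[of i] by (simp add: nhd_def)
  qed (use U that in blast)+
  have "continuous_at_one L" unfolding continuous_at_one_def
  proof (intro allI impI)
    fix \<epsilon> :: real assume "\<epsilon> > 0"
    then obtain i where "(1/2 :: real) ^ i < \<epsilon>" using real_arch_pow_inv[of \<epsilon> "1/2"] by auto
    then show "\<exists>U. nhd U \<and> (\<forall>u\<in>U. L u < \<epsilon>)" using U(1) L(3) le_less_trans by (intro exI[of _ "U i"]) blast
  qed
  then show ?thesis using L(1,2) L(4)[of _ 0] U(3) by (intro that[of L]) auto
qed

section \<open>The center\<close>

lemma center_carrier: "center G \<subseteq> carrier G" by (auto simp: center_def)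

lemma center_comm: "z \<in> center G \<Longrightarrow> x \<in> carrier G \<Longrightarrow> z \<otimes> x = x \<otimes> z" by (auto simp: center_def)

lemma center_subgroup: "subgroup (center G) G"
proof (rule subgroupI)
  show "center G \<subseteq> carrier G" by (rule center_carrier)
  show "center G \<noteq> {}" by (auto simp: center_def intro!: exI[of _ \<one>])
  show "inv a \<in> center G" if "a \<in> center G" for a
  proof -
    have a: "a \<in> carrier G" "\<And>x. x \<in> carrier G \<Longrightarrow> a \<otimes> x = x \<otimes> a" using that by (auto simp: center_def)
    have "inv a \<otimes> x = x \<otimes> inv a" if x: "x \<in> carrier G" for x
    proof -
      have "inv a \<otimes> x = inv (inv x \<otimes> a)" using a(1) x by (simp add: inv_mult_group)
      also have "inv x \<otimes> a = a \<otimes> inv x" using a(2)[of "inv x"] x by simp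
      also have "inv (a \<otimes> inv x) = x \<otimes> inv a" using a(1) x by (simp add: inv_mult_group)
      finally show ?thesis .
    qed
    then show ?thesis using a(1) unfolding center_def by blast
  qed
  show "a \<otimes> b \<in> center G" if "a \<in> center G" "b \<in> center G" for a b
  proof -
    have c: "a \<in> carrier G" "b \<in> carrier G" "\<And>x. x \<in> carrier G \<Longrightarrow> a \<otimes> x = x \<otimes> a"
      "\<And>x. x \<in> carrier G \<Longrightarrow> b \<otimes> x = x \<otimes> b" using that by (auto simp: center_def)
    have "(a \<otimes> b) \<otimes> x = x \<otimes> (a \<otimes> b)" if x: "x \<in> carrier G" for x
    proof -
      have "(a \<otimes> b) \<otimes> x = a \<otimes> (b \<otimes> x)" using c(1,2) x by (simp add: m_assoc)
      also have "\<dots> = (a \<otimes> x) \<otimes> b" unfolding c(4)[OF x] using c(1,2) x by (simp add: m_assoc)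
      also have "\<dots> = x \<otimes> (a \<otimes> b)" unfolding c(3)[OF x] using c(1,2) x by (simp add: m_assoc)
      finally show ?thesis .
    qed
    moreover have "a \<otimes> b \<in> carrier G" using c(1,2) by simp
    ultimately show ?thesis unfolding center_def by blast
  qed
qed

lemma closed_center: "closedin T (center G)"
proof -
  have "closedin T {z \<in> topspace T. z \<otimes> x = x \<otimes> z}" if "x \<in> carrier G" for x
    by (rule closedin_continuous_maps_eq[OF hausdorff continuous_mult_right[OF that] continuous_mult_left[OF that]])
  then have "closedin T (topspace T \<inter> (\<Inter>x\<in>carrier G. {z \<in> topspace T. z \<otimes> x = x \<otimes> z}))"
    by (intro closedin_Int closedin_topspace closedin_Inter) (auto intro: one_closed)
  moreover have "topspace T \<inter> (\<Inter>x\<in>carrier G. {z \<in> topspace T. z \<otimes> x = x \<otimes> z}) = center G"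
    by (auto simp: center_def topspace_eq)
  ultimately show ?thesis by simp
qed

end

sublocale hausdorff_group \<subseteq> C: comm_group "center_group G"
  rewrites "carrier (center_group G) = center G" and "x \<otimes>\<^bsub>center_group G\<^esub> y = x \<otimes>\<^bsub>G\<^esub> y"
    and "\<one>\<^bsub>center_group G\<^esub> = \<one>\<^bsub>G\<^esub>"
proof -
  show "comm_group (center_group G)"
  proof (rule group.group_comm_groupI)
    show "group (center_group G)" by (rule subgroup.subgroup_is_group[OF center_subgroup is_group])
  qed (use center_comm center_carrier in auto)
qed auto

context hausdorff_group
begin

lemma center_inv: "x \<in> center G \<Longrightarrow> inv\<^bsub>center_group G\<^esub> x = inv x"
  using m_inv_consistent[OF center_subgroup] by simp

lemma center_pow: "x [^]\<^bsub>center_group G\<^esub> (n::nat) = x [^] n"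
  by (simp add: nat_pow_consistent[symmetric])

lemma center_int_pow: "x \<in> center G \<Longrightarrow> x [^]\<^bsub>center_group G\<^esub> (n::int) = x [^] n"
  using int_pow_consistent[OF center_subgroup] by metis

definition continuous_on_center :: "('a \<Rightarrow> real) \<Rightarrow> bool" where
  "continuous_on_center L \<longleftrightarrow> (\<forall>\<epsilon>>0. \<exists>U. nhd U \<and> (\<forall>u\<in>U \<inter> center G. L u < \<epsilon>))"

lemma tame_seminorm_in_nhd:
  assumes "nhd W"
  obtains L n where "C.tame L n" "continuous_on_center L" "\<And>x. x \<in> center G \<Longrightarrow> L x < 1 \<Longrightarrow> x \<in> W"
proof -
  obtain V where V: "\<And>i::nat. nhd (V i)" "\<And>i x. x \<in> V i \<Longrightarrow> inv x \<in> V i"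
    "V 0 \<subseteq> W" "\<And>i x y z. x \<in> V (Suc i) \<Longrightarrow> y \<in> V (Suc i) \<Longrightarrow> z \<in> V (Suc i) \<Longrightarrow> x \<otimes> y \<otimes> z \<in> V i"
    by (rule nhd_chain[OF assms]) (rule that)
  \<comment> \<open>The shift by 2 makes room for nine factors: \<open>(V 2)\<^sup>9\<close> lies in \<open>V 0\<close>.\<close>
  define U where "U i = V (i + 2) \<inter> center G" for i
  obtain L n where L: "C.tame L n" "\<And>i x. x \<in> U i \<Longrightarrow> L x \<le> (1/2) ^ i"
    "\<And>x. x \<in> center G \<Longrightarrow> L x < 1 \<Longrightarrow> x \<in> C.set_pow (U 0) 9"
  proof (rule C.tame_of_chain[of U])
    show "U i \<subseteq> center G" for i by (simp add: U_def)
    show "\<one> \<in> U i" for i using V(1)[of "i + 2"] C.one_closed by (simp add: U_def nhd_def)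
    show "inv\<^bsub>center_group G\<^esub> x \<in> U i" if "x \<in> U i" for i x
      using that V(2) C.inv_closed[of x] by (auto simp: U_def center_inv)
    show "x \<otimes> y \<otimes> z \<in> U i" if "x \<in> U (Suc i)" "y \<in> U (Suc i)" "z \<in> U (Suc i)" for x y z i
      using that V(4)[of x "i + 2" y z] by (auto simp: U_def)
  qed (use that in blast)
  have triple: "C.set_pow S 3 \<subseteq> V i" if S: "S \<subseteq> V (Suc i)" for S i
  proof
    fix x assume "x \<in> C.set_pow S 3"
    then obtain a b c where "a \<in> S" "b \<in> S" "c \<in> S" "x = a \<otimes> (b \<otimes> (c \<otimes> \<one>))"
      by (auto simp: numeral_3_eq_3 set_mult_def)
    moreover from this have "a \<in> carrier G" "b \<in> carrier G" "c \<in> carrier G"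
      using S nhd_carrier[OF V(1)] by blast+
    ultimately show "x \<in> V i" using V(4)[of a i b c] S by (auto simp: m_assoc)
  qed
  have "C.set_pow (U 0) 9 = C.set_pow (C.set_pow (U 0) 3) 3"
    using C.set_pow_mult[of "U 0" 3 3] by (simp add: U_def)
  also have "\<dots> \<subseteq> V 0" by (intro triple) (auto simp: U_def numeral_2_eq_2)
  finally have "C.set_pow (U 0) 9 \<subseteq> W" using V(3) by blast
  moreover have "continuous_on_center L" unfolding continuous_on_center_def
  proof (intro allI impI)
    fix \<epsilon> :: real assume "\<epsilon> > 0"
    then obtain i where "(1/2 :: real) ^ i < \<epsilon>" using real_arch_pow_inv[of \<epsilon> "1/2"] by auto
    then show "\<exists>U. nhd U \<and> (\<forall>u\<in>U \<inter> center G. L u < \<epsilon>)"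
    proof (intro exI conjI ballI)
      show "nhd (V (i + 2))" by (rule V(1))
      fix u assume "u \<in> V (i + 2) \<inter> center G"
      then have "L u \<le> (1/2) ^ i" by (intro L(2)) (simp add: U_def)
      then show "L u < \<epsilon>" using \<open>(1/2) ^ i < \<epsilon>\<close> by linarith
    qed
  qed
  ultimately show ?thesis using L(1,3) that by blast
qed

section \<open>Seminorms on the extension by the integers\<close>

abbreviation \<Gamma> where "\<Gamma> \<equiv> G \<times>\<times> integer_group"

lemma group_\<Gamma>: "group \<Gamma>" by (simp add: DirProd_group is_group)

lemma inv_\<Gamma>: "x \<in> carrier G \<Longrightarrow> inv\<^bsub>\<Gamma>\<^esub> (x, d) = (inv x, - d)"
  using inv_DirProd[OF is_group group_integer_group] by simp

text \<open>In a topology defined by such functions on \<open>G \<times> \<int>\<close> the inclusion of \<open>G\<close> is continuous and the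
  elements \<open>(z k, 0)\<close> converge along \<open>p\<close> to \<open>(\<one>, 1)\<close>.\<close>
definition adapted :: "('k \<Rightarrow> 'a) \<Rightarrow> 'k filter \<Rightarrow> ('a \<times> int \<Rightarrow> real) \<Rightarrow> bool" where
  "adapted z p L \<longleftrightarrow> continuous_at_one (\<lambda>u. L (u, 0)) \<and> (\<forall>\<epsilon>>0. eventually (\<lambda>k. L (z k, -1) < \<epsilon>) p)"

text \<open>The quotient seminorm for the surjection \<open>(e, u) \<mapsto> (word z e \<otimes> u, - sum e)\<close> from the
  direct product of the free abelian group and \<open>G\<close>, where the generator with index \<open>k\<close> has length \<open>w k\<close>.
  The surjection is a homomorphism because the \<open>z k\<close> are central.\<close>
lemma word_norm:
  fixes z :: "nat \<Rightarrow> 'a" and w :: "nat \<Rightarrow> real"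
  assumes N: "seminorm G N" "continuous_at_one N" and z: "\<And>k. z k \<in> center G"
    and w: "\<And>k. 0 \<le> w k" "(w \<longlongrightarrow> 0) p"
  obtains L where "seminorm \<Gamma> L" "adapted z p L"
    "\<And>x d r. x \<in> carrier G \<Longrightarrow> L (x, d) < r \<Longrightarrow> \<exists>e. finite {k. e k \<noteq> 0} \<and> (\<Sum>k | e k \<noteq> 0. e k) = - d \<and>
       (\<Sum>k | e k \<noteq> 0. \<bar>e k\<bar> * w k) + N (inv (C.word z e) \<otimes> x) < r"
proof -
  let ?W = "C.word z"
  define S where "S e = (\<Sum>k | e k \<noteq> 0. \<bar>e k\<bar> * w k)" for e :: "nat \<Rightarrow> int"
  define s where "s e = (\<Sum>k | e k \<noteq> 0. e k)" for e :: "nat \<Rightarrow> int"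
  have W: "?W e \<in> center G" for e by (rule C.word_closed[OF z])
  then have Wc: "?W e \<in> carrier G" for e using center_carrier by blast
  have S0: "0 \<le> S e" for e unfolding S_def by (rule sum_nonneg) (use w in auto)
  have S_eq: "S e = (\<Sum>k\<in>K. \<bar>e k\<bar> * w k)" if "finite K" "{k. e k \<noteq> 0} \<subseteq> K" for e :: "nat \<Rightarrow> int" and K
    unfolding S_def by (rule sum.mono_neutral_left) (use that in auto)
  have s_eq: "s e = (\<Sum>k\<in>K. e k)" if "finite K" "{k. e k \<noteq> 0} \<subseteq> K" for e :: "nat \<Rightarrow> int" and K
    unfolding s_def by (rule sum.mono_neutral_left) (use that in auto)
  define E where "E d = {e. finite {k. e k \<noteq> 0} \<and> s e = - d}" for d
  define V where "V x d = (\<lambda>e. S e + N (inv (?W e) \<otimes> x)) ` E d" for x d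
  define L where "L = (\<lambda>(x, d). Inf (V x d))"
  have N0: "0 \<le> N x" if "x \<in> carrier G" for x by (rule seminormD(2)[OF N(1) that])
  have V0: "0 \<le> r" if "r \<in> V x d" "x \<in> carrier G" for r x d
    using that S0 N0 Wc by (auto simp: V_def intro!: add_nonneg_nonneg)
  have bdd: "bdd_below (V x d)" if "x \<in> carrier G" for x d
    by (rule bdd_belowI[of _ 0]) (use V0 that in blast)
  have single: "(\<lambda>j. if j = k then c else 0) \<in> E (- c)" "S (\<lambda>j. if j = k then c else 0) = \<bar>c\<bar> * w k" for k and c :: int
  proof -
    have sub: "{j. (if j = k then c else 0) \<noteq> 0} \<subseteq> {k}" by auto
    then show "(\<lambda>j. if j = k then c else 0) \<in> E (- c)" "S (\<lambda>j. if j = k then c else 0) = \<bar>c\<bar> * w k"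
      unfolding E_def using finite_subset[OF sub] s_eq[OF _ sub] S_eq[OF _ sub] by simp_all
  qed
  have ne: "V x d \<noteq> {}" for x d using single(1)[of _ "- d"] by (auto simp: V_def)
  have LI: "L (x, d) \<le> S e + N (inv (?W e) \<otimes> x)" if "x \<in> carrier G" "e \<in> E d" for x d e
    unfolding L_def using that by (auto simp: V_def intro!: cInf_lower bdd[unfolded V_def])
  have LD: "\<exists>e\<in>E d. S e + N (inv (?W e) \<otimes> x) < r" if "x \<in> carrier G" "L (x, d) < r" for x d r
    using cInf_lessD[OF ne, of x d r] that by (auto simp: L_def V_def)
  have L0: "0 \<le> L (x, d)" if "x \<in> carrier G" for x d
    unfolding L_def using cInf_greatest[OF ne] V0 that by auto
  have tri: "L (x \<otimes> y, d + d') \<le> L (x, d) + L (y, d')" if x: "x \<in> carrier G" and y: "y \<in> carrier G" for x y d d'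
  proof (rule field_le_epsilon)
    fix \<epsilon> :: real assume "\<epsilon> > 0"
    then obtain e e' where e: "e \<in> E d" "S e + N (inv (?W e) \<otimes> x) < L (x, d) + \<epsilon> / 2"
      "e' \<in> E d'" "S e' + N (inv (?W e') \<otimes> y) < L (y, d') + \<epsilon> / 2"
      using LD[OF x, of d "L (x, d) + \<epsilon> / 2"] LD[OF y, of d' "L (y, d') + \<epsilon> / 2"] by auto
    let ?e = "\<lambda>k. e k + e' k" and ?K = "{k. e k \<noteq> 0} \<union> {k. e' k \<noteq> 0}"
    have K: "finite ?K" "{k. ?e k \<noteq> 0} \<subseteq> ?K" "{k. e k \<noteq> 0} \<subseteq> ?K" "{k. e' k \<noteq> 0} \<subseteq> ?K"
      using e by (auto simp: E_def)
    have "S ?e \<le> (\<Sum>k\<in>?K. \<bar>e k\<bar> * w k + \<bar>e' k\<bar> * w k)"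
      unfolding S_eq[OF K(1,2)] by (rule sum_mono)
        (simp add: distrib_right[symmetric] mult_right_mono[OF _ w(1)] flip: of_int_add of_int_abs)
    also have "\<dots> = S e + S e'" using K by (simp add: S_eq[of ?K] sum.distrib)
    finally have Se: "S ?e \<le> S e + S e'" .
    have "s ?e = s e + s e'" using K by (simp add: s_eq[of ?K] sum.distrib)
    then have eE: "?e \<in> E (d + d')" using e finite_subset[OF K(2,1)] by (simp add: E_def)
    have "?W ?e = ?W e \<otimes> ?W e'" by (rule C.word_add) (use z e in \<open>auto simp: E_def\<close>)
    then have "inv (?W ?e) \<otimes> (x \<otimes> y) = inv (?W e') \<otimes> inv (?W e) \<otimes> (x \<otimes> y)"
      using Wc by (simp add: inv_mult_group)
    also have "\<dots> = inv (?W e') \<otimes> (inv (?W e) \<otimes> x) \<otimes> y" using x y Wc by (simp add: m_assoc)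
    also have "inv (?W e') \<otimes> (inv (?W e) \<otimes> x) = (inv (?W e) \<otimes> x) \<otimes> inv (?W e')"
      by (rule center_comm) (use x Wc subgroup.m_inv_closed[OF center_subgroup W] in auto)
    finally have "inv (?W ?e) \<otimes> (x \<otimes> y) = (inv (?W e) \<otimes> x) \<otimes> (inv (?W e') \<otimes> y)"
      using x y Wc by (simp add: m_assoc)
    then have "N (inv (?W ?e) \<otimes> (x \<otimes> y)) \<le> N (inv (?W e) \<otimes> x) + N (inv (?W e') \<otimes> y)"
      using seminormD(4)[OF N(1)] x y Wc by simp
    then show "L (x \<otimes> y, d + d') \<le> L (x, d) + L (y, d') + \<epsilon>"
      using LI[OF _ eE, of "x \<otimes> y"] Se e x y by auto
  qed
  have symm: "L (inv x, - d) \<le> L (x, d)" if x: "x \<in> carrier G" for x d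
  proof (rule field_le_epsilon)
    fix \<epsilon> :: real assume "\<epsilon> > 0"
    then obtain e where e: "e \<in> E d" "S e + N (inv (?W e) \<otimes> x) < L (x, d) + \<epsilon>"
      using LD[OF x, of d "L (x, d) + \<epsilon>"] by auto
    have eE: "(\<lambda>k. - e k) \<in> E (- d)" using e by (auto simp: E_def s_def sum_negf)
    have "?W (\<lambda>k. - e k) = inv (?W e)"
      using C.word_minus[of z e] z e W by (simp add: E_def center_inv)
    then have "inv (?W (\<lambda>k. - e k)) \<otimes> inv x = ?W e \<otimes> inv x" using Wc by simp
    also have "\<dots> = inv x \<otimes> ?W e" by (rule center_comm) (use W x in auto)
    also have "\<dots> = inv (inv (?W e) \<otimes> x)" using x Wc by (simp add: inv_mult_group)
    finally have "N (inv (?W (\<lambda>k. - e k)) \<otimes> inv x) = N (inv (?W e) \<otimes> x)"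
      using seminormD(3)[OF N(1)] x Wc by simp
    moreover have "S (\<lambda>k. - e k) = S e" by (simp add: S_def)
    ultimately show "L (inv x, - d) \<le> L (x, d) + \<epsilon>" using LI[OF _ eE, of "inv x"] e x by simp
  qed
  have "L (\<one>, 0) \<le> 0"
    using LI[OF one_closed, of "\<lambda>k. 0" 0] seminormD(1)[OF N(1)] by (simp add: E_def S_def s_def C.word_zero)
  then have one: "L (\<one>, 0) = 0" using L0[OF one_closed, of 0] by simp
  have Ls: "seminorm \<Gamma> L"
    unfolding seminorm_def prenorm_def
  proof (intro conjI ballI)
    show "L \<one>\<^bsub>\<Gamma>\<^esub> = 0" using one by simp
    fix a assume a: "a \<in> carrier \<Gamma>"
    then show "0 \<le> L a" using L0 by auto
    obtain x d where xd: "a = (x, d)" "x \<in> carrier G" using a by auto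
    show "L (a \<otimes>\<^bsub>\<Gamma>\<^esub> b) \<le> L a + L b" if "b \<in> carrier \<Gamma>" for b using xd that tri by auto
    have "inv\<^bsub>\<Gamma>\<^esub> a = (inv x, - d)" using xd inv_DirProd[OF is_group group_integer_group] by simp
    then show "L (inv\<^bsub>\<Gamma>\<^esub> a) = L a" using symm[OF xd(2), of d] symm[of "inv x" "- d"] xd by simp
  qed
  have "adapted z p L" unfolding adapted_def
  proof (intro conjI allI impI)
    have "L (x, 0) \<le> N x" if "x \<in> carrier G" for x
      using LI[OF that, of "\<lambda>k. 0" 0] that by (simp add: E_def S_def s_def C.word_zero)
    then show "continuous_at_one (\<lambda>u. L (u, 0))"
      using N(2) nhd_carrier unfolding continuous_at_one_def by (meson le_less_trans subsetD)
    fix \<epsilon> :: real assume "\<epsilon> > 0"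
    then have "eventually (\<lambda>k. w k < \<epsilon>) p" using w(2) by (rule order_tendstoD(2)[rotated])
    moreover have "L (z k, -1) \<le> w k" for k
    proof -
      have zk: "z k \<in> carrier G" using z center_carrier by blast
      have "?W (\<lambda>j. if j = k then 1 else 0) = z k"
        using C.word_single[of z k 1] z zk by (simp add: center_int_pow)
      then show ?thesis using LI[OF zk, of "\<lambda>j. if j = k then 1 else 0" "-1"] single[of k 1] zk
        by (simp add: seminormD(1)[OF N(1)])
    qed
    ultimately show "eventually (\<lambda>k. L (z k, -1) < \<epsilon>) p" by (meson eventually_mono le_less_trans)
  qed
  show ?thesis
    by (rule that[OF Ls \<open>adapted z p L\<close>]) (use LD in \<open>auto simp: E_def S_def s_def\<close>)
qed

text \<open>Total boundedness, with translations by central elements only. For sets of central elements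
  one-sided coverings suffice.\<close>
definition centrally_bounded :: "'a set \<Rightarrow> bool" where
  "centrally_bounded A \<longleftrightarrow> (\<forall>U. nhd U \<longrightarrow> (\<exists>F. finite F \<and> F \<subseteq> center G \<and> (\<forall>a\<in>A. \<exists>f\<in>F. inv f \<otimes> a \<in> U)))"

lemma nhd_away_from_closed:
  assumes "closedin T A" "g \<in> carrier G" "g \<notin> A"
  obtains U where "nhd U" "\<And>u. u \<in> U \<Longrightarrow> g \<otimes> inv u \<notin> A"
proof -
  have "openin T (topspace T - A)" using assms(1) by blast
  then have "openin T {x \<in> carrier G. g \<otimes> x \<in> topspace T - A}" (is "openin T ?O")
    by (rule open_vimage[OF continuous_mult_left[OF assms(2)]])
  then have "nhd ?O" using assms topspace_eq by (simp add: nhd_def)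
  then have "nhd {x \<in> carrier G. inv x \<in> ?O}" by (rule nhd_inv)
  then show ?thesis by (rule that) auto
qed

text \<open>Suppose that all adapted seminorms vanish at \<open>(g, d)\<close>. Apply this to the quotient seminorm with weights
  \<open>w k\<close> that dominate \<open>1 / Suc k\<close> and the oscillation from \<open>word_oscillation\<close>. There is a cheap word
  \<open>e1\<close> close to \<open>g\<close> with exponent sum \<open>- d\<close>, and then another one, \<open>e2\<close>, so cheap that its support
  lies beyond that of \<open>e1\<close>. The word of the difference is small and its exponents are bounded by their indices,
  so that independence makes \<open>n\<close> divide all exponents of \<open>e2\<close>, and therefore \<open>d\<close>. This settles
  the case \<open>\<not> int n dvd d\<close>. If \<open>d = 0\<close>, then \<open>e2\<close> is a combination of \<open>n\<close>-th powers with exponent sum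
  zero; its oscillation is small, and \<open>g\<close> is close to a word on which \<open>l\<close> is small.\<close>
lemma word_norm_positive:
  fixes z :: "nat \<Rightarrow> 'a" and L0 :: "'a \<Rightarrow> real"
  assumes p: "ultrafilter p" "p \<le> sequentially" and z: "\<And>k. z k \<in> center G"
    and L0: "seminorm (center_group G) L0" "continuous_on_center L0" "0 < \<epsilon>"
      "\<And>e k. finite {k. e k \<noteq> 0} \<Longrightarrow> (\<And>k. \<bar>e k\<bar> \<le> int k) \<Longrightarrow> L0 (C.word z e) < \<epsilon> \<Longrightarrow> n \<le> k \<Longrightarrow> int n dvd e k"
    and l: "C.tame l n" "continuous_on_center l"
    and g: "g \<in> center G" "\<not> int n dvd d \<or> d = 0 \<and> 1 \<le> l g"
  shows "\<exists>L. seminorm \<Gamma> L \<and> adapted z p L \<and> 0 < L (g, d)"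
proof -
  let ?W = "C.word z"
  have ls: "seminorm (center_group G) l" using l by (simp add: C.tame_def)
  have gc: "g \<in> carrier G" using g center_carrier by blast
  obtain v :: "nat \<Rightarrow> real" where v: "\<And>k. 0 \<le> v k" "(v \<longlongrightarrow> 0) p"
    "\<And>e. finite {k. e k \<noteq> 0} \<Longrightarrow> (\<Sum>k | e k \<noteq> 0. e k) = 0 \<Longrightarrow>
      l (?W (\<lambda>k. e k * int n)) \<le> (\<Sum>k | e k \<noteq> 0. \<bar>real_of_int (e k)\<bar> * v k)"
    by (rule C.word_oscillation[OF p(1) l(1), of z]) (use z that in blast)+
  \<comment> \<open>The summand \<open>1 / Suc k\<close> makes the exponents of a word of length below 1 bounded by their indices.\<close>
  define w where "w k = v k + 1 / real (Suc k)" for k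
  have w0: "0 < w k" "v k \<le> w k" "1 / real (Suc k) \<le> w k" for k
    using v(1)[of k] by (auto simp: w_def add_nonneg_pos)
  have "((\<lambda>k. 1 / real (Suc k)) \<longlongrightarrow> 0) p"
    by (rule tendsto_mono[OF p(2)]) (use LIMSEQ_inverse_real_of_nat in \<open>simp add: inverse_eq_divide\<close>)
  then have wlim: "(w \<longlongrightarrow> 0) p" using tendsto_add[OF v(2)] unfolding w_def by fastforce
  \<comment> \<open>Two errors below \<open>\<delta>\<close> add up to \<open>\<epsilon>\<close> for \<open>L0\<close>; for \<open>l\<close> the total error stays below 1.\<close>
  define \<delta> where "\<delta> = min (1/4) (\<epsilon> / 2)"
  have \<delta>: "0 < \<delta>" "\<delta> \<le> 1/4" "2 * \<delta> \<le> \<epsilon>" using L0(3) by (auto simp: \<delta>_def)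
  obtain U1 U2 where U: "nhd U1" "\<And>u. u \<in> U1 \<inter> center G \<Longrightarrow> L0 u < \<delta>"
    "nhd U2" "\<And>u. u \<in> U2 \<inter> center G \<Longrightarrow> l u < \<delta>"
    using L0(2) l(2) \<delta>(1) unfolding continuous_on_center_def by meson
  obtain N where N: "seminorm G N" "continuous_at_one N" "\<And>x. x \<in> carrier G \<Longrightarrow> N x < 1 \<Longrightarrow> x \<in> U1 \<inter> U2"
    by (rule continuous_seminorm_in_nhd[OF nhd_Int[OF U(1,3)]]) (use that in blast)
  obtain L where L: "seminorm \<Gamma> L" "adapted z p L"
    "\<And>x d r. x \<in> carrier G \<Longrightarrow> L (x, d) < r \<Longrightarrow> \<exists>e. finite {k. e k \<noteq> 0} \<and> (\<Sum>k | e k \<noteq> 0. e k) = - d \<and>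
       (\<Sum>k | e k \<noteq> 0. \<bar>real_of_int (e k)\<bar> * w k) + N (inv (?W e) \<otimes> x) < r"
    by (rule word_norm[OF N(1,2) z less_imp_le[OF w0(1)] wlim]) (rule that)
  have W: "?W e \<in> center G" for e by (rule C.word_closed[OF z])
  have Wc: "?W e \<in> carrier G" for e using W center_carrier by blast
  have Wg: "inv (?W e) \<otimes> g \<in> center G" for e
    using W g(1) by (meson center_subgroup subgroup.m_closed subgroup.m_inv_closed)
  have Wgc: "inv (?W e) \<otimes> g \<in> carrier G" for e using Wg center_carrier by blast
  show ?thesis
  proof (rule ccontr)
    assume "\<not> ?thesis"
    then have neg: "L (g, d) \<le> 0" using L(1,2) by (metis not_le)
    have pick: "\<exists>e. finite {k. e k \<noteq> 0} \<and> (\<Sum>k | e k \<noteq> 0. e k) = - d \<and>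
        (\<Sum>k | e k \<noteq> 0. \<bar>real_of_int (e k)\<bar> * w k) < r \<and> inv (?W e) \<otimes> g \<in> U1 \<inter> U2 \<inter> center G" if r: "0 < r" "r \<le> 1" for r
    proof -
      obtain e where e: "finite {k. e k \<noteq> 0}" "(\<Sum>k | e k \<noteq> 0. e k) = - d"
        "(\<Sum>k | e k \<noteq> 0. \<bar>real_of_int (e k)\<bar> * w k) + N (inv (?W e) \<otimes> g) < r"
        using L(3)[OF gc, of d r] neg r by auto
      have "0 \<le> N (inv (?W e) \<otimes> g)" by (rule seminormD(2)[OF N(1) Wgc])
      moreover have "0 \<le> (\<Sum>k | e k \<noteq> 0. \<bar>real_of_int (e k)\<bar> * w k)" by (rule sum_nonneg) (use less_imp_le[OF w0(1)] in auto)
      ultimately have "(\<Sum>k | e k \<noteq> 0. \<bar>real_of_int (e k)\<bar> * w k) < r" "N (inv (?W e) \<otimes> g) < 1" using e(3) r by linarith+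
      then show ?thesis using e N(3)[OF Wgc] Wg by blast
    qed
    have summand: "\<bar>real_of_int (e k)\<bar> * w k < r" if "finite {k. e k \<noteq> 0}" "(\<Sum>k | e k \<noteq> 0. \<bar>real_of_int (e k)\<bar> * w k) < r" "0 < r" for e :: "nat \<Rightarrow> int" and k r
    proof (cases "e k = 0")
      case False
      have "\<bar>real_of_int (e k)\<bar> * w k \<le> (\<Sum>k | e k \<noteq> 0. \<bar>real_of_int (e k)\<bar> * w k)"
        by (rule member_le_sum) (use that False less_imp_le[OF w0(1)] in auto)
      then show ?thesis using that by linarith
    qed (use that in simp)
    have small: "\<bar>e k\<bar> \<le> int k" if "finite {k. e k \<noteq> 0}" "(\<Sum>k | e k \<noteq> 0. \<bar>real_of_int (e k)\<bar> * w k) < 1" for e :: "nat \<Rightarrow> int" and k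
    proof -
      have "\<bar>real_of_int (e k)\<bar> * (1 / real (Suc k)) \<le> \<bar>real_of_int (e k)\<bar> * w k" by (rule mult_left_mono[OF w0(3)]) simp
      then have "\<bar>real_of_int (e k)\<bar> * (1 / real (Suc k)) < 1" using summand[OF that, of k] by linarith
      then have "\<bar>real_of_int (e k)\<bar> < real (Suc k)" by (simp add: field_simps)
      then have "\<bar>e k\<bar> < int (Suc k)" by linarith
      then show ?thesis by simp
    qed
    obtain e1 where e1: "finite {k. e1 k \<noteq> 0}" "(\<Sum>k | e1 k \<noteq> 0. \<bar>real_of_int (e1 k)\<bar> * w k) < 1"
      "inv (?W e1) \<otimes> g \<in> U1 \<inter> U2 \<inter> center G" using pick[of 1] by auto
    obtain m0 where m0: "{k. e1 k \<noteq> 0} \<subseteq> {..<m0}" using e1(1) finite_nat_iff_bounded by blast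
    define m where "m = max m0 (Suc n)"
    have m: "\<And>k. m \<le> k \<Longrightarrow> e1 k = 0" "n \<le> m" "0 < m" using m0 by (auto simp: m_def)
    define \<eta> where "\<eta> = Min (insert (1/4) (w ` {..<m}))"
    have \<eta>: "0 < \<eta>" "\<eta> \<le> 1/4" "\<And>k. k < m \<Longrightarrow> \<eta> \<le> w k"
    proof -
      show "0 < \<eta>" unfolding \<eta>_def by (subst Min_gr_iff) (use w0 in auto)
      show "\<eta> \<le> 1/4" "\<And>k. k < m \<Longrightarrow> \<eta> \<le> w k" unfolding \<eta>_def by (rule Min_le; simp)+
    qed
    obtain e2 where e2: "finite {k. e2 k \<noteq> 0}" "(\<Sum>k | e2 k \<noteq> 0. e2 k) = - d"
      "(\<Sum>k | e2 k \<noteq> 0. \<bar>real_of_int (e2 k)\<bar> * w k) < \<eta>" "inv (?W e2) \<otimes> g \<in> U1 \<inter> U2 \<inter> center G"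
      using pick[of \<eta>] \<eta> by auto
    have e2_low: "e2 k = 0" if "k < m" for k
    proof (rule ccontr)
      assume "e2 k \<noteq> 0"
      then have "1 * w k \<le> \<bar>real_of_int (e2 k)\<bar> * w k" using w0(1)[of k] by (intro mult_right_mono) auto
      then show False using summand[OF e2(1,3) \<eta>(1), of k] \<eta>(3)[OF that] by linarith
    qed
    define e where "e k = e2 k + - e1 k" for k
    have fe: "finite {k. e k \<noteq> 0}"
      by (rule finite_subset[OF _ finite_UnI[OF e1(1) e2(1)]]) (auto simp: e_def)
    have e_small: "\<bar>e k\<bar> \<le> int k" for k
      using small[OF e1(1,2), of k] small[OF e2(1), of k] e2(3) \<eta>(2) e2_low[of k] m(1)[of k]
      by (cases "k < m") (auto simp: e_def)
    have We: "?W e = ?W e2 \<otimes> inv (?W e1)"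
    proof -
      have "?W e = ?W e2 \<otimes> ?W (\<lambda>k. - e1 k)" unfolding e_def
        by (rule C.word_add) (use z e1 e2 in auto)
      then show ?thesis using C.word_minus[of z e1] z e1(1) W by (simp add: center_inv)
    qed
    have "?W e = (inv (?W e1) \<otimes> g) \<otimes> inv (inv (?W e2) \<otimes> g)"
    proof -
      have "(inv (?W e1) \<otimes> g) \<otimes> inv (inv (?W e2) \<otimes> g) = inv (?W e1) \<otimes> ?W e2"
        using Wc gc by (simp add: inv_mult_group m_assoc mult_inv_mult_cancel)
      also have "\<dots> = ?W e" unfolding We
        using center_comm[OF W[of e2], of "inv (?W e1)"] Wc by simp
      finally show ?thesis ..
    qed
    then have "L0 (?W e) \<le> L0 (inv (?W e1) \<otimes> g) + L0 (inv (?W e2) \<otimes> g)"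
      using seminormD(4)[OF L0(1), of "inv (?W e1) \<otimes> g" "inv (inv (?W e2) \<otimes> g)"]
        seminormD(3)[OF L0(1), of "inv (?W e2) \<otimes> g"] Wg subgroup.m_inv_closed[OF center_subgroup Wg]
      by (simp add: center_inv)
    also have "\<dots> < \<epsilon>" using U(2) e1(3) e2(4) \<delta>(3) by (smt (verit) Int_iff)
    finally have dvd_e: "int n dvd e k" if "n \<le> k" for k using L0(4)[OF fe e_small _ that] by blast
    have dvd: "int n dvd e2 k" for k
    proof (cases "k < m")
      case False
      then show ?thesis using dvd_e[of k] m(1)[of k] m(2) by (simp add: e_def)
    qed (simp add: e2_low)
    then have "int n dvd (\<Sum>k | e2 k \<noteq> 0. e2 k)" by (intro dvd_sum)
    then have "int n dvd d" unfolding e2(2) by simp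
    then have d0: "d = 0" "1 \<le> l g" using g(2) by auto
    define f where "f k = e2 k div int n" for k
    have f: "e2 = (\<lambda>k. f k * int n)" using dvd by (auto simp: f_def)
    have ff: "finite {k. f k \<noteq> 0}" by (rule finite_subset[OF _ e2(1)]) (auto simp: f_def)
    have "(\<Sum>k | e2 k \<noteq> 0. f k) * int n = 0" using e2(2) d0 f by (simp add: sum_distrib_right)
    moreover have fsupp: "{k. f k \<noteq> 0} = {k. e2 k \<noteq> 0}" if "n \<noteq> 0" using f that by auto
    ultimately have "(\<Sum>k | f k \<noteq> 0. f k) = 0"
      by (cases "n = 0") (auto simp: f_def)
    then have "l (?W e2) \<le> (\<Sum>k | f k \<noteq> 0. \<bar>real_of_int (f k)\<bar> * v k)" using v(3)[OF ff] f by metis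
    also have "\<dots> \<le> (\<Sum>k | e2 k \<noteq> 0. \<bar>real_of_int (e2 k)\<bar> * w k)"
    proof (rule sum_mono2[OF e2(1), THEN order_trans[rotated]])
      show "(\<Sum>k | f k \<noteq> 0. \<bar>real_of_int (f k)\<bar> * v k) \<le> (\<Sum>k | f k \<noteq> 0. \<bar>real_of_int (e2 k)\<bar> * w k)"
      proof (rule sum_mono)
        fix k assume k: "k \<in> {k. f k \<noteq> 0}"
        then have "int n \<noteq> 0" by (cases "n = 0") (simp_all add: f_def)
        then have "\<bar>f k\<bar> * 1 \<le> \<bar>f k\<bar> * int n" by (intro mult_left_mono) auto
        then have "\<bar>f k\<bar> \<le> \<bar>e2 k\<bar>" using f by (metis abs_mult abs_of_nat mult.right_neutral)
        then show "\<bar>real_of_int (f k)\<bar> * v k \<le> \<bar>real_of_int (e2 k)\<bar> * w k" using w0(2)[of k] v(1)[of k] by (intro mult_mono) auto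
      qed
      show "{k. f k \<noteq> 0} \<subseteq> {k. e2 k \<noteq> 0}" by (auto simp: f_def)
    qed (use less_imp_le[OF w0(1)] in auto)
    also have "\<dots> < 1/4" using e2(3) \<eta>(2) by linarith
    finally have "l (?W e2) < 1/4" .
    moreover have "l (inv (?W e2) \<otimes> g) < 1/4" using U(4) e2(4) \<delta>(2) by (smt (verit) Int_iff)
    moreover have "l g \<le> l (?W e2) + l (inv (?W e2) \<otimes> g)"
      using seminormD(4)[OF ls, of "?W e2" "inv (?W e2) \<otimes> g"] W Wg Wc gc by (simp add: m_assoc[symmetric])
    ultimately show False using d0 by linarith
  qed
qed

text \<open>There may be too many tame seminorms for one sequence to be independent of all of them. The
  generator \<open>n\<close> of the ideal of exponents is a natural number, however, and in \<open>word_norm_positive\<close>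
  the seminorm \<open>L0\<close> used for independence and the seminorm \<open>l\<close> used for separation only need to
  have the same \<open>n\<close>. So one seminorm is selected for every \<open>n\<close> that occurs.\<close>
theorem separating_extension:
  obtains z :: "nat \<Rightarrow> 'a" and p where "ultrafilter p" "range z \<subseteq> center G"
    "\<And>g d. g \<in> carrier G \<Longrightarrow> (g, d) \<noteq> (\<one>, 0) \<Longrightarrow> d = 0 \<or> \<not> centrally_bounded ((\<lambda>x. x [^] d) ` center G) \<Longrightarrow>
      \<exists>L. seminorm \<Gamma> L \<and> adapted z p L \<and> 0 < L (g, d)"
proof -
  define P where "P l n \<longleftrightarrow> C.tame l n \<and> continuous_on_center l" for l n
  define I where "I = {n. \<exists>l. P l n}"
  have "\<exists>L0. \<forall>n. n \<in> I \<longrightarrow> P (L0 n) n" by (intro choice) (auto simp: I_def)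
  then obtain L0 where L0: "\<And>n. n \<in> I \<Longrightarrow> P (L0 n) n" by blast
  obtain z \<epsilon> where z: "\<And>k :: nat. z k \<in> center G" and \<epsilon>: "\<And>n. n \<in> I \<Longrightarrow> 0 < \<epsilon> n"
    "\<And>n e k. n \<in> I \<Longrightarrow> finite {k. e k \<noteq> 0} \<Longrightarrow> (\<And>k. \<bar>e k\<bar> \<le> int k) \<Longrightarrow>
       L0 n (C.word z e) < \<epsilon> n \<Longrightarrow> n \<le> k \<Longrightarrow> int n dvd e k"
    by (rule C.independent_sequence[of I L0]) (use L0 that in \<open>auto simp: P_def\<close>)
  obtain p :: "nat filter" where p: "ultrafilter p" "p \<le> sequentially"
    using ultrafilter_below[of sequentially] by auto
  have sep: "\<exists>L. seminorm \<Gamma> L \<and> adapted z p L \<and> 0 < L (g, d)"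
    if "P l n" "g \<in> center G" "\<not> int n dvd d \<or> d = 0 \<and> 1 \<le> l g" for l n g and d :: int
  proof -
    have n: "n \<in> I" using that(1) by (auto simp: I_def)
    show ?thesis
    proof (rule word_norm_positive[OF p z])
      show "seminorm (center_group G) (L0 n)" "continuous_on_center (L0 n)"
        using L0[OF n] by (auto simp: P_def C.tame_def)
      show "0 < \<epsilon> n" by (rule \<epsilon>(1)[OF n])
      show "int n dvd e k" if "finite {k. e k \<noteq> 0}" "\<And>k. \<bar>e k\<bar> \<le> int k" "L0 n (C.word z e) < \<epsilon> n" "n \<le> k" for e k
        by (rule \<epsilon>(2)[OF n]) (use that in auto)
      show "C.tame l n" "continuous_on_center l" using that(1) by (auto simp: P_def)
    qed (use that in auto)
  qed
  show ?thesis
  proof (rule that[OF p(1)])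
    show "range z \<subseteq> center G" using z by blast
  next
    fix g and d :: int assume g: "g \<in> carrier G" "(g, d) \<noteq> (\<one>, 0)"
      and ntb: "d = 0 \<or> \<not> centrally_bounded ((\<lambda>x. x [^] d) ` center G)"
    show "\<exists>L. seminorm \<Gamma> L \<and> adapted z p L \<and> 0 < L (g, d)"
    proof (cases "g \<in> center G")
      case False
      obtain U where U: "nhd U" "\<And>u. u \<in> U \<Longrightarrow> g \<otimes> inv u \<notin> center G"
        by (rule nhd_away_from_closed[OF closed_center g(1) False]) (use that in blast)
      obtain N where N: "seminorm G N" "continuous_at_one N" "\<And>x. x \<in> carrier G \<Longrightarrow> N x < 1 \<Longrightarrow> x \<in> U"
        by (rule continuous_seminorm_in_nhd[OF U(1)]) (use that in blast)
      obtain L where L: "seminorm \<Gamma> L" "adapted z p L"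
        "\<And>x d r. x \<in> carrier G \<Longrightarrow> L (x, d) < r \<Longrightarrow> \<exists>e. finite {k. e k \<noteq> 0} \<and> (\<Sum>k | e k \<noteq> 0. e k) = - d \<and>
           (\<Sum>k | e k \<noteq> 0. \<bar>real_of_int (e k)\<bar> * 0) + N (inv (C.word z e) \<otimes> x) < r"
        by (rule word_norm[OF N(1,2), of z "\<lambda>k. 0" p]) (use that z in auto)
      have "0 < L (g, d)"
      proof (rule ccontr)
        assume "\<not> ?thesis"
        then obtain e where e: "N (inv (C.word z e) \<otimes> g) < 1" using L(3)[OF g(1), of d 1] by auto
        have W: "C.word z e \<in> center G" by (rule C.word_closed[OF z])
        then have Wc: "C.word z e \<in> carrier G" using center_carrier by blast
        have "inv (C.word z e) \<otimes> g \<in> U" using N(3) e Wc g by auto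
        then have "g \<otimes> inv (inv (C.word z e) \<otimes> g) \<notin> center G" by (rule U(2))
        moreover have "g \<otimes> inv (inv (C.word z e) \<otimes> g) = C.word z e"
          using Wc g by (simp add: inv_mult_group m_assoc[symmetric])
        ultimately show False using W by simp
      qed
      with L show ?thesis by blast
    next
      case True
      show ?thesis
      proof (cases "d = 0")
        case True
        then have "g \<noteq> \<one>" using g by simp
        moreover have "closedin T {\<one>}"
          using hausdorff topspace_eq by (intro closedin_Hausdorff_singleton) auto
        ultimately obtain U where U: "nhd U" "\<And>u. u \<in> U \<Longrightarrow> g \<otimes> inv u \<noteq> \<one>"
          using nhd_away_from_closed[of "{\<one>}" g] g(1) by auto
        have "g \<notin> U" using U(2)[of g] g(1) by auto
        obtain l n where l: "C.tame l n" "continuous_on_center l" "\<And>x. x \<in> center G \<Longrightarrow> l x < 1 \<Longrightarrow> x \<in> U"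
          by (rule tame_seminorm_in_nhd[OF U(1)]) (use that in blast)
        have "1 \<le> l g" using l(3)[OF \<open>g \<in> center G\<close>] \<open>g \<notin> U\<close> by force
        then show ?thesis using sep[of l n g d] l True \<open>g \<in> center G\<close> by (auto simp: P_def)
      next
        case False
        then obtain U where U: "nhd U"
          "\<not> (\<exists>F. finite F \<and> F \<subseteq> center G \<and> (\<forall>a\<in>(\<lambda>x. x [^] d) ` center G. \<exists>f\<in>F. inv f \<otimes> a \<in> U))"
          using ntb unfolding centrally_bounded_def by blast
        obtain l n where l: "C.tame l n" "continuous_on_center l" "\<And>x. x \<in> center G \<Longrightarrow> l x < 1 \<Longrightarrow> x \<in> U"
          by (rule tame_seminorm_in_nhd[OF U(1)]) (use that in blast)
        have "\<not> int n dvd d"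
        proof
          assume "int n dvd d"
          moreover have "C.powers_covered l (int n) 1" using l(1) by (simp add: C.tame_def)
          ultimately have "C.powers_covered l d 1" by (rule C.powers_covered_dvd[rotated])
          then obtain F where F: "finite F" "F \<subseteq> center G"
            "\<And>z. z \<in> center G \<Longrightarrow> \<exists>f\<in>F. l (z [^]\<^bsub>center_group G\<^esub> d \<otimes> inv\<^bsub>center_group G\<^esub> f) < 1"
            unfolding C.powers_covered_def by blast
          have "\<exists>f\<in>F. inv f \<otimes> x [^] d \<in> U" if x: "x \<in> center G" for x
          proof -
            obtain f where f: "f \<in> F" "l (x [^]\<^bsub>center_group G\<^esub> d \<otimes> inv\<^bsub>center_group G\<^esub> f) < 1" using F(3)[OF x] by blast
            have fz: "f \<in> center G" using f F by blast
            then have fc: "f \<in> carrier G" "x \<in> carrier G" using x center_carrier by auto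
            have "x [^]\<^bsub>center_group G\<^esub> d \<otimes> inv\<^bsub>center_group G\<^esub> f \<in> U"
              by (rule l(3)[OF _ f(2)]) (use x fz C.int_pow_closed C.inv_closed C.m_closed in auto)
            moreover have "x [^]\<^bsub>center_group G\<^esub> d \<otimes> inv\<^bsub>center_group G\<^esub> f = inv f \<otimes> x [^] d"
              using x fz fc center_comm[OF subgroup.m_inv_closed[OF center_subgroup fz], of "x [^] d"]
              by (simp add: center_int_pow center_inv)
            ultimately show ?thesis using f(1) by auto
          qed
          then show False using U(2) F by blast
        qed
        then show ?thesis using sep[of l n g d] l True by (auto simp: P_def)
      qed
    qed
  qed
qed

end

section \<open>Topologies defined by prenorms\<close>

definition norm_topology :: "('g, 'm) monoid_scheme \<Rightarrow> ('g \<Rightarrow> real) set \<Rightarrow> 'g topology" where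
  "norm_topology Y \<L> = topology (\<lambda>U. U \<subseteq> carrier Y \<and>
     (\<forall>x\<in>U. \<exists>L\<in>\<L>. \<exists>\<epsilon>>0. \<forall>y\<in>carrier Y. L (inv\<^bsub>Y\<^esub> x \<otimes>\<^bsub>Y\<^esub> y) < \<epsilon> \<longrightarrow> y \<in> U))"

locale norm_family = group Y for Y :: "('g, 'm) monoid_scheme" (structure) +
  fixes \<L> :: "('g \<Rightarrow> real) set"
  assumes nonempty: "\<L> \<noteq> {}"
    and prenorm: "L \<in> \<L> \<Longrightarrow> prenorm Y L"
    and add: "L \<in> \<L> \<Longrightarrow> L' \<in> \<L> \<Longrightarrow> (\<lambda>x. L x + L' x) \<in> \<L>"
    and conj: "L \<in> \<L> \<Longrightarrow> g \<in> carrier Y \<Longrightarrow> \<exists>M\<in>\<L>. \<forall>x\<in>carrier Y. M x = L (g \<otimes> x \<otimes> inv g)"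
begin

lemma norm_nonneg: "L \<in> \<L> \<Longrightarrow> x \<in> carrier Y \<Longrightarrow> 0 \<le> L x"
  and norm_one: "L \<in> \<L> \<Longrightarrow> L \<one> = 0"
  and norm_mult: "L \<in> \<L> \<Longrightarrow> x \<in> carrier Y \<Longrightarrow> y \<in> carrier Y \<Longrightarrow> L (x \<otimes> y) \<le> L x + L y"
  using prenorm unfolding prenorm_def by blast+

abbreviation S where "S \<equiv> norm_topology Y \<L>"

lemma openin_norm_topology: "openin S U \<longleftrightarrow> U \<subseteq> carrier Y \<and>
     (\<forall>x\<in>U. \<exists>L\<in>\<L>. \<exists>\<epsilon>>0. \<forall>y\<in>carrier Y. L (inv x \<otimes> y) < \<epsilon> \<longrightarrow> y \<in> U)"
proof -
  let ?P = "\<lambda>U. U \<subseteq> carrier Y \<and> (\<forall>x\<in>U. \<exists>L\<in>\<L>. \<exists>\<epsilon>>0. \<forall>y\<in>carrier Y. L (inv x \<otimes> y) < \<epsilon> \<longrightarrow> y \<in> U)"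
  have "istopology ?P" unfolding istopology_def
  proof (intro conjI allI impI)
    fix A B assume A: "?P A" and B: "?P B"
    show "A \<inter> B \<subseteq> carrier Y" using A by blast
    show "\<forall>x\<in>A \<inter> B. \<exists>L\<in>\<L>. \<exists>\<epsilon>>0. \<forall>y\<in>carrier Y. L (inv x \<otimes> y) < \<epsilon> \<longrightarrow> y \<in> A \<inter> B"
    proof
      fix x assume x: "x \<in> A \<inter> B"
      obtain L \<epsilon> where L: "L \<in> \<L>" "\<epsilon> > 0" "\<forall>y\<in>carrier Y. L (inv x \<otimes> y) < \<epsilon> \<longrightarrow> y \<in> A" using A x by blast
      obtain L' \<epsilon>' where L': "L' \<in> \<L>" "\<epsilon>' > 0" "\<forall>y\<in>carrier Y. L' (inv x \<otimes> y) < \<epsilon>' \<longrightarrow> y \<in> B" using B x by blast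
      have xc: "x \<in> carrier Y" using A x by blast
      show "\<exists>L\<in>\<L>. \<exists>\<epsilon>>0. \<forall>y\<in>carrier Y. L (inv x \<otimes> y) < \<epsilon> \<longrightarrow> y \<in> A \<inter> B"
      proof (intro bexI[OF _ add[OF L(1) L'(1)]] exI[of _ "min \<epsilon> \<epsilon>'"] conjI ballI impI)
        show "0 < min \<epsilon> \<epsilon>'" using L L' by simp
        fix y assume y: "y \<in> carrier Y" "L (inv x \<otimes> y) + L' (inv x \<otimes> y) < min \<epsilon> \<epsilon>'"
        then have "L (inv x \<otimes> y) < \<epsilon>" "L' (inv x \<otimes> y) < \<epsilon>'"
          using norm_nonneg[OF L(1), of "inv x \<otimes> y"] norm_nonneg[OF L'(1), of "inv x \<otimes> y"] xc by auto
        then show "y \<in> A \<inter> B" using L(3) L'(3) y by blast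
      qed
    qed
  next
    fix K assume K: "\<forall>A\<in>K. ?P A"
    show "\<Union>K \<subseteq> carrier Y" using K by blast
    show "\<forall>x\<in>\<Union>K. \<exists>L\<in>\<L>. \<exists>\<epsilon>>0. \<forall>y\<in>carrier Y. L (inv x \<otimes> y) < \<epsilon> \<longrightarrow> y \<in> \<Union>K"
      using K by (metis UnionE UnionI)
  qed
  then show ?thesis unfolding norm_topology_def by simp
qed

lemma topspace_norm_topology: "topspace S = carrier Y"
proof
  show "topspace S \<subseteq> carrier Y" using openin_norm_topology by blast
  obtain L where "L \<in> \<L>" using nonempty by blast
  then have "openin S (carrier Y)" unfolding openin_norm_topology
    by (intro conjI ballI bexI[of _ L] exI[of _ 1]) auto
  then show "carrier Y \<subseteq> topspace S" by (rule openin_subset)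
qed

lemma open_ball:
  assumes L: "L \<in> \<L>" and x: "x \<in> carrier Y"
  shows "openin S {y \<in> carrier Y. L (inv x \<otimes> y) < \<epsilon>}"
  unfolding openin_norm_topology
proof (intro conjI ballI)
  fix y assume "y \<in> {y \<in> carrier Y. L (inv x \<otimes> y) < \<epsilon>}"
  then have y: "y \<in> carrier Y" "L (inv x \<otimes> y) < \<epsilon>" by auto
  show "\<exists>L'\<in>\<L>. \<exists>\<delta>>0. \<forall>u\<in>carrier Y. L' (inv y \<otimes> u) < \<delta> \<longrightarrow> u \<in> {y \<in> carrier Y. L (inv x \<otimes> y) < \<epsilon>}"
  proof (intro bexI[OF _ L] exI[of _ "\<epsilon> - L (inv x \<otimes> y)"] conjI ballI impI)
    show "0 < \<epsilon> - L (inv x \<otimes> y)" using y by simp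
    fix u assume u: "u \<in> carrier Y" "L (inv y \<otimes> u) < \<epsilon> - L (inv x \<otimes> y)"
    have "inv x \<otimes> u = (inv x \<otimes> y) \<otimes> (inv y \<otimes> u)" using x y u by (simp add: m_assoc mult_inv_mult_cancel)
    then have "L (inv x \<otimes> u) \<le> L (inv x \<otimes> y) + L (inv y \<otimes> u)" using norm_mult[OF L] x y u by simp
    then show "u \<in> {y \<in> carrier Y. L (inv x \<otimes> y) < \<epsilon>}" using u by simp
  qed
qed auto

lemma mem_ball: "L \<in> \<L> \<Longrightarrow> x \<in> carrier Y \<Longrightarrow> \<epsilon> > 0 \<Longrightarrow> x \<in> {y \<in> carrier Y. L (inv x \<otimes> y) < \<epsilon>}"
  by (simp add: norm_one)

text \<open>Only the separating functions have to be symmetric; the others may define a topology in which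
  inversion is not continuous.\<close>
lemma Hausdorff_norm_topology:
  assumes sep: "\<And>x. x \<in> carrier Y \<Longrightarrow> x \<noteq> \<one> \<Longrightarrow> \<exists>L\<in>\<L>. seminorm Y L \<and> 0 < L x"
  shows "Hausdorff_space S"
  unfolding Hausdorff_space_def topspace_norm_topology
proof (intro allI impI)
  fix x y assume "x \<in> carrier Y \<and> y \<in> carrier Y \<and> x \<noteq> y"
  then have x: "x \<in> carrier Y" and y: "y \<in> carrier Y" and "inv x \<otimes> y \<noteq> \<one>"
    by (auto simp: inv_solve_left')
  then obtain L where L: "L \<in> \<L>" "seminorm Y L" "0 < L (inv x \<otimes> y)" using sep[of "inv x \<otimes> y"] by auto
  define \<epsilon> where "\<epsilon> = L (inv x \<otimes> y) / 2"
  have \<epsilon>: "\<epsilon> > 0" using L by (simp add: \<epsilon>_def)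
  have "disjnt {u \<in> carrier Y. L (inv x \<otimes> u) < \<epsilon>} {u \<in> carrier Y. L (inv y \<otimes> u) < \<epsilon>}"
  proof (clarsimp simp: disjnt_iff)
    fix u assume u: "u \<in> carrier Y" "L (inv x \<otimes> u) < \<epsilon>" "L (inv y \<otimes> u) < \<epsilon>"
    have "inv x \<otimes> y = (inv x \<otimes> u) \<otimes> inv (inv y \<otimes> u)"
      using x y u by (simp add: inv_mult_group m_assoc mult_inv_mult_cancel)
    then have "L (inv x \<otimes> y) \<le> L (inv x \<otimes> u) + L (inv y \<otimes> u)"
      using norm_mult[OF L(1), of "inv x \<otimes> u" "inv (inv y \<otimes> u)"] seminormD(3)[OF L(2), of "inv y \<otimes> u"] x y u by simp
    then show False using u by (simp add: \<epsilon>_def)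
  qed
  then show "\<exists>U V. openin S U \<and> openin S V \<and> x \<in> U \<and> y \<in> V \<and> disjnt U V"
    using open_ball[OF L(1) x] open_ball[OF L(1) y] mem_ball[OF L(1) x \<epsilon>] mem_ball[OF L(1) y \<epsilon>] by blast
qed

lemma paratopological_norm_topology:
  assumes sep: "\<And>x. x \<in> carrier Y \<Longrightarrow> x \<noteq> \<one> \<Longrightarrow> \<exists>L\<in>\<L>. seminorm Y L \<and> 0 < L x"
  shows "paratopological_group Y S"
  unfolding paratopological_group_def topological_semigroup_def topologized_semigroup_def
proof (intro conjI)
  show "group Y" by (rule is_group)
  show "topspace S = carrier Y" by (rule topspace_norm_topology)
  show "Hausdorff_space S" by (rule Hausdorff_norm_topology[OF sep])
  show "continuous_map (prod_topology S S) S (\<lambda>(x, y). x \<otimes> y)"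
  proof (rule continuous_map_prodI, unfold topspace_norm_topology)
    fix W x y assume W: "openin S W" and x: "x \<in> carrier Y" and y: "y \<in> carrier Y"
      and xy: "(case (x, y) of (x, y) \<Rightarrow> x \<otimes> y) \<in> W"
    then obtain L \<epsilon> where L: "L \<in> \<L>" "\<epsilon> > 0" "\<And>u. u \<in> carrier Y \<Longrightarrow> L (inv (x \<otimes> y) \<otimes> u) < \<epsilon> \<Longrightarrow> u \<in> W"
      unfolding openin_norm_topology by auto
    obtain M where M: "M \<in> \<L>" and M_eq: "\<And>u. u \<in> carrier Y \<Longrightarrow> M u = L (inv y \<otimes> u \<otimes> inv (inv y))"
      using conj[OF L(1) inv_closed[OF y]] by blast
    have "a \<otimes> b \<in> W" if a: "a \<in> {u \<in> carrier Y. M (inv x \<otimes> u) < \<epsilon> / 2}"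
      and b: "b \<in> {u \<in> carrier Y. L (inv y \<otimes> u) < \<epsilon> / 2}" for a b
    proof (rule L(3))
      have "inv (x \<otimes> y) \<otimes> (a \<otimes> b) = (inv y \<otimes> (inv x \<otimes> a) \<otimes> inv (inv y)) \<otimes> (inv y \<otimes> b)"
        using a b x y by (simp add: inv_mult_group m_assoc mult_inv_mult_cancel)
      then have "L (inv (x \<otimes> y) \<otimes> (a \<otimes> b)) \<le> M (inv x \<otimes> a) + L (inv y \<otimes> b)"
        using norm_mult[OF L(1), of "inv y \<otimes> (inv x \<otimes> a) \<otimes> inv (inv y)" "inv y \<otimes> b"] a b x y by (simp add: M_eq)
      then show "L (inv (x \<otimes> y) \<otimes> (a \<otimes> b)) < \<epsilon>" using a b by simp
    qed (use a b in simp)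
    moreover have "openin S {u \<in> carrier Y. M (inv x \<otimes> u) < \<epsilon> / 2}" by (rule open_ball[OF M x])
    moreover have "openin S {u \<in> carrier Y. L (inv y \<otimes> u) < \<epsilon> / 2}" by (rule open_ball[OF L(1) y])
    moreover have "x \<in> {u \<in> carrier Y. M (inv x \<otimes> u) < \<epsilon> / 2}" by (rule mem_ball[OF M x]) (use L(2) in simp)
    moreover have "y \<in> {u \<in> carrier Y. L (inv y \<otimes> u) < \<epsilon> / 2}" by (rule mem_ball[OF L(1) y]) (use L(2) in simp)
    ultimately show "\<exists>A B. openin S A \<and> x \<in> A \<and> openin S B \<and> y \<in> B \<and>
        (\<forall>a\<in>A. \<forall>b\<in>B. (case (a, b) of (x, y) \<Rightarrow> x \<otimes> y) \<in> W)"
      unfolding prod.case by blast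
  qed auto
qed (auto simp: m_assoc)

lemma topological_norm_topology:
  assumes sep: "\<And>x. x \<in> carrier Y \<Longrightarrow> x \<noteq> \<one> \<Longrightarrow> \<exists>L\<in>\<L>. 0 < L x"
    and sym: "\<And>L. L \<in> \<L> \<Longrightarrow> seminorm Y L"
  shows "topological_group Y S"
  unfolding topological_group_def
proof
  show "paratopological_group Y S" by (rule paratopological_norm_topology) (use sep sym in blast)
  show "continuous_map S S (\<lambda>x. inv x)"
  proof (rule continuous_mapI_nhds, unfold topspace_norm_topology)
    fix W x assume W: "openin S W" and x: "x \<in> carrier Y" "inv x \<in> W"
    then obtain L \<epsilon> where L: "L \<in> \<L>" "\<epsilon> > 0" "\<And>u. u \<in> carrier Y \<Longrightarrow> L (inv (inv x) \<otimes> u) < \<epsilon> \<Longrightarrow> u \<in> W"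
      unfolding openin_norm_topology by blast
    obtain M where M: "M \<in> \<L>" and M_eq: "\<And>u. u \<in> carrier Y \<Longrightarrow> M u = L (x \<otimes> u \<otimes> inv x)"
      using conj[OF L(1) x(1)] by blast
    have "inv a \<in> W" if a: "a \<in> {u \<in> carrier Y. M (inv x \<otimes> u) < \<epsilon>}" for a
    proof (rule L(3))
      have "inv (inv x) \<otimes> inv a = x \<otimes> inv (inv x \<otimes> a) \<otimes> inv x"
        using a x by (simp add: inv_mult_group m_assoc)
      then have "L (inv (inv x) \<otimes> inv a) = M (inv (inv x \<otimes> a))" using a x by (simp add: M_eq)
      also have "\<dots> = M (inv x \<otimes> a)" by (rule seminormD(3)[OF sym[OF M]]) (use a x in simp)
      finally show "L (inv (inv x) \<otimes> inv a) < \<epsilon>" using a by simp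
    qed (use a in simp)
    then show "\<exists>A. openin S A \<and> x \<in> A \<and> (\<forall>a\<in>A. inv a \<in> W)"
      using open_ball[OF M x(1), of \<epsilon>] mem_ball[OF M x(1) L(2)] by blast
  qed auto
qed

text \<open>The Hausdorff reflection: the common null elements of the seminorms form a normal subgroup, and the
  seminorms are constant on its cosets.\<close>
lemma seminorm_quotient:
  assumes sym: "\<And>L. L \<in> \<L> \<Longrightarrow> seminorm Y L"
  obtains Q :: "'g set monoid" and R \<pi> where "topological_group Q R" "\<pi> \<in> hom Y Q"
    "\<And>W x. openin R W \<Longrightarrow> x \<in> carrier Y \<Longrightarrow> \<pi> x \<in> W \<Longrightarrow>
      \<exists>L\<in>\<L>. \<exists>\<epsilon>>0. \<forall>y\<in>carrier Y. L (inv x \<otimes> y) < \<epsilon> \<longrightarrow> \<pi> y \<in> W"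
    "\<And>L x \<epsilon>. L \<in> \<L> \<Longrightarrow> x \<in> carrier Y \<Longrightarrow> \<epsilon> > 0 \<Longrightarrow>
      \<exists>W. openin R W \<and> \<pi> x \<in> W \<and> (\<forall>y\<in>carrier Y. \<pi> y \<in> W \<longrightarrow> L (inv x \<otimes> y) < \<epsilon>)"
    "\<And>L x y. L \<in> \<L> \<Longrightarrow> x \<in> carrier Y \<Longrightarrow> y \<in> carrier Y \<Longrightarrow> \<pi> x = \<pi> y \<Longrightarrow> L (inv x \<otimes> y) = 0"
proof -
  define N where "N = {x \<in> carrier Y. \<forall>L\<in>\<L>. L x = 0}"
  have N0: "L n = 0" if "n \<in> N" "L \<in> \<L>" for n L using that by (auto simp: N_def)
  have Nc: "N \<subseteq> carrier Y" by (auto simp: N_def)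
  have null_mult: "L (x \<otimes> y) = 0" if "L \<in> \<L>" "x \<in> carrier Y" "y \<in> carrier Y" "L x = 0" "L y = 0" for L x y
    using norm_mult[OF that(1-3)] norm_nonneg[OF that(1), of "x \<otimes> y"] that by simp
  have Nsub: "subgroup N Y"
  proof (rule subgroupI)
    show "N \<noteq> {}" using norm_one by (auto simp: N_def)
    show "inv a \<in> N" if a: "a \<in> N" for a
    proof -
      have "a \<in> carrier Y" using a by (simp add: N_def)
      then have "L (inv a) = 0" if "L \<in> \<L>" for L
        using seminormD(3)[OF sym[OF that], of a] N0[OF a that] by simp
      then show ?thesis using a by (simp add: N_def)
    qed
    show "a \<otimes> b \<in> N" if "a \<in> N" "b \<in> N" for a b using that null_mult by (auto simp: N_def)
  qed (rule Nc)
  have "N \<lhd> Y" unfolding normal_inv_iff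
  proof (intro conjI ballI Nsub)
    fix x h assume "x \<in> carrier Y" "h \<in> N"
    then have "L (x \<otimes> h \<otimes> inv x) = 0" if L: "L \<in> \<L>" for L
      using conj[OF L, of x] N0[of h] Nc by (metis subsetD)
    then show "x \<otimes> h \<otimes> inv x \<in> N" using \<open>x \<in> carrier Y\<close> \<open>h \<in> N\<close> Nc by (auto simp: N_def)
  qed
  then interpret N: normal N Y .
  define Q where "Q = Y Mod N"
  have gQ: "group Q" unfolding Q_def by (rule N.factorgroup_is_group)
  define \<pi> where "\<pi> x = N #> x" for x
  have Qc: "carrier Q = \<pi> ` carrier Y" by (auto simp: Q_def carrier_FactGroup \<pi>_def)
  have Qm: "\<pi> x \<otimes>\<^bsub>Q\<^esub> \<pi> y = \<pi> (x \<otimes> y)" if "x \<in> carrier Y" "y \<in> carrier Y" for x y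
    using N.rcos_sum[OF that] by (simp add: Q_def \<pi>_def)
  have Qo: "\<one>\<^bsub>Q\<^esub> = \<pi> \<one>" using coset_mult_one[OF Nc] by (simp add: Q_def \<pi>_def)
  have Qi: "inv\<^bsub>Q\<^esub> (\<pi> x) = \<pi> (inv x)" if "x \<in> carrier Y" for x
    using that by (intro group.inv_equality[OF gQ]) (auto simp: Qm Qo Qc)
  define bar where "bar L c = L (SOME x. x \<in> c)" for L :: "'g \<Rightarrow> real" and c
  have bar: "bar L (\<pi> x) = L x" if L: "L \<in> \<L>" and x: "x \<in> carrier Y" for L x
  proof -
    have "x \<in> \<pi> x" unfolding \<pi>_def by (rule rcos_self[OF x Nsub])
    then have "(SOME y. y \<in> \<pi> x) \<in> \<pi> x" by (rule someI)
    then obtain n where n: "n \<in> N" "(SOME y. y \<in> \<pi> x) = n \<otimes> x" by (auto simp: \<pi>_def r_coset_def)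
    then have nc: "n \<in> carrier Y" using Nc by blast
    have "L (n \<otimes> x) \<le> L n + L x" by (rule norm_mult[OF L nc x])
    moreover have "L (inv n \<otimes> (n \<otimes> x)) \<le> L (inv n) + L (n \<otimes> x)" by (rule norm_mult[OF L]) (use nc x in auto)
    moreover have "inv n \<otimes> (n \<otimes> x) = x" using nc x by (simp add: m_assoc[symmetric])
    moreover have "L n = 0" "L (inv n) = 0" using N0 n(1) L seminormD(3)[OF sym[OF L] nc] by auto
    ultimately show ?thesis using n(2) by (simp add: bar_def)
  qed
  interpret Q: norm_family Q "bar ` \<L>"
  proof (intro norm_family.intro norm_family_axioms.intro gQ)
    show "bar ` \<L> \<noteq> {}" using nonempty by blast
    fix L' assume "L' \<in> bar ` \<L>"
    then obtain L where L: "L \<in> \<L>" "L' = bar L" by blast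
    show "prenorm Q L'" unfolding prenorm_def Qc Qo
      using L(1) norm_nonneg norm_one norm_mult by (auto simp: L(2) bar Qm)
    show "(\<lambda>x. L' x + M' x) \<in> bar ` \<L>" if M': "M' \<in> bar ` \<L>" for M'
    proof -
      obtain M where M: "M \<in> \<L>" "M' = bar M" using M' by blast
      have "(\<lambda>x. L' x + M' x) = bar (\<lambda>x. L x + M x)" unfolding L(2) M(2) by (simp add: fun_eq_iff bar_def)
      then show ?thesis using add[OF L(1) M(1)] by blast
    qed
  next
    fix L' c assume "L' \<in> bar ` \<L>" "c \<in> carrier Q"
    then obtain L g where L: "L \<in> \<L>" "L' = bar L" "g \<in> carrier Y" "c = \<pi> g" by (auto simp: Qc)
    obtain M where M: "M \<in> \<L>" "\<And>x. x \<in> carrier Y \<Longrightarrow> M x = L (g \<otimes> x \<otimes> inv g)"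
      using conj[OF L(1,3)] by blast
    show "\<exists>M'\<in>bar ` \<L>. \<forall>x\<in>carrier Q. M' x = L' (c \<otimes>\<^bsub>Q\<^esub> x \<otimes>\<^bsub>Q\<^esub> inv\<^bsub>Q\<^esub> c)"
    proof (intro bexI[of _ "bar M"] ballI)
      fix x assume "x \<in> carrier Q"
      then obtain y where y: "y \<in> carrier Y" "x = \<pi> y" by (auto simp: Qc)
      then show "bar M x = L' (c \<otimes>\<^bsub>Q\<^esub> x \<otimes>\<^bsub>Q\<^esub> inv\<^bsub>Q\<^esub> c)"
        using L M by (simp add: bar Qm Qi)
    qed (use M in blast)
  qed
  have ball_eq: "bar L (inv\<^bsub>Q\<^esub> (\<pi> x) \<otimes>\<^bsub>Q\<^esub> \<pi> y) = L (inv x \<otimes> y)"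
    if "L \<in> \<L>" "x \<in> carrier Y" "y \<in> carrier Y" for L x y
    using that by (simp add: Qi Qm bar)
  show ?thesis
  proof (rule that[of Q Q.S \<pi>])
    show "topological_group Q Q.S"
    proof (rule Q.topological_norm_topology)
      fix c assume c: "c \<in> carrier Q" "c \<noteq> \<one>\<^bsub>Q\<^esub>"
      then obtain x where x: "x \<in> carrier Y" "c = \<pi> x" by (auto simp: Qc)
      have "x \<notin> N" using c coset_join2[OF x(1) Nsub] by (auto simp: x(2) \<pi>_def Q_def)
      then obtain L where "L \<in> \<L>" "L x \<noteq> 0" using x(1) unfolding N_def by blast
      then show "\<exists>L\<in>bar ` \<L>. 0 < L c" using norm_nonneg[of L x] x by (intro bexI[of _ "bar L"]) (auto simp: bar)
    next
      fix L' assume "L' \<in> bar ` \<L>"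
      then obtain L where L: "L \<in> \<L>" "L' = bar L" by blast
      show "seminorm Q L'" unfolding seminorm_def
        using Q.prenorm[of L'] L seminormD(3)[OF sym[OF L(1)]] by (auto simp: Qc Qi bar)
    qed
    show "\<pi> \<in> hom Y Q" by (auto simp: hom_def Qc Qm)
    show "\<exists>L\<in>\<L>. \<exists>\<epsilon>>0. \<forall>y\<in>carrier Y. L (inv x \<otimes> y) < \<epsilon> \<longrightarrow> \<pi> y \<in> W"
      if W: "openin Q.S W" "x \<in> carrier Y" "\<pi> x \<in> W" for W x
    proof -
      obtain L \<epsilon> where "L \<in> \<L>" "\<epsilon> > 0" "\<And>c. c \<in> carrier Q \<Longrightarrow> bar L (inv\<^bsub>Q\<^esub> (\<pi> x) \<otimes>\<^bsub>Q\<^esub> c) < \<epsilon> \<Longrightarrow> c \<in> W"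
        using W unfolding Q.openin_norm_topology by blast
      then show ?thesis using W(2) by (intro bexI[of _ L] exI[of _ \<epsilon>]) (auto simp: Qc ball_eq)
    qed
    show "\<exists>W. openin Q.S W \<and> \<pi> x \<in> W \<and> (\<forall>y\<in>carrier Y. \<pi> y \<in> W \<longrightarrow> L (inv x \<otimes> y) < \<epsilon>)"
      if L: "L \<in> \<L>" "x \<in> carrier Y" "\<epsilon> > 0" for L x \<epsilon>
    proof (intro exI conjI)
      have c: "bar L \<in> bar ` \<L>" "\<pi> x \<in> carrier Q" using L by (auto simp: Qc)
      show "openin Q.S {c \<in> carrier Q. bar L (inv\<^bsub>Q\<^esub> (\<pi> x) \<otimes>\<^bsub>Q\<^esub> c) < \<epsilon>}" by (rule Q.open_ball[OF c])
      show "\<pi> x \<in> {c \<in> carrier Q. bar L (inv\<^bsub>Q\<^esub> (\<pi> x) \<otimes>\<^bsub>Q\<^esub> c) < \<epsilon>}" by (rule Q.mem_ball[OF c L(3)])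
    qed (use L in \<open>auto simp: ball_eq\<close>)
    show "L (inv x \<otimes> y) = 0" if "L \<in> \<L>" "x \<in> carrier Y" "y \<in> carrier Y" "\<pi> x = \<pi> y" for L x y
      using ball_eq[OF that(1,2,2)] ball_eq[OF that(1-3)] that norm_one[OF that(1)] by simp
  qed
qed

end

context hausdorff_group
begin

section \<open>Group topologies on the extension\<close>

lemma adapted_add:
  assumes "adapted z p L" "adapted z p M"
  shows "adapted z p (\<lambda>x. L x + M x)"
  unfolding adapted_def continuous_at_one_def
proof (intro conjI allI impI)
  fix \<epsilon> :: real assume "\<epsilon> > 0"
  then have e: "\<epsilon> / 2 > 0" by simp
  obtain U V where "nhd U" "\<forall>u\<in>U. L (u, 0) < \<epsilon> / 2" "nhd V" "\<forall>u\<in>V. M (u, 0) < \<epsilon> / 2"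
    using assms e unfolding adapted_def continuous_at_one_def by meson
  then have "nhd (U \<inter> V)" "\<forall>u\<in>U \<inter> V. L (u, 0) + M (u, 0) < \<epsilon>" by (auto intro: nhd_Int) (force)
  then show "\<exists>U. nhd U \<and> (\<forall>u\<in>U. L (u, 0) + M (u, 0) < \<epsilon>)" by blast
  have "eventually (\<lambda>k. L (z k, -1) < \<epsilon> / 2) p" "eventually (\<lambda>k. M (z k, -1) < \<epsilon> / 2) p"
    using assms e unfolding adapted_def by blast+
  then show "eventually (\<lambda>k. L (z k, -1) + M (z k, -1) < \<epsilon>) p"
    by eventually_elim simp
qed

lemma adapted_conj:
  assumes L: "adapted z p L" and z: "eventually (\<lambda>k. z k \<in> center G) p" and g: "g \<in> carrier \<Gamma>"
  shows "adapted z p (\<lambda>x. L (g \<otimes>\<^bsub>\<Gamma>\<^esub> x \<otimes>\<^bsub>\<Gamma>\<^esub> inv\<^bsub>\<Gamma>\<^esub> g))"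
proof -
  obtain a d where ad: "g = (a, d)" "a \<in> carrier G" using g by auto
  have e: "g \<otimes>\<^bsub>\<Gamma>\<^esub> (x, c) \<otimes>\<^bsub>\<Gamma>\<^esub> inv\<^bsub>\<Gamma>\<^esub> g = (a \<otimes> x \<otimes> inv a, c)" for x c
    by (simp add: ad inv_\<Gamma>)
  show ?thesis unfolding adapted_def continuous_at_one_def e
  proof (intro conjI allI impI)
    fix \<epsilon> :: real assume \<epsilon>: "\<epsilon> > 0"
    obtain U where U: "nhd U" "\<forall>u\<in>U. L (u, 0) < \<epsilon>"
      using L \<epsilon> unfolding adapted_def continuous_at_one_def by meson
    have "continuous_map T T (\<lambda>x. a \<otimes> x \<otimes> inv a)"
      using continuous_map_compose[OF continuous_mult_left[OF ad(2)] continuous_mult_right[of "inv a"]] ad(2)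
      by (simp add: o_def)
    then have "nhd {x \<in> carrier G. a \<otimes> x \<otimes> inv a \<in> U}"
      using open_vimage[of "\<lambda>x. a \<otimes> x \<otimes> inv a" U] U(1) ad(2) by (auto simp: nhd_def)
    then show "\<exists>U. nhd U \<and> (\<forall>u\<in>U. L (a \<otimes> u \<otimes> inv a, 0) < \<epsilon>)" using U(2) by blast
    have "eventually (\<lambda>k. L (z k, -1) < \<epsilon>) p" using L \<epsilon> by (simp add: adapted_def)
    with z show "eventually (\<lambda>k. L (a \<otimes> z k \<otimes> inv a, -1) < \<epsilon>) p"
    proof eventually_elim
      case (elim k)
      have zc: "z k \<in> carrier G" using elim center_carrier by blast
      have "a \<otimes> z k \<otimes> inv a = z k \<otimes> a \<otimes> inv a" using center_comm[OF elim(1) ad(2)] by simp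
      also have "\<dots> = z k" using zc ad(2) by (simp add: m_assoc)
      finally show ?case using elim by simp
    qed
  qed
qed

lemma prenorm_add: "prenorm Y L \<Longrightarrow> prenorm Y M \<Longrightarrow> prenorm Y (\<lambda>x. L x + M x)"
  unfolding prenorm_def by (auto simp: add_nonneg_nonneg) (smt (verit))

lemma seminorm_add: "seminorm Y L \<Longrightarrow> seminorm Y M \<Longrightarrow> seminorm Y (\<lambda>x. L x + M x)"
  unfolding seminorm_def using prenorm_add by auto

lemma prenorm_conj:
  assumes L: "prenorm \<Gamma> L" and g: "g \<in> carrier \<Gamma>"
  shows "prenorm \<Gamma> (\<lambda>x. L (g \<otimes>\<^bsub>\<Gamma>\<^esub> x \<otimes>\<^bsub>\<Gamma>\<^esub> inv\<^bsub>\<Gamma>\<^esub> g))"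
proof -
  interpret E: group \<Gamma> by (rule group_\<Gamma>)
  have e: "g \<otimes>\<^bsub>\<Gamma>\<^esub> (x \<otimes>\<^bsub>\<Gamma>\<^esub> y) \<otimes>\<^bsub>\<Gamma>\<^esub> inv\<^bsub>\<Gamma>\<^esub> g = (g \<otimes>\<^bsub>\<Gamma>\<^esub> x \<otimes>\<^bsub>\<Gamma>\<^esub> inv\<^bsub>\<Gamma>\<^esub> g) \<otimes>\<^bsub>\<Gamma>\<^esub> (g \<otimes>\<^bsub>\<Gamma>\<^esub> y \<otimes>\<^bsub>\<Gamma>\<^esub> inv\<^bsub>\<Gamma>\<^esub> g)"
    if "x \<in> carrier \<Gamma>" "y \<in> carrier \<Gamma>" for x y
  proof -
    have "inv\<^bsub>\<Gamma>\<^esub> g \<otimes>\<^bsub>\<Gamma>\<^esub> (g \<otimes>\<^bsub>\<Gamma>\<^esub> w) = w" if "w \<in> carrier \<Gamma>" for w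
      using g that E.m_assoc[of "inv\<^bsub>\<Gamma>\<^esub> g" g w] by (metis E.inv_closed E.l_inv E.l_one)
    then show ?thesis using that g by (metis E.inv_closed E.m_assoc E.m_closed)
  qed
  have c: "g \<otimes>\<^bsub>\<Gamma>\<^esub> x \<otimes>\<^bsub>\<Gamma>\<^esub> inv\<^bsub>\<Gamma>\<^esub> g \<in> carrier \<Gamma>" if "x \<in> carrier \<Gamma>" for x
    using g that E.inv_closed E.m_closed by metis
  have o: "g \<otimes>\<^bsub>\<Gamma>\<^esub> \<one>\<^bsub>\<Gamma>\<^esub> \<otimes>\<^bsub>\<Gamma>\<^esub> inv\<^bsub>\<Gamma>\<^esub> g = \<one>\<^bsub>\<Gamma>\<^esub>"
    using g by (metis E.r_inv E.r_one)
  show ?thesis using L unfolding prenorm_def by (metis c e o)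
qed

lemma seminorm_conj:
  assumes L: "seminorm \<Gamma> L" and g: "g \<in> carrier \<Gamma>"
  shows "seminorm \<Gamma> (\<lambda>x. L (g \<otimes>\<^bsub>\<Gamma>\<^esub> x \<otimes>\<^bsub>\<Gamma>\<^esub> inv\<^bsub>\<Gamma>\<^esub> g))"
proof -
  interpret E: group \<Gamma> by (rule group_\<Gamma>)
  have "L (g \<otimes>\<^bsub>\<Gamma>\<^esub> inv\<^bsub>\<Gamma>\<^esub> x \<otimes>\<^bsub>\<Gamma>\<^esub> inv\<^bsub>\<Gamma>\<^esub> g) = L (g \<otimes>\<^bsub>\<Gamma>\<^esub> x \<otimes>\<^bsub>\<Gamma>\<^esub> inv\<^bsub>\<Gamma>\<^esub> g)" if x: "x \<in> carrier \<Gamma>" for x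
  proof -
    have "inv\<^bsub>\<Gamma>\<^esub> (g \<otimes>\<^bsub>\<Gamma>\<^esub> x \<otimes>\<^bsub>\<Gamma>\<^esub> inv\<^bsub>\<Gamma>\<^esub> g) = g \<otimes>\<^bsub>\<Gamma>\<^esub> inv\<^bsub>\<Gamma>\<^esub> x \<otimes>\<^bsub>\<Gamma>\<^esub> inv\<^bsub>\<Gamma>\<^esub> g"
      using g x by (metis E.inv_closed E.inv_inv E.inv_mult_group E.m_assoc E.m_closed)
    then show ?thesis using seminormD(3)[OF L, of "g \<otimes>\<^bsub>\<Gamma>\<^esub> x \<otimes>\<^bsub>\<Gamma>\<^esub> inv\<^bsub>\<Gamma>\<^esub> g"] g x
      by (metis E.inv_closed E.m_closed)
  qed
  then show ?thesis using prenorm_conj[of L g] L g by (simp add: seminorm_def)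
qed

definition para_norms where "para_norms z p = {L. prenorm \<Gamma> L \<and> adapted z p L}"
definition sym_norms where "sym_norms z p = {L. seminorm \<Gamma> L \<and> adapted z p L}"

lemma zero_norm: "seminorm \<Gamma> (\<lambda>x. 0) \<and> adapted z p (\<lambda>x. 0)"
proof -
  have "nhd (carrier G)" unfolding nhd_def using openin_topspace[of T] by (simp add: topspace_eq)
  then show ?thesis by (auto simp: seminorm_def prenorm_def adapted_def continuous_at_one_def)
qed

lemma norm_family_para:
  assumes z: "eventually (\<lambda>k. z k \<in> center G) p"
  shows "norm_family \<Gamma> (para_norms z p)"
proof (intro norm_family.intro norm_family_axioms.intro group_\<Gamma>)
  show "para_norms z p \<noteq> {}" using zero_norm unfolding para_norms_def seminorm_def by blast
  show "prenorm \<Gamma> L" if "L \<in> para_norms z p" for L using that by (simp add: para_norms_def)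
  show "(\<lambda>x. L x + L' x) \<in> para_norms z p" if "L \<in> para_norms z p" "L' \<in> para_norms z p" for L L'
    using that by (simp add: para_norms_def prenorm_add adapted_add)
  show "\<exists>M\<in>para_norms z p. \<forall>x\<in>carrier \<Gamma>. M x = L (g \<otimes>\<^bsub>\<Gamma>\<^esub> x \<otimes>\<^bsub>\<Gamma>\<^esub> inv\<^bsub>\<Gamma>\<^esub> g)"
    if "L \<in> para_norms z p" "g \<in> carrier \<Gamma>" for L g
    by (rule bexI[where x = "\<lambda>x. L (g \<otimes>\<^bsub>\<Gamma>\<^esub> x \<otimes>\<^bsub>\<Gamma>\<^esub> inv\<^bsub>\<Gamma>\<^esub> g)"])
      (use that prenorm_conj[of L g] adapted_conj[OF _ z, of L g] in \<open>simp_all add: para_norms_def\<close>)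
qed

lemma norm_family_sym:
  assumes z: "eventually (\<lambda>k. z k \<in> center G) p"
  shows "norm_family \<Gamma> (sym_norms z p)"
proof (intro norm_family.intro norm_family_axioms.intro group_\<Gamma>)
  show "sym_norms z p \<noteq> {}" using zero_norm unfolding sym_norms_def by blast
  show "prenorm \<Gamma> L" if "L \<in> sym_norms z p" for L using that by (simp add: sym_norms_def seminorm_def)
  show "(\<lambda>x. L x + L' x) \<in> sym_norms z p" if "L \<in> sym_norms z p" "L' \<in> sym_norms z p" for L L'
    using that by (simp add: sym_norms_def seminorm_add adapted_add)
  show "\<exists>M\<in>sym_norms z p. \<forall>x\<in>carrier \<Gamma>. M x = L (g \<otimes>\<^bsub>\<Gamma>\<^esub> x \<otimes>\<^bsub>\<Gamma>\<^esub> inv\<^bsub>\<Gamma>\<^esub> g)"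
    if "L \<in> sym_norms z p" "g \<in> carrier \<Gamma>" for L g
    by (rule bexI[where x = "\<lambda>x. L (g \<otimes>\<^bsub>\<Gamma>\<^esub> x \<otimes>\<^bsub>\<Gamma>\<^esub> inv\<^bsub>\<Gamma>\<^esub> g)"])
      (use that seminorm_conj[of L g] adapted_conj[OF _ z, of L g] in \<open>simp_all add: sym_norms_def\<close>)
qed

lemma base_continuous_para:
  assumes z: "eventually (\<lambda>k. z k \<in> center G) p"
  shows "continuous_map T (norm_topology \<Gamma> (para_norms z p)) (\<lambda>x. (x, 0))"
proof -
  interpret E: norm_family \<Gamma> "para_norms z p" by (rule norm_family_para[OF z])
  show ?thesis
  proof (rule continuous_mapI_nhds)
    show "(x, 0) \<in> topspace E.S" if "x \<in> topspace T" for x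
      using that by (simp add: E.topspace_norm_topology topspace_eq)
    fix W x assume W: "openin E.S W" "x \<in> topspace T" "(x, 0) \<in> W"
    then have x: "x \<in> carrier G" by (simp add: topspace_eq)
    obtain L \<epsilon> where L: "L \<in> para_norms z p" "\<epsilon> > 0"
      "\<And>y. y \<in> carrier \<Gamma> \<Longrightarrow> L (inv\<^bsub>\<Gamma>\<^esub> (x, 0) \<otimes>\<^bsub>\<Gamma>\<^esub> y) < \<epsilon> \<Longrightarrow> y \<in> W"
      using W unfolding E.openin_norm_topology by blast
    obtain U where U: "nhd U" "\<And>u. u \<in> U \<Longrightarrow> L (u, 0) < \<epsilon>"
      using L(1,2) unfolding para_norms_def adapted_def continuous_at_one_def by blast
    have "openin T {y \<in> carrier G. inv x \<otimes> y \<in> U}"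
      using open_vimage[OF continuous_mult_left] U(1) x by (simp add: nhd_def)
    moreover have "x \<in> {y \<in> carrier G. inv x \<otimes> y \<in> U}" using U(1) x by (simp add: nhd_def)
    moreover have "(y, 0) \<in> W" if "y \<in> {y \<in> carrier G. inv x \<otimes> y \<in> U}" for y
      by (rule L(3)) (use that U(2) x in \<open>auto simp: inv_\<Gamma>\<close>)
    ultimately show "\<exists>A. openin T A \<and> x \<in> A \<and> (\<forall>a\<in>A. (a, 0) \<in> W)" by blast
  qed
qed

text \<open>The point \<open>(z k, 0)\<close> is the translate by \<open>(\<one>, 1)\<close> of \<open>(z k, -1)\<close>.\<close>
lemma base_approaches_para:
  assumes z: "eventually (\<lambda>k. z k \<in> center G) p" and p: "p \<noteq> bot"
    and W: "openin (norm_topology \<Gamma> (para_norms z p)) W" "(\<one>, 1) \<in> W"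
  obtains x where "x \<in> carrier G" "(x, 0) \<in> W"
proof -
  interpret E: norm_family \<Gamma> "para_norms z p" by (rule norm_family_para[OF z])
  obtain L \<epsilon> where L: "L \<in> para_norms z p" "\<epsilon> > 0"
    "\<And>y. y \<in> carrier \<Gamma> \<Longrightarrow> L (inv\<^bsub>\<Gamma>\<^esub> (\<one>, 1) \<otimes>\<^bsub>\<Gamma>\<^esub> y) < \<epsilon> \<Longrightarrow> y \<in> W"
    using W unfolding E.openin_norm_topology by blast
  have "eventually (\<lambda>k. L (z k, -1) < \<epsilon>) p" using L by (simp add: para_norms_def adapted_def)
  with z have "eventually (\<lambda>k. z k \<in> center G \<and> L (z k, -1) < \<epsilon>) p" by (rule eventually_conj)
  then obtain k where k: "z k \<in> center G" "L (z k, -1) < \<epsilon>" using p eventually_happens by blast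
  then have "z k \<in> carrier G" using center_carrier by blast
  moreover have "(z k, 0) \<in> W" by (rule L(3)) (use k calculation in \<open>simp_all add: inv_\<Gamma>\<close>)
  ultimately show ?thesis by (rule that)
qed

text \<open>Every continuous seminorm \<open>N \<le> 1\<close> on \<open>G\<close> extends to an adapted prenorm: elements of negative
  degree, such as \<open>(z k, -1)\<close>, have length 0 and those of positive degree have length 1. This
  extension is not symmetric; it is the reason why paratopological groups occur.\<close>
lemma base_embedding_para:
  assumes z: "eventually (\<lambda>k. z k \<in> center G) p"
  shows "embedding_map T (norm_topology \<Gamma> (para_norms z p)) (\<lambda>x. (x, 0))"
proof (rule embedding_mapI[OF base_continuous_para[OF z]])
  interpret E: norm_family \<Gamma> "para_norms z p" by (rule norm_family_para[OF z])
  show "inj_on (\<lambda>x. (x, 0)) (topspace T)" by (auto simp: inj_on_def)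
  fix A x assume A: "openin T A" "x \<in> A"
  then have x: "x \<in> carrier G" using open_carrier by blast
  obtain N where N: "seminorm G N" "continuous_at_one N" "\<And>u. u \<in> carrier G \<Longrightarrow> N u \<le> 1"
    "\<And>u. u \<in> carrier G \<Longrightarrow> N u < 1 \<Longrightarrow> u \<in> {u \<in> carrier G. x \<otimes> u \<in> A}"
    by (rule continuous_seminorm_in_nhd[OF nhd_translate_left[OF A]]) (use that in blast)
  define L where "L = (\<lambda>(u, d::int). if d > 0 then 1 else if d = 0 then N u else 0)"
  have "prenorm \<Gamma> L"
  proof -
    have "L ((u, d) \<otimes>\<^bsub>\<Gamma>\<^esub> (u', d')) \<le> L (u, d) + L (u', d')"
      if "u \<in> carrier G" "u' \<in> carrier G" for u u' d d'
      using that N(3)[of "u \<otimes> u'"] seminormD(2)[OF N(1), of u] seminormD(2)[OF N(1), of u']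
        seminormD(4)[OF N(1), of u u'] by (auto simp: L_def)
    moreover have "0 \<le> L (u, d)" if "u \<in> carrier G" for u d
      using seminormD(2)[OF N(1) that] by (simp add: L_def)
    moreover have "L (\<one>, 0) = 0" using seminormD(1)[OF N(1)] by (simp add: L_def)
    ultimately show ?thesis unfolding prenorm_def by auto
  qed
  moreover have "adapted z p L" using N(2) by (simp add: adapted_def L_def)
  ultimately have L: "L \<in> para_norms z p" by (simp add: para_norms_def)
  have xc: "(x, 0) \<in> carrier \<Gamma>" using x by simp
  show "\<exists>W. openin E.S W \<and> (x, 0) \<in> W \<and> (\<forall>y\<in>topspace T. (y, 0) \<in> W \<longrightarrow> y \<in> A)"
  proof (intro exI conjI ballI impI)
    show "openin E.S {y \<in> carrier \<Gamma>. L (inv\<^bsub>\<Gamma>\<^esub> (x, 0) \<otimes>\<^bsub>\<Gamma>\<^esub> y) < 1}" by (rule E.open_ball[OF L xc])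
    show "(x, 0) \<in> {y \<in> carrier \<Gamma>. L (inv\<^bsub>\<Gamma>\<^esub> (x, 0) \<otimes>\<^bsub>\<Gamma>\<^esub> y) < 1}" by (rule E.mem_ball[OF L xc]) simp
    fix y assume y: "y \<in> topspace T" "(y, 0) \<in> {y \<in> carrier \<Gamma>. L (inv\<^bsub>\<Gamma>\<^esub> (x, 0) \<otimes>\<^bsub>\<Gamma>\<^esub> y) < 1}"
    then have "N (inv x \<otimes> y) < 1" using x by (simp add: inv_\<Gamma> L_def)
    then have "x \<otimes> (inv x \<otimes> y) \<in> A" using N(4)[of "inv x \<otimes> y"] x y(1) topspace_eq by auto
    then show "y \<in> A" using x y(1) topspace_eq by (simp add: mult_inv_mult_cancel)
  qed
qed

lemma paratopological_extension:
  assumes z: "eventually (\<lambda>k. z k \<in> center G) p"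
    and sep: "\<And>g d. g \<in> carrier G \<Longrightarrow> (g, d) \<noteq> (\<one>, 0) \<Longrightarrow> \<exists>L. seminorm \<Gamma> L \<and> adapted z p L \<and> 0 < L (g, d)"
  shows "paratopological_group \<Gamma> (norm_topology \<Gamma> (para_norms z p))"
proof -
  interpret E: norm_family \<Gamma> "para_norms z p" by (rule norm_family_para[OF z])
  show ?thesis
  proof (rule E.paratopological_norm_topology)
    fix x assume "x \<in> carrier \<Gamma>" "x \<noteq> \<one>\<^bsub>\<Gamma>\<^esub>"
    moreover obtain g d where "x = (g, d)" by (cases x)
    ultimately obtain L where "seminorm \<Gamma> L" "adapted z p L" "0 < L x" using sep[of g d] by auto
    then show "\<exists>L\<in>para_norms z p. seminorm \<Gamma> L \<and> 0 < L x" unfolding para_norms_def seminorm_def by blast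
  qed
qed

text \<open>For seminorms only the Hausdorff reflection of \<open>G \<times> \<int>\<close> is a topological group. Its map from \<open>G\<close> is
  injective by the first separation hypothesis, and by the second one the limit of the \<open>z k\<close> lies outside of the image.
  The map is an embedding if the adapted seminorms induce the topology of \<open>G\<close>.\<close>
lemma non_closed_group_extension:
  assumes z: "eventually (\<lambda>k. z k \<in> center G) p" and p: "p \<noteq> bot"
    and sep0: "\<And>g. g \<in> carrier G \<Longrightarrow> g \<noteq> \<one> \<Longrightarrow> \<exists>L. seminorm \<Gamma> L \<and> adapted z p L \<and> 0 < L (g, 0)"
    and sep1: "\<And>g. g \<in> carrier G \<Longrightarrow> \<exists>L. seminorm \<Gamma> L \<and> adapted z p L \<and> 0 < L (g, 1)"
  obtains Y :: "('a \<times> int) set monoid" and S f where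
    "topological_group Y S" "f \<in> hom G Y" "continuous_map T S f" "inj_on f (carrier G)"
    "\<not> closedin S (f ` carrier G)"
    "(\<forall>U. nhd U \<longrightarrow> (\<exists>L. seminorm \<Gamma> L \<and> adapted z p L \<and> (\<forall>x\<in>carrier G. L (x, 0) < 1 \<longrightarrow> x \<in> U))) \<longrightarrow>
      embedding_map T S f"
proof -
  interpret E: norm_family \<Gamma> "sym_norms z p" by (rule norm_family_sym[OF z])
  have sym: "seminorm \<Gamma> L" if "L \<in> sym_norms z p" for L using that by (simp add: sym_norms_def)
  obtain Y :: "('a \<times> int) set monoid" and S \<pi> where Y: "topological_group Y S" "\<pi> \<in> hom \<Gamma> Y"
    and small: "\<And>W x. openin S W \<Longrightarrow> x \<in> carrier \<Gamma> \<Longrightarrow> \<pi> x \<in> W \<Longrightarrow>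
      \<exists>L\<in>sym_norms z p. \<exists>\<epsilon>>0. \<forall>y\<in>carrier \<Gamma>. L (inv\<^bsub>\<Gamma>\<^esub> x \<otimes>\<^bsub>\<Gamma>\<^esub> y) < \<epsilon> \<longrightarrow> \<pi> y \<in> W"
    and nbhd: "\<And>L x \<epsilon>. L \<in> sym_norms z p \<Longrightarrow> x \<in> carrier \<Gamma> \<Longrightarrow> \<epsilon> > 0 \<Longrightarrow>
      \<exists>W. openin S W \<and> \<pi> x \<in> W \<and> (\<forall>y\<in>carrier \<Gamma>. \<pi> y \<in> W \<longrightarrow> L (inv\<^bsub>\<Gamma>\<^esub> x \<otimes>\<^bsub>\<Gamma>\<^esub> y) < \<epsilon>)"
    and ker: "\<And>L x y. L \<in> sym_norms z p \<Longrightarrow> x \<in> carrier \<Gamma> \<Longrightarrow> y \<in> carrier \<Gamma> \<Longrightarrow> \<pi> x = \<pi> y \<Longrightarrow> L (inv\<^bsub>\<Gamma>\<^esub> x \<otimes>\<^bsub>\<Gamma>\<^esub> y) = 0"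
    by (rule E.seminorm_quotient[OF sym]) (assumption, rule that)
  define f where "f x = \<pi> (x, 0)" for x
  have topS: "topspace S = carrier Y" using Y(1)
    by (auto simp: topological_group_def paratopological_group_def topological_semigroup_def topologized_semigroup_def)
  have \<pi>c: "\<pi> x \<in> carrier Y" if "x \<in> carrier \<Gamma>" for x using Y(2) that by (auto simp: hom_def)
  have cont: "continuous_map T S f"
  proof (rule continuous_mapI_nhds)
    show "f x \<in> topspace S" if "x \<in> topspace T" for x using that \<pi>c by (simp add: topS topspace_eq f_def)
    fix W x assume W: "openin S W" "x \<in> topspace T" "f x \<in> W"
    then have x: "x \<in> carrier G" by (simp add: topspace_eq)
    obtain L \<epsilon> where L: "L \<in> sym_norms z p" "\<epsilon> > 0"
      "\<And>y. y \<in> carrier \<Gamma> \<Longrightarrow> L (inv\<^bsub>\<Gamma>\<^esub> (x, 0) \<otimes>\<^bsub>\<Gamma>\<^esub> y) < \<epsilon> \<Longrightarrow> \<pi> y \<in> W"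
      using small[OF W(1), of "(x, 0)"] W(3) x by (auto simp: f_def)
    obtain U where U: "nhd U" "\<And>u. u \<in> U \<Longrightarrow> L (u, 0) < \<epsilon>"
      using L(1,2) unfolding sym_norms_def adapted_def continuous_at_one_def by blast
    have "openin T {y \<in> carrier G. inv x \<otimes> y \<in> U}"
      using open_vimage[OF continuous_mult_left] U(1) x by (simp add: nhd_def)
    moreover have "x \<in> {y \<in> carrier G. inv x \<otimes> y \<in> U}" using U(1) x by (simp add: nhd_def)
    moreover have "f y \<in> W" if "y \<in> {y \<in> carrier G. inv x \<otimes> y \<in> U}" for y
      unfolding f_def by (rule L(3)) (use that U(2) x in \<open>auto simp: inv_\<Gamma>\<close>)
    ultimately show "\<exists>A. openin T A \<and> x \<in> A \<and> (\<forall>a\<in>A. f a \<in> W)" by blast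
  qed
  have inj: "inj_on f (carrier G)"
  proof (rule inj_onI, rule ccontr)
    fix x y assume xy: "x \<in> carrier G" "y \<in> carrier G" "f x = f y" "x \<noteq> y"
    then have "inv x \<otimes> y \<noteq> \<one>" by (auto simp: inv_solve_left')
    then obtain L where L: "seminorm \<Gamma> L" "adapted z p L" "0 < L (inv x \<otimes> y, 0)" using sep0[of "inv x \<otimes> y"] xy by auto
    have "L (inv\<^bsub>\<Gamma>\<^esub> (x, 0) \<otimes>\<^bsub>\<Gamma>\<^esub> (y, 0)) = 0"
      by (rule ker) (use L xy in \<open>auto simp: sym_norms_def f_def\<close>)
    then show False using L xy by (simp add: inv_\<Gamma>)
  qed
  have nc: "\<not> closedin S (f ` carrier G)"
  proof
    assume "closedin S (f ` carrier G)"
    then have op: "openin S (topspace S - f ` carrier G)" by blast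
    have "\<pi> (\<one>, 1) \<notin> f ` carrier G"
    proof
      assume "\<pi> (\<one>, 1) \<in> f ` carrier G"
      then obtain x where x: "x \<in> carrier G" "\<pi> (x, 0) = \<pi> (\<one>, 1)" by (auto simp: f_def)
      obtain L where L: "seminorm \<Gamma> L" "adapted z p L" "0 < L (inv x, 1)" using sep1[of "inv x"] x by auto
      have "L (inv\<^bsub>\<Gamma>\<^esub> (x, 0) \<otimes>\<^bsub>\<Gamma>\<^esub> (\<one>, 1)) = 0"
        by (rule ker) (use L x in \<open>auto simp: sym_norms_def\<close>)
      then show False using L x by (simp add: inv_\<Gamma>)
    qed
    then have "\<pi> (\<one>, 1) \<in> topspace S - f ` carrier G" using \<pi>c by (simp add: topS)
    then obtain L \<epsilon> where L: "L \<in> sym_norms z p" "\<epsilon> > 0"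
      "\<And>y. y \<in> carrier \<Gamma> \<Longrightarrow> L (inv\<^bsub>\<Gamma>\<^esub> (\<one>, 1) \<otimes>\<^bsub>\<Gamma>\<^esub> y) < \<epsilon> \<Longrightarrow> \<pi> y \<in> topspace S - f ` carrier G"
      using small[OF op, of "(\<one>, 1)"] by auto
    have "eventually (\<lambda>k. L (z k, -1) < \<epsilon>) p" using L by (simp add: sym_norms_def adapted_def)
    with z have "eventually (\<lambda>k. z k \<in> center G \<and> L (z k, -1) < \<epsilon>) p" by (rule eventually_conj)
    then obtain k where k: "z k \<in> center G" "L (z k, -1) < \<epsilon>" using p eventually_happens by blast
    then have zk: "z k \<in> carrier G" using center_carrier by blast
    have "\<pi> (z k, 0) \<in> topspace S - f ` carrier G" by (rule L(3)) (use k zk in \<open>simp_all add: inv_\<Gamma>\<close>)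
    then show False using zk by (auto simp: f_def)
  qed
  have emb: "embedding_map T S f"
    if H: "\<forall>U. nhd U \<longrightarrow> (\<exists>L. seminorm \<Gamma> L \<and> adapted z p L \<and> (\<forall>x\<in>carrier G. L (x, 0) < 1 \<longrightarrow> x \<in> U))"
  proof (rule embedding_mapI[OF cont])
    show "inj_on f (topspace T)" using inj by (simp add: topspace_eq)
    fix A x assume A: "openin T A" "x \<in> A"
    then have x: "x \<in> carrier G" using open_carrier by blast
    obtain L where L: "seminorm \<Gamma> L" "adapted z p L" "\<And>u. u \<in> carrier G \<Longrightarrow> L (u, 0) < 1 \<Longrightarrow> x \<otimes> u \<in> A"
      using H nhd_translate_left[OF A] by blast
    obtain W where W: "openin S W" "\<pi> (x, 0) \<in> W"
      "\<And>y. y \<in> carrier \<Gamma> \<Longrightarrow> \<pi> y \<in> W \<Longrightarrow> L (inv\<^bsub>\<Gamma>\<^esub> (x, 0) \<otimes>\<^bsub>\<Gamma>\<^esub> y) < 1"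
      using nbhd[of L "(x, 0)" 1] L(1,2) x by (auto simp: sym_norms_def)
    have "y \<in> A" if y: "y \<in> topspace T" "f y \<in> W" for y
    proof -
      have yc: "y \<in> carrier G" using y by (simp add: topspace_eq)
      then have "L (inv x \<otimes> y, 0) < 1" using W(3)[of "(y, 0)"] y x by (simp add: f_def inv_\<Gamma>)
      then have "x \<otimes> (inv x \<otimes> y) \<in> A" using L(3) x yc by simp
      then show ?thesis using x yc by (simp add: mult_inv_mult_cancel)
    qed
    then show "\<exists>W. openin S W \<and> f x \<in> W \<and> (\<forall>y\<in>topspace T. f y \<in> W \<longrightarrow> y \<in> A)"
      using W(1,2) by (auto simp: f_def)
  qed
  have "f \<in> hom G Y"
  proof (rule homI)
    show "f x \<in> carrier Y" if "x \<in> carrier G" for x using that \<pi>c by (simp add: f_def)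
    show "f (x \<otimes> y) = f x \<otimes>\<^bsub>Y\<^esub> f y" if "x \<in> carrier G" "y \<in> carrier G" for x y
      using hom_mult[OF Y(2), of "(x, 0)" "(y, 0)"] that by (simp add: f_def)
  qed
  from that[OF Y(1) this cont inj nc] emb show ?thesis by blast
qed

section \<open>Convergence of central Cauchy ultrafilters\<close>

text \<open>Otherwise a limit of \<open>p\<close> can be added to \<open>G\<close>. If \<open>l\<close> tends to that limit along \<open>p\<close>, a seminorm \<open>N\<close>
  on \<open>G\<close> extends to \<open>G \<times> \<int>\<close> as the limit of \<open>N (x \<otimes> l [^] d)\<close>. These extensions are adapted
  because \<open>p\<close> is a Cauchy filter, and they restrict to \<open>N\<close>, so that the map from \<open>G\<close> to the extended
  group is an embedding with an image that is not closed.\<close>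
lemma central_ultrafilter_converges:
  assumes closed: "\<And>(Y :: ('a \<times> int) set monoid) S f. topological_group Y S \<Longrightarrow> f \<in> hom G Y \<Longrightarrow>
      embedding_map T S f \<Longrightarrow> closedin S (f ` carrier G)"
    and p: "ultrafilter p" and pz: "eventually (\<lambda>x. x \<in> center G) p"
    and cauchy: "\<And>U. nhd U \<Longrightarrow> \<exists>a\<in>center G. eventually (\<lambda>x. inv a \<otimes> x \<in> U) p"
  obtains x where "x \<in> carrier G" "\<And>U. nhd U \<Longrightarrow> eventually (\<lambda>y. inv x \<otimes> y \<in> U) p"
proof (rule ccontr)
  assume "\<not> thesis"
  then have nconv: "\<exists>U. nhd U \<and> eventually (\<lambda>y. inv x \<otimes> y \<notin> U) p" if "x \<in> carrier G" for x
    using p that \<open>\<And>x. x \<in> carrier G \<Longrightarrow> (\<And>U. nhd U \<Longrightarrow> eventually (\<lambda>y. inv x \<otimes> y \<in> U) p) \<Longrightarrow> thesis\<close>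
    unfolding ultrafilter_def by metis
  have pb: "p \<noteq> bot" using p by (simp add: ultrafilter_def)
  have lim: "\<exists>L. seminorm \<Gamma> L \<and> adapted (\<lambda>x. x) p L \<and> (\<forall>x\<in>carrier G. L (x, 0) = N x) \<and>
      (\<forall>x\<in>carrier G. eventually (\<lambda>l. N (x \<otimes> l) \<ge> 1) p \<longrightarrow> L (x, 1) \<ge> 1)"
    if N: "seminorm G N" "continuous_at_one N" "\<And>x. x \<in> carrier G \<Longrightarrow> N x \<le> 1" for N
  proof -
    \<comment> \<open>The value 0 elsewhere only serves to bound the function everywhere.\<close>
    define F where "F = (\<lambda>(x, d::int) l. if x \<in> carrier G \<and> l \<in> center G then N (x \<otimes> l [^] d) else 0)"
    have F: "F (x, d) l = N (x \<otimes> l [^] d)" if "x \<in> carrier G" "l \<in> center G" for x d l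
      using that by (simp add: F_def)
    have lc: "l \<in> carrier G" if "l \<in> center G" for l using that center_carrier by blast
    have pow_center: "l [^] (d::int) \<in> center G" if "l \<in> center G" for l d
      using C.int_pow_closed[OF that, of d] that by (simp add: center_int_pow)
    have "\<exists>r. (F a \<longlongrightarrow> r) p" for a
    proof (rule ultrafilter_bounded_limit[OF p, of "F a" 0 1])
      show "F a l \<in> {0..1}" for l
        using N(3) seminormD(2)[OF N(1)] lc by (cases a) (auto simp: F_def)
    qed blast
    then obtain L where L: "\<And>a. (F a \<longlongrightarrow> L a) p" by metis
    have le: "L a \<le> r" if "eventually (\<lambda>l. l \<in> center G \<longrightarrow> F a l \<le> r) p" for a r
      by (rule tendsto_upperbound[OF L _ pb]) (use that pz in eventually_elim, simp)
    have "seminorm \<Gamma> L" unfolding seminorm_def prenorm_def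
    proof (intro conjI ballI)
      have "eventually (\<lambda>l. F (\<one>, 0) l = 0) p"
        using pz by eventually_elim (simp add: F seminormD(1)[OF N(1)])
      then show "L \<one>\<^bsub>\<Gamma>\<^esub> = 0" using tendsto_unique[OF pb L tendsto_eventually] by simp
      fix a assume "a \<in> carrier \<Gamma>"
      then obtain x d where a: "a = (x, d)" "x \<in> carrier G" by auto
      show "0 \<le> L a"
        by (rule tendsto_lowerbound[OF L _ pb]) (auto simp: a F_def seminormD(2)[OF N(1)] lc)
      show "L (a \<otimes>\<^bsub>\<Gamma>\<^esub> b) \<le> L a + L b" if bc: "b \<in> carrier \<Gamma>" for b
      proof -
        obtain y c where b: "b = (y, c)" "y \<in> carrier G" using bc by auto
        show ?thesis
        proof (rule tendsto_le[OF pb tendsto_add[OF L L] L])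
          show "eventually (\<lambda>l. F (a \<otimes>\<^bsub>\<Gamma>\<^esub> b) l \<le> F a l + F b l) p"
            using pz
          proof eventually_elim
            case (elim l)
            have "(x \<otimes> y) \<otimes> l [^] (d + c) = x \<otimes> (y \<otimes> l [^] d) \<otimes> l [^] c"
              using a b lc[OF elim] by (simp add: int_pow_mult m_assoc)
            also have "y \<otimes> l [^] d = l [^] d \<otimes> y" using center_comm[OF pow_center[OF elim]] b by simp
            finally have "(x \<otimes> y) \<otimes> l [^] (d + c) = (x \<otimes> l [^] d) \<otimes> (y \<otimes> l [^] c)"
              using a b lc[OF elim] by (simp add: m_assoc)
            then show ?case using seminormD(4)[OF N(1), of "x \<otimes> l [^] d" "y \<otimes> l [^] c"] a b lc[OF elim] elim
              by (simp add: F)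
          qed
        qed
      qed
      have "eventually (\<lambda>l. F (inv\<^bsub>\<Gamma>\<^esub> a) l = F a l) p"
        using pz
      proof eventually_elim
        case (elim l)
        have "inv x \<otimes> l [^] (- d) = inv (l [^] d \<otimes> x)"
          using a lc[OF elim] by (simp add: int_pow_neg inv_mult_group)
        also have "l [^] d \<otimes> x = x \<otimes> l [^] d" using center_comm[OF pow_center[OF elim]] a by simp
        finally show ?case using seminormD(3)[OF N(1), of "x \<otimes> l [^] d"] a lc[OF elim] elim
          by (simp add: F inv_\<Gamma>)
      qed
      then have "(F a \<longlongrightarrow> L (inv\<^bsub>\<Gamma>\<^esub> a)) p" using L Lim_transform_eventually by blast
      then show "L (inv\<^bsub>\<Gamma>\<^esub> a) = L a" using tendsto_unique[OF pb L] by metis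
    qed
    moreover have L0: "L (x, 0) = N x" if "x \<in> carrier G" for x
    proof -
      have "eventually (\<lambda>l. F (x, 0) l = N x) p" using pz by eventually_elim (simp add: F that)
      then show ?thesis using tendsto_unique[OF pb L tendsto_eventually] by blast
    qed
    moreover have "L (x, 1) \<ge> 1" if "x \<in> carrier G" "eventually (\<lambda>l. N (x \<otimes> l) \<ge> 1) p" for x
    proof (rule tendsto_lowerbound[OF L _ pb])
      show "eventually (\<lambda>l. 1 \<le> F (x, 1) l) p" using that(2) pz
        by eventually_elim (simp add: F that(1) lc)
    qed
    moreover have "adapted (\<lambda>x. x) p L" unfolding adapted_def
    proof (intro conjI allI impI)
      show "continuous_at_one (\<lambda>u. L (u, 0))"
        using N(2) nhd_carrier L0 unfolding continuous_at_one_def by (metis subsetD)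
      fix \<epsilon> :: real assume \<epsilon>: "\<epsilon> > 0"
      then have "\<epsilon> / 4 > 0" by simp
      then obtain U where U: "nhd U" "\<And>u. u \<in> U \<Longrightarrow> N u < \<epsilon> / 4" using N(2) unfolding continuous_at_one_def by meson
      obtain a where a: "a \<in> center G" "eventually (\<lambda>x. inv a \<otimes> x \<in> U) p" using cauchy[OF U(1)] by blast
      show "eventually (\<lambda>k. L (k, -1) < \<epsilon>) p" using a(2) pz
      proof eventually_elim
        case (elim k)
        have "L (k, -1) \<le> \<epsilon> / 2"
        proof (rule le, rule eventually_mono[OF a(2)], rule impI)
          fix l assume l: "inv a \<otimes> l \<in> U" "l \<in> center G"
          have c: "a \<in> carrier G" "k \<in> carrier G" "l \<in> carrier G" using a(1) l(2) elim lc by auto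
          have "k \<otimes> l [^] (-1::int) = (inv a \<otimes> k) \<otimes> inv (inv a \<otimes> l)"
          proof -
            have "(inv a \<otimes> k) \<otimes> inv (inv a \<otimes> l) = inv a \<otimes> (k \<otimes> inv l) \<otimes> a"
              using c by (simp add: inv_mult_group m_assoc)
            also have "\<dots> = a \<otimes> (inv a \<otimes> (k \<otimes> inv l))"
              using center_comm[OF a(1), of "inv a \<otimes> (k \<otimes> inv l)"] c by simp
            also have "\<dots> = k \<otimes> l [^] (-1::int)" using c by (simp add: mult_inv_mult_cancel int_pow_neg)
            finally show ?thesis ..
          qed
          then have "N (k \<otimes> l [^] (-1::int)) \<le> N (inv a \<otimes> k) + N (inv a \<otimes> l)"
            using seminormD(4)[OF N(1), of "inv a \<otimes> k" "inv (inv a \<otimes> l)"]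
              seminormD(3)[OF N(1), of "inv a \<otimes> l"] c by simp
          then show "F (k, -1) l \<le> \<epsilon> / 2" using U(2)[OF elim(1)] U(2)[OF l(1)] c l(2) by (simp add: F)
        qed
        then show ?case using \<epsilon> by simp
      qed
    qed
    ultimately show ?thesis by blast
  qed
  obtain Y :: "('a \<times> int) set monoid" and S f where Y:
    "topological_group Y S" "f \<in> hom G Y" "\<not> closedin S (f ` carrier G)"
    and emb: "(\<forall>U. nhd U \<longrightarrow> (\<exists>L. seminorm \<Gamma> L \<and> adapted (\<lambda>x. x) p L \<and> (\<forall>x\<in>carrier G. L (x, 0) < 1 \<longrightarrow> x \<in> U))) \<longrightarrow>
      embedding_map T S f"
  proof (rule non_closed_group_extension[of "\<lambda>x. x" p])
    show "eventually (\<lambda>k. k \<in> center G) p" by (rule pz)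
    show "p \<noteq> bot" by (rule pb)
    show "\<exists>L. seminorm \<Gamma> L \<and> adapted (\<lambda>x. x) p L \<and> 0 < L (g, 0)" if g: "g \<in> carrier G" "g \<noteq> \<one>" for g
    proof -
      have "closedin T {\<one>}" using hausdorff topspace_eq by (intro closedin_Hausdorff_singleton) auto
      then obtain U where U: "nhd U" "\<And>u. u \<in> U \<Longrightarrow> g \<otimes> inv u \<noteq> \<one>"
        using nhd_away_from_closed[of "{\<one>}" g] g by auto
      have gU: "g \<notin> U" using U(2)[of g] g(1) by auto
      obtain N where N: "seminorm G N" "continuous_at_one N" "\<And>x. x \<in> carrier G \<Longrightarrow> N x \<le> 1"
        "\<And>x. x \<in> carrier G \<Longrightarrow> N x < 1 \<Longrightarrow> x \<in> U"
        by (rule continuous_seminorm_in_nhd[OF U(1)]) (rule that)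
      have "1 \<le> N g" using N(4)[OF g(1)] gU by force
      moreover obtain L where "seminorm \<Gamma> L" "adapted (\<lambda>x. x) p L" "L (g, 0) = N g" using lim[OF N(1-3)] g(1) by blast
      ultimately show ?thesis by (intro exI[of _ L]) auto
    qed
    show "\<exists>L. seminorm \<Gamma> L \<and> adapted (\<lambda>x. x) p L \<and> 0 < L (g, 1)" if g: "g \<in> carrier G" for g
    proof -
      obtain U where U: "nhd U" "eventually (\<lambda>y. inv (inv g) \<otimes> y \<notin> U) p" using nconv[of "inv g"] g by auto
      obtain N where N: "seminorm G N" "continuous_at_one N" "\<And>x. x \<in> carrier G \<Longrightarrow> N x \<le> 1"
        "\<And>x. x \<in> carrier G \<Longrightarrow> N x < 1 \<Longrightarrow> x \<in> U"
        by (rule continuous_seminorm_in_nhd[OF U(1)]) (rule that)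
      have "eventually (\<lambda>l. N (g \<otimes> l) \<ge> 1) p" using U(2) pz
      proof eventually_elim
        case (elim l)
        then have "l \<in> carrier G" using center_carrier by blast
        then show ?case using elim N(4)[of "g \<otimes> l"] g by force
      qed
      then obtain L where "seminorm \<Gamma> L" "adapted (\<lambda>x. x) p L" "1 \<le> L (g, 1)" using lim[OF N(1-3)] g by blast
      then show ?thesis by (intro exI[of _ L]) auto
    qed
  qed (rule that)
  have "embedding_map T S f"
  proof (rule emb[rule_format])
    fix U assume U: "nhd U"
    obtain N where N: "seminorm G N" "continuous_at_one N" "\<And>x. x \<in> carrier G \<Longrightarrow> N x \<le> 1"
      "\<And>x. x \<in> carrier G \<Longrightarrow> N x < 1 \<Longrightarrow> x \<in> U"
      by (rule continuous_seminorm_in_nhd[OF U]) (rule that)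
    then show "\<exists>L. seminorm \<Gamma> L \<and> adapted (\<lambda>x. x) p L \<and> (\<forall>x\<in>carrier G. L (x, 0) < 1 \<longrightarrow> x \<in> U)"
      using lim[OF N(1-3)] by metis
  qed
  then show False using closed[OF Y(1,2)] Y(3) by blast
qed

section \<open>Semigroup extensions\<close>

text \<open>The semigroup is the disjoint union of the open subgroup \<open>G\<close> and the ideal \<open>I\<close>, where products with
  a factor in \<open>I\<close> are computed in \<open>Y\<close>. Its topology is generated by the open sets of \<open>G\<close> and the preimages of
  open sets under the homomorphism \<open>\<phi>\<close> to \<open>Y\<close>. Unlike an extension by a group it
  may identify elements of \<open>G\<close> in the limit: \<open>\<theta>\<close> need not be injective.\<close>
lemma non_closed_semigroup_extension:
  fixes Y :: "('g, 'n) monoid_scheme"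
  assumes Y: "paratopological_group Y R" and \<theta>: "\<theta> \<in> hom G Y" "continuous_map T R \<theta>"
    and I: "I \<subseteq> carrier Y" "\<And>x y. x \<in> I \<Longrightarrow> y \<in> I \<Longrightarrow> x \<otimes>\<^bsub>Y\<^esub> y \<in> I"
      "\<And>x y. x \<in> carrier G \<Longrightarrow> y \<in> I \<Longrightarrow> \<theta> x \<otimes>\<^bsub>Y\<^esub> y \<in> I \<and> y \<otimes>\<^bsub>Y\<^esub> \<theta> x \<in> I"
      "\<And>x. x \<in> carrier G \<Longrightarrow> \<theta> x \<notin> I"
    and y0: "y0 \<in> I" "\<And>W. openin R W \<Longrightarrow> y0 \<in> W \<Longrightarrow> \<exists>x\<in>carrier G. \<theta> x \<in> W"
  obtains P :: "('a + 'g) monoid" and Q where "topological_semigroup P Q" "Inl \<in> hom G P"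
    "embedding_map T Q Inl" "\<not> closedin Q (Inl ` carrier G)"
proof -
  define \<phi> where "\<phi> = case_sum \<theta> (\<lambda>y::'g. y)"
  have \<phi> [simp]: "\<phi> (Inl x) = \<theta> x" "\<phi> (Inr y) = y" for x y by (simp_all add: \<phi>_def)
  define m where "m s t = (case (s, t) of (Inl a, Inl b) \<Rightarrow> Inl (a \<otimes> b) | _ \<Rightarrow> Inr (\<phi> s \<otimes>\<^bsub>Y\<^esub> \<phi> t))" for s t
  have m [simp]: "m (Inl a) (Inl b) = Inl (a \<otimes> b)" "m (Inr y) t = Inr (y \<otimes>\<^bsub>Y\<^esub> \<phi> t)"
    "m s (Inr y) = Inr (\<phi> s \<otimes>\<^bsub>Y\<^esub> y)" for a b y s t
    by (simp_all add: m_def split: sum.splits)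
  define P :: "('a + 'g) monoid" where "P = \<lparr>carrier = Inl ` carrier G \<union> Inr ` I, mult = m, one = Inl \<one>\<rparr>"
  have P [simp]: "carrier P = Inl ` carrier G \<union> Inr ` I" "s \<otimes>\<^bsub>P\<^esub> t = m s t" for s t by (simp_all add: P_def)
  interpret Y: group Y using Y by (simp add: paratopological_group_def)
  have R: "topspace R = carrier Y" "Hausdorff_space R" "continuous_map (prod_topology R R) R (\<lambda>(x, y). x \<otimes>\<^bsub>Y\<^esub> y)"
    using Y by (auto simp: paratopological_group_def topological_semigroup_def topologized_semigroup_def)
  have \<phi>c: "\<phi> s \<in> carrier Y" if "s \<in> carrier P" for s using that I(1) \<theta>(1) by (auto simp: hom_def)
  have mc: "m s t \<in> carrier P" if "s \<in> carrier P" "t \<in> carrier P" for s t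
    using that I(2,3) by (auto simp: subset_iff)
  have \<phi>m: "\<phi> (m s t) = \<phi> s \<otimes>\<^bsub>Y\<^esub> \<phi> t" if "s \<in> carrier P" "t \<in> carrier P" for s t
    using that \<theta>(1) by (auto simp: hom_def)
  have assoc: "m (m s t) u = m s (m t u)" if "s \<in> carrier P" "t \<in> carrier P" "u \<in> carrier P" for s t u
  proof (cases "s \<in> Inl ` carrier G \<and> t \<in> Inl ` carrier G \<and> u \<in> Inl ` carrier G")
    case True
    then show ?thesis by (auto simp: m_assoc)
  next
    case False
    have "m (m s t) u = Inr (\<phi> (m s t) \<otimes>\<^bsub>Y\<^esub> \<phi> u)" "m s (m t u) = Inr (\<phi> s \<otimes>\<^bsub>Y\<^esub> \<phi> (m t u))"
      using False that by auto
    then show ?thesis using that \<phi>m \<phi>c Y.m_assoc by metis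
  qed
  define op where "op U \<longleftrightarrow> U \<subseteq> carrier P \<and> openin T {x \<in> carrier G. Inl x \<in> U} \<and>
      (\<forall>y\<in>I. Inr y \<in> U \<longrightarrow> (\<exists>W. openin R W \<and> y \<in> W \<and> (\<forall>s\<in>carrier P. \<phi> s \<in> W \<longrightarrow> s \<in> U)))" for U
  have "istopology op" unfolding istopology_def
  proof (intro conjI allI impI)
    fix A B assume A: "op A" and B: "op B"
    show "op (A \<inter> B)" unfolding op_def
    proof (intro conjI ballI impI)
      show "A \<inter> B \<subseteq> carrier P" using A by (auto simp: op_def)
      have "{x \<in> carrier G. Inl x \<in> A \<inter> B} = {x \<in> carrier G. Inl x \<in> A} \<inter> {x \<in> carrier G. Inl x \<in> B}" by auto
      then show "openin T {x \<in> carrier G. Inl x \<in> A \<inter> B}" using A B by (simp add: op_def openin_Int)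
      fix y assume y: "y \<in> I" "Inr y \<in> A \<inter> B"
      obtain V where V: "openin R V" "y \<in> V" "\<forall>s\<in>carrier P. \<phi> s \<in> V \<longrightarrow> s \<in> A" using A y unfolding op_def by blast
      obtain W where W: "openin R W" "y \<in> W" "\<forall>s\<in>carrier P. \<phi> s \<in> W \<longrightarrow> s \<in> B" using B y unfolding op_def by blast
      show "\<exists>W. openin R W \<and> y \<in> W \<and> (\<forall>s\<in>carrier P. \<phi> s \<in> W \<longrightarrow> s \<in> A \<inter> B)"
        using V W by (intro exI[of _ "V \<inter> W"]) (simp add: openin_Int)
    qed
  next
    fix K assume K: "\<forall>A\<in>K. op A"
    show "op (\<Union>K)" unfolding op_def
    proof (intro conjI ballI impI)
      show "\<Union>K \<subseteq> carrier P" using K unfolding op_def by blast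
      have "{x \<in> carrier G. Inl x \<in> \<Union>K} = (\<Union>A\<in>K. {x \<in> carrier G. Inl x \<in> A})" by auto
      then show "openin T {x \<in> carrier G. Inl x \<in> \<Union>K}" using K by (auto simp: op_def)
      fix y assume y: "y \<in> I" "Inr y \<in> \<Union>K"
      then obtain A where "A \<in> K" "Inr y \<in> A" by blast
      then show "\<exists>W. openin R W \<and> y \<in> W \<and> (\<forall>s\<in>carrier P. \<phi> s \<in> W \<longrightarrow> s \<in> \<Union>K)"
        using K y(1) unfolding op_def by (meson UnionI)
    qed
  qed
  define Q where "Q = topology op"
  have Q: "openin Q U \<longleftrightarrow> op U" for U unfolding Q_def using \<open>istopology op\<close> by simp
  have Inl_open: "openin Q (Inl ` A)" if A: "openin T A" for A
  proof -
    have "{x \<in> carrier G. Inl x \<in> (Inl ` A :: ('a + 'g) set)} = A" using open_carrier[OF A] by auto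
    then show ?thesis unfolding Q op_def using A open_carrier[OF A] by auto
  qed
  have pre_open: "openin Q {s \<in> carrier P. \<phi> s \<in> W}" if W: "openin R W" for W
    unfolding Q op_def
  proof (intro conjI ballI impI)
    have "{x \<in> carrier G. Inl x \<in> {s \<in> carrier P. \<phi> s \<in> W}} = {x \<in> topspace T. \<theta> x \<in> W}" by (auto simp: topspace_eq)
    then show "openin T {x \<in> carrier G. Inl x \<in> {s \<in> carrier P. \<phi> s \<in> W}}"
      using openin_continuous_map_preimage[OF \<theta>(2) W] by simp
  qed (use W in auto)
  have topQ: "topspace Q = carrier P"
  proof
    show "topspace Q \<subseteq> carrier P" using openin_topspace[of Q] unfolding Q op_def by blast
    have "{s \<in> carrier P. \<phi> s \<in> topspace R} = carrier P" using \<phi>c R(1) by blast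
    then have "openin Q (carrier P)" using pre_open[OF openin_topspace] by (simp only:)
    then show "carrier P \<subseteq> topspace Q" by (rule openin_subset)
  qed
  have "Hausdorff_space Q" unfolding Hausdorff_space_def
  proof (intro allI impI)
    fix s t assume st: "s \<in> topspace Q \<and> t \<in> topspace Q \<and> s \<noteq> t"
    show "\<exists>U V. openin Q U \<and> openin Q V \<and> s \<in> U \<and> t \<in> V \<and> disjnt U V"
    proof (cases "\<phi> s = \<phi> t")
      case False
      moreover have "\<phi> s \<in> carrier Y" "\<phi> t \<in> carrier Y" using \<phi>c st topQ by auto
      ultimately obtain U V where UV: "openin R U" "openin R V" "\<phi> s \<in> U" "\<phi> t \<in> V" "disjnt U V"
        using R(2) unfolding Hausdorff_space_def R(1) by blast
      have "disjnt {s \<in> carrier P. \<phi> s \<in> U} {s \<in> carrier P. \<phi> s \<in> V}" using UV(5) by (auto simp: disjnt_iff)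
      then show ?thesis using pre_open[OF UV(1)] pre_open[OF UV(2)] UV st topQ by blast
    next
      case True
      obtain a b where ab: "s = Inl a" "t = Inl b" "a \<in> carrier G" "b \<in> carrier G" "a \<noteq> b"
        using True st topQ I(4) by auto
      then obtain U V where UV: "openin T U" "openin T V" "a \<in> U" "b \<in> V" "disjnt U V"
        using hausdorff unfolding Hausdorff_space_def topspace_eq by blast
      have "disjnt (Inl ` U :: ('a + 'g) set) (Inl ` V)" using UV(5) by (auto simp: disjnt_iff)
      then show ?thesis using Inl_open[OF UV(1)] Inl_open[OF UV(2)] UV(3,4) ab by blast
    qed
  qed
  moreover have "continuous_map (prod_topology Q Q) Q (\<lambda>(s, t). s \<otimes>\<^bsub>P\<^esub> t)"
  proof (rule continuous_map_prodI)
    show "(\<lambda>(s, t). s \<otimes>\<^bsub>P\<^esub> t) (s, t) \<in> topspace Q" if "s \<in> topspace Q" "t \<in> topspace Q" for s t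
      using that mc by (simp add: topQ)
    fix U s t assume U: "openin Q U" and st: "s \<in> topspace Q" "t \<in> topspace Q" "(\<lambda>(s, t). s \<otimes>\<^bsub>P\<^esub> t) (s, t) \<in> U"
    then have sP: "s \<in> carrier P" "t \<in> carrier P" "m s t \<in> U" by (auto simp: topQ)
    have opU: "op U" using U Q by simp
    show "\<exists>A B. openin Q A \<and> s \<in> A \<and> openin Q B \<and> t \<in> B \<and> (\<forall>a\<in>A. \<forall>b\<in>B. (\<lambda>(s, t). s \<otimes>\<^bsub>P\<^esub> t) (a, b) \<in> U)"
    proof (cases "s \<in> Inl ` carrier G \<and> t \<in> Inl ` carrier G")
      case True
      then obtain a b where ab: "s = Inl a" "t = Inl b" "a \<in> carrier G" "b \<in> carrier G" by blast
      have "openin T {x \<in> carrier G. Inl x \<in> U}" using opU by (simp add: op_def)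
      then obtain A B where AB: "openin T A" "a \<in> A" "openin T B" "b \<in> B"
        "\<And>a b. a \<in> A \<Longrightarrow> b \<in> B \<Longrightarrow> a \<otimes> b \<in> {x \<in> carrier G. Inl x \<in> U}"
        by (rule mult_nhds[OF _ ab(3,4)]) (use sP ab in auto)
      show ?thesis
        by (rule exI[of _ "Inl ` A"], rule exI[of _ "Inl ` B"]) (use AB ab Inl_open in auto)
    next
      case False
      then have st_eq: "m s t = Inr (\<phi> s \<otimes>\<^bsub>Y\<^esub> \<phi> t)" using sP by auto
      then have "\<phi> s \<otimes>\<^bsub>Y\<^esub> \<phi> t \<in> I" using mc[OF sP(1,2)] by auto
      then obtain W where W: "openin R W" "\<phi> s \<otimes>\<^bsub>Y\<^esub> \<phi> t \<in> W" "\<And>u. u \<in> carrier P \<Longrightarrow> \<phi> u \<in> W \<Longrightarrow> u \<in> U"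
        using opU sP(3) unfolding op_def st_eq by blast
      obtain A B where AB: "openin R A" "\<phi> s \<in> A" "openin R B" "\<phi> t \<in> B"
        "\<And>a b. a \<in> A \<Longrightarrow> b \<in> B \<Longrightarrow> (\<lambda>(x, y). x \<otimes>\<^bsub>Y\<^esub> y) (a, b) \<in> W"
        by (rule continuous_prod_nhds[OF R(3) W(1), of "\<phi> s" "\<phi> t"]) (use W(2) sP \<phi>c R(1) that in auto)
      show ?thesis
      proof (intro exI conjI ballI)
        show "openin Q {s \<in> carrier P. \<phi> s \<in> A}" "openin Q {s \<in> carrier P. \<phi> s \<in> B}" by (rule pre_open AB)+
        show "s \<in> {s \<in> carrier P. \<phi> s \<in> A}" "t \<in> {s \<in> carrier P. \<phi> s \<in> B}" using sP AB by auto
        fix a b assume ab: "a \<in> {s \<in> carrier P. \<phi> s \<in> A}" "b \<in> {s \<in> carrier P. \<phi> s \<in> B}"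
        then have "m a b \<in> U" using W(3)[OF mc[of a b]] \<phi>m[of a b] AB(5)[of "\<phi> a" "\<phi> b"] by auto
        then show "(\<lambda>(s, t). s \<otimes>\<^bsub>P\<^esub> t) (a, b) \<in> U" by simp
      qed
    qed
  qed
  moreover have "topologized_semigroup P Q"
    unfolding topologized_semigroup_def using topQ mc assoc by (auto simp del: P(1) simp: P(2))
  ultimately have "topological_semigroup P Q" by (simp add: topological_semigroup_def)
  moreover have "Inl \<in> hom G P" by (auto simp: hom_def)
  moreover have "embedding_map T Q Inl"
  proof (rule embedding_mapI)
    show "continuous_map T Q Inl" unfolding continuous_map_def topspace_eq topQ
      by (auto simp: Q op_def)
    show "inj_on Inl (topspace T)" by simp
    show "\<exists>W. openin Q W \<and> Inl x \<in> W \<and> (\<forall>y\<in>topspace T. Inl y \<in> W \<longrightarrow> y \<in> A)" if "openin T A" "x \<in> A" for A x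
      using Inl_open[OF that(1)] that(2) by (intro exI[of _ "Inl ` A"]) auto
  qed
  moreover have "\<not> closedin Q (Inl ` carrier G)"
  proof
    assume "closedin Q (Inl ` carrier G)"
    then have "op (topspace Q - Inl ` carrier G)" using Q by (simp add: closedin_def)
    moreover have "Inr y0 \<in> topspace Q - Inl ` carrier G" using y0(1) topQ by auto
    ultimately obtain W where W: "openin R W" "y0 \<in> W" "\<forall>s\<in>carrier P. \<phi> s \<in> W \<longrightarrow> s \<in> topspace Q - Inl ` carrier G"
      using y0(1) unfolding op_def by blast
    then obtain x where "x \<in> carrier G" "\<theta> x \<in> W" using y0(2) by blast
    then show False using W(3)[rule_format, of "Inl x"] by auto
  qed
  ultimately show ?thesis by (rule that)
qed

text \<open>A zero element \<open>None\<close> is added. Its neighborhoods are the complements of sets covered by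
  finitely many two-sided translates \<open>a U b\<close>; this condition is invariant under translations, which
  makes the multiplication separately continuous. A two-sided translate meets the center in a set of
  diameter \<open>U U\<inverse>\<close>, because conjugation by \<open>a\<close> fixes the central quotient of two of its elements. Hence
  if the center is not bounded, then \<open>G\<close> is not covered and the zero is not isolated.\<close>
lemma non_closed_one_point_extension:
  assumes "\<not> centrally_bounded (center G)"
  obtains P :: "'a option monoid" and Q where "semitopological_semigroup P Q" "Some \<in> hom G P"
    "embedding_map T Q Some" "\<not> closedin Q (Some ` carrier G)"
proof -
  obtain W0 where W0_nhd: "nhd W0"
    and W0_no: "\<not> (\<exists>F. finite F \<and> F \<subseteq> center G \<and> (\<forall>a\<in>center G. \<exists>f\<in>F. inv f \<otimes> a \<in> W0))"
    using assms unfolding centrally_bounded_def by blast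
  have "\<forall>F. finite F \<longrightarrow> F \<subseteq> center G \<longrightarrow> (\<exists>a\<in>center G. \<forall>f\<in>F. inv f \<otimes> a \<notin> W0)" using W0_no by simp
  with W0_nhd have W0: "nhd W0" "\<And>F. finite F \<Longrightarrow> F \<subseteq> center G \<Longrightarrow> \<exists>a\<in>center G. \<forall>f\<in>F. inv f \<otimes> a \<notin> W0"
    by simp_all
  obtain U where U: "nhd U" "\<And>x. x \<in> U \<Longrightarrow> inv x \<in> U" "\<And>x y z. x \<in> U \<Longrightarrow> y \<in> U \<Longrightarrow> z \<in> U \<Longrightarrow> x \<otimes> y \<otimes> z \<in> W0"
    by (rule nhd_cube[OF W0(1)]) (rule that)
  have Uc: "u \<in> U \<Longrightarrow> u \<in> carrier G" for u using nhd_carrier[OF U(1)] by blast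
  have one: "\<one> \<in> U" using U(1) by (simp add: nhd_def)
  define small where "small K \<longleftrightarrow> (\<exists>F. finite F \<and> F \<subseteq> carrier G \<times> carrier G \<and>
      (\<forall>x\<in>K. \<exists>q\<in>F. \<exists>u\<in>U. x = fst q \<otimes> u \<otimes> snd q))" for K
  have small_mono: "small K \<Longrightarrow> K' \<subseteq> K \<Longrightarrow> small K'" for K K' unfolding small_def by (meson subsetD)
  have small_Un: "small (K \<union> K')" if "small K" "small K'" for K K'
  proof -
    obtain F where F: "finite F" "F \<subseteq> carrier G \<times> carrier G" "\<forall>x\<in>K. \<exists>q\<in>F. \<exists>u\<in>U. x = fst q \<otimes> u \<otimes> snd q"
      using \<open>small K\<close> unfolding small_def by (elim exE conjE) (rule that)
    obtain F' where F': "finite F'" "F' \<subseteq> carrier G \<times> carrier G" "\<forall>x\<in>K'. \<exists>q\<in>F'. \<exists>u\<in>U. x = fst q \<otimes> u \<otimes> snd q"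
      using \<open>small K'\<close> unfolding small_def by (elim exE conjE) (rule that)
    show ?thesis unfolding small_def
    proof (intro exI[of _ "F \<union> F'"] conjI ballI)
      fix x assume "x \<in> K \<union> K'"
      then show "\<exists>q\<in>F \<union> F'. \<exists>u\<in>U. x = fst q \<otimes> u \<otimes> snd q"
        using F(3) F'(3) by blast
    qed (use F F' in auto)
  qed
  have small_left: "small {x \<in> carrier G. g \<otimes> x \<in> K}" and small_right: "small {x \<in> carrier G. x \<otimes> g \<in> K}"
    if "small K" and g: "g \<in> carrier G" for K g
  proof -
    obtain F where F: "finite F" "F \<subseteq> carrier G \<times> carrier G" "\<forall>x\<in>K. \<exists>q\<in>F. \<exists>u\<in>U. x = fst q \<otimes> u \<otimes> snd q"
      using \<open>small K\<close> unfolding small_def by (elim exE conjE) (rule that)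
    show "small {x \<in> carrier G. g \<otimes> x \<in> K}" unfolding small_def
    proof (intro exI[of _ "(\<lambda>(a, b). (inv g \<otimes> a, b)) ` F"] conjI ballI)
      fix x assume x: "x \<in> {x \<in> carrier G. g \<otimes> x \<in> K}"
      then obtain q u where "q \<in> F" "u \<in> U" "g \<otimes> x = fst q \<otimes> u \<otimes> snd q" using F(3)[rule_format, of "g \<otimes> x"] x by auto
      then obtain a b where abu: "(a, b) \<in> F" "u \<in> U" "g \<otimes> x = a \<otimes> u \<otimes> b" by (cases q) simp
      then have c: "a \<in> carrier G" "b \<in> carrier G" "u \<in> carrier G" using F(2) Uc by auto
      have "x = inv g \<otimes> (g \<otimes> x)" using g x by (simp add: m_assoc[symmetric])
      then have "x = (inv g \<otimes> a) \<otimes> u \<otimes> b" using abu(3) g c by (simp add: m_assoc)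
      then show "\<exists>q\<in>(\<lambda>(a, b). (inv g \<otimes> a, b)) ` F. \<exists>u\<in>U. x = fst q \<otimes> u \<otimes> snd q"
        using abu(2) by (intro bexI[OF _ image_eqI[of _ _ "(a, b)"]] bexI[of _ u]) (use abu(1) in auto)
    qed (use F g in auto)
    show "small {x \<in> carrier G. x \<otimes> g \<in> K}" unfolding small_def
    proof (intro exI[of _ "(\<lambda>(a, b). (a, b \<otimes> inv g)) ` F"] conjI ballI)
      fix x assume x: "x \<in> {x \<in> carrier G. x \<otimes> g \<in> K}"
      then obtain q u where "q \<in> F" "u \<in> U" "x \<otimes> g = fst q \<otimes> u \<otimes> snd q" using F(3)[rule_format, of "x \<otimes> g"] x by auto
      then obtain a b where abu: "(a, b) \<in> F" "u \<in> U" "x \<otimes> g = a \<otimes> u \<otimes> b" by (cases q) simp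
      then have c: "a \<in> carrier G" "b \<in> carrier G" "u \<in> carrier G" using F(2) Uc by auto
      have "x = (x \<otimes> g) \<otimes> inv g" using g x by (simp add: m_assoc)
      then have "x = a \<otimes> u \<otimes> (b \<otimes> inv g)" using abu(3) g c by (simp add: m_assoc)
      then show "\<exists>q\<in>(\<lambda>(a, b). (a, b \<otimes> inv g)) ` F. \<exists>u\<in>U. x = fst q \<otimes> u \<otimes> snd q"
        using abu(2) by (intro bexI[OF _ image_eqI[of _ _ "(a, b)"]] bexI[of _ u]) (use abu(1) in auto)
    qed (use F g in auto)
  qed
  have not_small: "\<not> small (carrier G)"
  proof
    assume "small (carrier G)"
    then obtain F where F: "finite F" "F \<subseteq> carrier G \<times> carrier G"
      "\<forall>x\<in>carrier G. \<exists>q\<in>F. \<exists>u\<in>U. x = fst q \<otimes> u \<otimes> snd q"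
      unfolding small_def by (elim exE conjE) (rule that)
    define F0 where "F0 = {q \<in> F. \<exists>z\<in>center G. \<exists>u\<in>U. z = fst q \<otimes> u \<otimes> snd q}"
    have "\<forall>q\<in>F0. \<exists>z. z \<in> center G \<and> (\<exists>u\<in>U. z = fst q \<otimes> u \<otimes> snd q)" by (auto simp: F0_def)
    then obtain c where c: "\<And>q. q \<in> F0 \<Longrightarrow> c q \<in> center G \<and> (\<exists>u\<in>U. c q = fst q \<otimes> u \<otimes> snd q)" by metis
    have "finite (c ` F0)" using F(1) by (simp add: F0_def)
    moreover have "c ` F0 \<subseteq> center G" using c by blast
    ultimately obtain z where z: "z \<in> center G" "\<And>f. f \<in> c ` F0 \<Longrightarrow> inv f \<otimes> z \<notin> W0" using W0(2)[of "c ` F0"] by blast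
    have zc: "z \<in> carrier G" using z(1) center_carrier by blast
    obtain q u where "q \<in> F" "u \<in> U" "z = fst q \<otimes> u \<otimes> snd q" using F(3)[rule_format, OF zc] by auto
    then obtain a b where abu: "(a, b) \<in> F" "u \<in> U" "z = a \<otimes> u \<otimes> b" by (cases q) simp
    then have q: "(a, b) \<in> F0" using z(1) by (auto simp: F0_def)
    obtain v where v: "v \<in> U" "c (a, b) = a \<otimes> v \<otimes> b" "c (a, b) \<in> center G" using c[OF q] by auto
    have cc: "a \<in> carrier G" "b \<in> carrier G" "u \<in> carrier G" "v \<in> carrier G" "c (a, b) \<in> carrier G"
      using abu F(2) Uc v center_carrier by auto
    have inv_c: "inv (c (a, b)) \<in> center G" by (rule subgroup.m_inv_closed[OF center_subgroup v(3)])
    have w: "inv (c (a, b)) \<otimes> z \<in> center G" by (rule subgroup.m_closed[OF center_subgroup inv_c z(1)])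
    have "inv (c (a, b)) \<otimes> z = z \<otimes> inv (c (a, b))" using center_comm[OF z(1), of "inv (c (a, b))"] cc by simp
    also have "\<dots> = a \<otimes> (u \<otimes> inv v) \<otimes> inv a"
      unfolding abu(3) v(2) using cc by (simp add: inv_mult_group m_assoc mult_inv_mult_cancel)
    finally have e: "inv (c (a, b)) \<otimes> z = a \<otimes> (u \<otimes> inv v) \<otimes> inv a" .
    \<comment> \<open>A conjugate of \<open>u \<otimes> inv v\<close> is central and therefore equal to it.\<close>
    have "u \<otimes> inv v = inv a \<otimes> (a \<otimes> (u \<otimes> inv v) \<otimes> inv a) \<otimes> a" using cc by (simp add: m_assoc) (simp add: m_assoc[symmetric])
    also have "\<dots> = inv a \<otimes> ((inv (c (a, b)) \<otimes> z) \<otimes> a)" unfolding e using cc by (simp add: m_assoc)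
    also have "\<dots> = inv (c (a, b)) \<otimes> z"
      unfolding center_comm[OF w cc(1)] using cc zc by (simp add: m_assoc[symmetric])
    finally have "inv (c (a, b)) \<otimes> z = u \<otimes> inv v \<otimes> \<one>" using cc zc by simp
    also have "\<dots> \<in> W0" using U(2,3) abu(2) v(1) one by blast
    finally show False using z(2) q by blast
  qed
  define m where "m s t = (case (s, t) of (Some a, Some b) \<Rightarrow> Some (a \<otimes> b) | _ \<Rightarrow> None)" for s t
  have m [simp]: "m (Some a) (Some b) = Some (a \<otimes> b)" "m None t = None" "m s None = None" for a b s t
    by (simp_all add: m_def split: option.splits)
  define P :: "'a option monoid" where "P = \<lparr>carrier = insert None (Some ` carrier G), mult = m, one = Some \<one>\<rparr>"
  have P [simp]: "carrier P = insert None (Some ` carrier G)" "s \<otimes>\<^bsub>P\<^esub> t = m s t" for s t by (simp_all add: P_def)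
  define op where "op A \<longleftrightarrow> A \<subseteq> carrier P \<and> openin T {x \<in> carrier G. Some x \<in> A} \<and>
      (None \<in> A \<longrightarrow> small {x \<in> carrier G. Some x \<notin> A})" for A
  have "istopology op" unfolding istopology_def
  proof (intro conjI allI impI)
    fix A B assume A: "op A" and B: "op B"
    have "{x \<in> carrier G. Some x \<in> A \<inter> B} = {x \<in> carrier G. Some x \<in> A} \<inter> {x \<in> carrier G. Some x \<in> B}"
      "{x \<in> carrier G. Some x \<notin> A \<inter> B} = {x \<in> carrier G. Some x \<notin> A} \<union> {x \<in> carrier G. Some x \<notin> B}" by auto
    then show "op (A \<inter> B)" using A B small_Un by (auto simp: op_def openin_Int)
  next
    fix K assume K: "\<forall>A\<in>K. op A"
    have "{x \<in> carrier G. Some x \<in> \<Union>K} = (\<Union>A\<in>K. {x \<in> carrier G. Some x \<in> A})" by auto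
    moreover have "small {x \<in> carrier G. Some x \<notin> \<Union>K}" if N: "None \<in> \<Union>K"
    proof -
      obtain A where A: "A \<in> K" "None \<in> A" using N by (rule UnionE)
      have "small {x \<in> carrier G. Some x \<notin> A}" using K A by (simp add: op_def)
      then show ?thesis by (rule small_mono) (use A(1) in auto)
    qed
    ultimately show "op (\<Union>K)" using K unfolding op_def by auto
  qed
  define Q where "Q = topology op"
  have Q: "openin Q A \<longleftrightarrow> op A" for A unfolding Q_def using \<open>istopology op\<close> by simp
  have Some_open: "openin Q (Some ` A)" if A: "openin T A" for A
  proof -
    have "{x \<in> carrier G. Some x \<in> Some ` A} = A" using open_carrier[OF A] by auto
    then show ?thesis unfolding Q op_def using A open_carrier[OF A] by auto
  qed
  have small_empty: "small {}" unfolding small_def by blast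
  have topQ: "topspace Q = carrier P"
  proof
    show "topspace Q \<subseteq> carrier P" using openin_topspace[of Q] unfolding Q op_def by blast
    have "op (carrier P)" unfolding op_def using small_empty openin_topspace[of T] by (simp add: topspace_eq image_iff)
    then show "carrier P \<subseteq> topspace Q" using openin_subset Q by blast
  qed
  have sep_None: "\<exists>A B. openin Q A \<and> openin Q B \<and> Some x \<in> A \<and> None \<in> B \<and> disjnt A B" if x: "x \<in> carrier G" for x
  proof -
    obtain V where V: "nhd V" "\<And>x. x \<in> V \<Longrightarrow> inv x \<in> V" "\<And>x y z. x \<in> V \<Longrightarrow> y \<in> V \<Longrightarrow> z \<in> V \<Longrightarrow> x \<otimes> y \<otimes> z \<in> U"
      by (rule nhd_cube[OF U(1)]) (rule that)
    have Vc: "v \<in> V \<Longrightarrow> v \<in> carrier G" for v using nhd_carrier[OF V(1)] by blast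
    define A where "A = {y \<in> carrier G. inv x \<otimes> y \<in> V}"
    have A: "openin T A" "x \<in> A" using open_vimage[OF continuous_mult_left, of "inv x" V] V(1) x by (auto simp: A_def nhd_def)
    define B where "B = carrier G - T closure_of A"
    have B: "openin T B" using closedin_closure_of[of T A] by (simp add: B_def topspace_eq[symmetric] openin_diff)
    have "small (T closure_of A)" unfolding small_def
    proof (intro exI[of _ "{(x, \<one>)}"] conjI ballI)
      fix y assume y: "y \<in> T closure_of A"
      then have yc: "y \<in> carrier G" by (simp add: in_closure_of topspace_eq)
      have "openin T {w \<in> carrier G. inv y \<otimes> w \<in> V}" "y \<in> {w \<in> carrier G. inv y \<otimes> w \<in> V}"
        using open_vimage[OF continuous_mult_left, of "inv y" V] V(1) yc by (auto simp: nhd_def)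
      then obtain w where w: "w \<in> A" "inv y \<otimes> w \<in> V"
        using conjunct2[OF y[unfolded in_closure_of], rule_format, of "{w \<in> carrier G. inv y \<otimes> w \<in> V}"] by auto
      then have wc: "w \<in> carrier G" by (simp add: A_def)
      have "inv x \<otimes> y = (inv x \<otimes> w) \<otimes> inv (inv y \<otimes> w) \<otimes> \<one>"
        using x yc wc by (simp add: inv_mult_group m_assoc mult_inv_mult_cancel)
      also have "\<dots> \<in> U" using w V(1,2,3) by (auto simp: A_def nhd_def)
      finally have "inv x \<otimes> y \<in> U" .
      moreover have "y = x \<otimes> (inv x \<otimes> y) \<otimes> \<one>" using x yc by (simp add: mult_inv_mult_cancel)
      ultimately show "\<exists>q\<in>{(x, \<one>)}. \<exists>u\<in>U. y = fst q \<otimes> u \<otimes> snd q" by (simp only: bex_simps fst_conv snd_conv) blast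
    qed (use x in auto)
    then have "small {y \<in> carrier G. Some y \<notin> insert None (Some ` B)}"
      by (rule small_mono) (auto simp: B_def)
    moreover have "{y \<in> carrier G. Some y \<in> insert None (Some ` B)} = B" by (auto simp: B_def)
    ultimately have "openin Q (insert None (Some ` B))" using B by (auto simp: Q op_def B_def)
    moreover have "disjnt (Some ` A) (insert None (Some ` B))"
      using closure_of_subset[of A T] open_carrier[OF A(1)] topspace_eq by (auto simp: disjnt_iff B_def)
    ultimately show ?thesis using Some_open[OF A(1)] A(2) by blast
  qed
  have "Hausdorff_space Q" unfolding Hausdorff_space_def
  proof (intro allI impI)
    fix s t assume st: "s \<in> topspace Q \<and> t \<in> topspace Q \<and> s \<noteq> t"
    then consider a b where "s = Some a" "t = Some b" "a \<in> carrier G" "b \<in> carrier G" "a \<noteq> b"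
      | a where "s = Some a" "t = None" "a \<in> carrier G" | b where "s = None" "t = Some b" "b \<in> carrier G"
      using topQ by auto
    then show "\<exists>U V. openin Q U \<and> openin Q V \<and> s \<in> U \<and> t \<in> V \<and> disjnt U V"
    proof cases
      case 1
      then obtain U V where UV: "openin T U" "openin T V" "a \<in> U" "b \<in> V" "disjnt U V"
        using hausdorff unfolding Hausdorff_space_def topspace_eq by blast
      have "disjnt (Some ` U) (Some ` V)" using UV(5) by (auto simp: disjnt_iff)
      then show ?thesis using Some_open[OF UV(1)] Some_open[OF UV(2)] UV(3,4) 1 by blast
    next
      case 2
      then show ?thesis using sep_None by blast
    next
      case 3
      then show ?thesis using sep_None[of b] disjnt_sym by blast
    qed
  qed
  moreover have "continuous_map Q Q (\<lambda>t. s \<otimes>\<^bsub>P\<^esub> t) \<and> continuous_map Q Q (\<lambda>t. t \<otimes>\<^bsub>P\<^esub> s)" if s: "s \<in> carrier P" for s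
  proof (cases s)
    case None
    then show ?thesis by (simp add: topQ)
  next
    case (Some g)
    then have g: "g \<in> carrier G" using s by auto
    have "op {t \<in> carrier P. m s t \<in> A} \<and> op {t \<in> carrier P. m t s \<in> A}" if A: "op A" for A
    proof -
      have 1: "{x \<in> carrier G. Some x \<in> {t \<in> carrier P. m s t \<in> A}} = {x \<in> carrier G. g \<otimes> x \<in> {x \<in> carrier G. Some x \<in> A}}"
        "{x \<in> carrier G. Some x \<in> {t \<in> carrier P. m t s \<in> A}} = {x \<in> carrier G. x \<otimes> g \<in> {x \<in> carrier G. Some x \<in> A}}"
        "{x \<in> carrier G. Some x \<notin> {t \<in> carrier P. m s t \<in> A}} = {x \<in> carrier G. g \<otimes> x \<in> {x \<in> carrier G. Some x \<notin> A}}"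
        "{x \<in> carrier G. Some x \<notin> {t \<in> carrier P. m t s \<in> A}} = {x \<in> carrier G. x \<otimes> g \<in> {x \<in> carrier G. Some x \<notin> A}}"
        using g by (auto simp: Some)
      have "openin T {x \<in> carrier G. Some x \<in> A}" using A by (simp add: op_def)
      then have "openin T {x \<in> carrier G. g \<otimes> x \<in> {x \<in> carrier G. Some x \<in> A}}"
        "openin T {x \<in> carrier G. x \<otimes> g \<in> {x \<in> carrier G. Some x \<in> A}}"
        using open_vimage[OF continuous_mult_left[OF g]] open_vimage[OF continuous_mult_right[OF g]] by blast+
      moreover have "small {x \<in> carrier G. g \<otimes> x \<in> {x \<in> carrier G. Some x \<notin> A}}"
        "small {x \<in> carrier G. x \<otimes> g \<in> {x \<in> carrier G. Some x \<notin> A}}" if "None \<in> A"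
        using small_left[OF _ g] small_right[OF _ g] A that by (simp_all only: op_def)
      ultimately show ?thesis unfolding op_def 1 by simp blast
    qed
    moreover have "m s t \<in> carrier P" "m t s \<in> carrier P" if "t \<in> carrier P" for t using that g Some by auto
    ultimately show ?thesis unfolding continuous_map_def topQ Q P(2) by auto
  qed
  moreover have "topologized_semigroup P Q"
    unfolding topologized_semigroup_def using topQ by (auto simp: m_assoc)
  ultimately have "semitopological_semigroup P Q" by (simp add: semitopological_semigroup_def)
  moreover have "Some \<in> hom G P" by (auto simp: hom_def)
  moreover have "embedding_map T Q Some"
  proof (rule embedding_mapI)
    show "continuous_map T Q Some" unfolding continuous_map_def topspace_eq topQ
      by (auto simp: Q op_def)
    show "inj_on Some (topspace T)" by simp
    show "\<exists>W. openin Q W \<and> Some x \<in> W \<and> (\<forall>y\<in>topspace T. Some y \<in> W \<longrightarrow> y \<in> A)" if "openin T A" "x \<in> A" for A x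
      using Some_open[OF that(1)] that(2) by (intro exI[of _ "Some ` A"]) auto
  qed
  moreover have "\<not> closedin Q (Some ` carrier G)"
  proof
    assume "closedin Q (Some ` carrier G)"
    moreover have "topspace Q - Some ` carrier G = {None}" using topQ by auto
    ultimately have "op {None}" using Q by (simp add: closedin_def)
    then show False using not_small by (simp add: op_def)
  qed
  ultimately show ?thesis by (rule that)
qed

end

section \<open>Compactness of bounded central sets\<close>

text \<open>Complements of finite unions of members of an open cover without finite subcover generate a proper
  filter; an ultrafilter below it cannot converge.\<close>
lemma compactin_ultrafilter:
  assumes K: "K \<subseteq> topspace T"
    and conv: "\<And>p. ultrafilter p \<Longrightarrow> eventually (\<lambda>x. x \<in> K) p \<Longrightarrow>
      \<exists>x\<in>K. \<forall>W. openin T W \<and> x \<in> W \<longrightarrow> eventually (\<lambda>y. y \<in> W) p"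
  shows "compactin T K"
  unfolding compactin_def
proof (intro conjI K allI impI, elim conjE)
  fix \<U> assume \<U>: "\<forall>U\<in>\<U>. openin T U" "K \<subseteq> \<Union>\<U>"
  show "\<exists>\<F>. finite \<F> \<and> \<F> \<subseteq> \<U> \<and> K \<subseteq> \<Union>\<F>"
  proof (rule ccontr)
    assume no: "\<not> ?thesis"
    define F where "F = (INF \<F>\<in>{\<F>. finite \<F> \<and> \<F> \<subseteq> \<U>}. principal (K - \<Union>\<F>))"
    have ev: "eventually P F \<longleftrightarrow> (\<exists>\<F>\<in>{\<F>. finite \<F> \<and> \<F> \<subseteq> \<U>}. eventually P (principal (K - \<Union>\<F>)))" for P
      unfolding F_def
    proof (rule eventually_INF_base)
      show "{\<F>. finite \<F> \<and> \<F> \<subseteq> \<U>} \<noteq> {}" by blast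
      show "\<exists>x\<in>{\<F>. finite \<F> \<and> \<F> \<subseteq> \<U>}. principal (K - \<Union>x) \<le> inf (principal (K - \<Union>a)) (principal (K - \<Union>b))"
        if "a \<in> {\<F>. finite \<F> \<and> \<F> \<subseteq> \<U>}" "b \<in> {\<F>. finite \<F> \<and> \<F> \<subseteq> \<U>}" for a b
        using that by (intro bexI[of _ "a \<union> b"]) auto
    qed
    have "F \<noteq> bot"
    proof
      assume "F = bot"
      then have "eventually (\<lambda>x. False) F" by simp
      then obtain \<F> where "finite \<F>" "\<F> \<subseteq> \<U>" "\<forall>x\<in>K - \<Union>\<F>. False"
        unfolding ev eventually_principal by blast
      then show False using no by blast
    qed
    then obtain p where p: "ultrafilter p" "p \<le> F" by (rule ultrafilter_below)
    have "eventually (\<lambda>x. x \<in> K) F" unfolding ev by (rule bexI[of _ "{}"]) (auto simp: eventually_principal)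
    then have "eventually (\<lambda>x. x \<in> K) p" by (rule filter_leD[OF p(2)])
    then obtain x where x: "x \<in> K" "\<And>W. openin T W \<Longrightarrow> x \<in> W \<Longrightarrow> eventually (\<lambda>y. y \<in> W) p"
      using conv[OF p(1)] by blast
    obtain U where U: "U \<in> \<U>" "x \<in> U" using x(1) \<U>(2) by blast
    have "eventually (\<lambda>y. y \<notin> U) F" unfolding ev by (rule bexI[of _ "{U}"]) (use U in \<open>auto simp: eventually_principal\<close>)
    then have "eventually (\<lambda>y. y \<notin> U) p" by (rule filter_leD[OF p(2)])
    moreover have "eventually (\<lambda>y. y \<in> U) p" using x(2) U \<U>(1) by blast
    ultimately have "eventually (\<lambda>y. False) p" by eventually_elim simp
    then show False using p(1) by (simp add: ultrafilter_def trivial_limit_def)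
  qed
qed

context hausdorff_group
begin

lemma centrally_boundedE:
  assumes "centrally_bounded A" "nhd U"
  obtains F where "finite F" "F \<subseteq> center G" "\<forall>a\<in>A. \<exists>f\<in>F. inv f \<otimes> a \<in> U"
  using assms(1)[unfolded centrally_bounded_def, rule_format, OF assms(2)] by (elim exE conjE) (rule that)

lemma centrally_bounded_closure:
  assumes A: "A \<subseteq> carrier G" "centrally_bounded A"
  shows "centrally_bounded (T closure_of A)"
  unfolding centrally_bounded_def
proof (intro allI impI)
  fix W assume "nhd W"
  then obtain V where V: "nhd V" "\<And>x. x \<in> V \<Longrightarrow> inv x \<in> V" "\<And>x y z. x \<in> V \<Longrightarrow> y \<in> V \<Longrightarrow> z \<in> V \<Longrightarrow> x \<otimes> y \<otimes> z \<in> W"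
    by (rule nhd_cube) (rule that)
  obtain F where F: "finite F" "F \<subseteq> center G" "\<forall>a\<in>A. \<exists>f\<in>F. inv f \<otimes> a \<in> V"
    by (rule centrally_boundedE[OF A(2) V(1)])
  have "\<exists>f\<in>F. inv f \<otimes> a \<in> W" if a: "a \<in> T closure_of A" for a
  proof -
    have ac: "a \<in> carrier G" using a by (simp add: in_closure_of topspace_eq)
    have "openin T {w \<in> carrier G. inv a \<otimes> w \<in> V}" "a \<in> {w \<in> carrier G. inv a \<otimes> w \<in> V}"
      using open_vimage[OF continuous_mult_left, of "inv a" V] V(1) ac by (auto simp: nhd_def)
    then obtain b where b: "b \<in> A" "inv a \<otimes> b \<in> V"
      using conjunct2[OF a[unfolded in_closure_of], rule_format, of "{w \<in> carrier G. inv a \<otimes> w \<in> V}"] by auto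
    obtain f where f: "f \<in> F" "inv f \<otimes> b \<in> V" using F(3)[rule_format, OF b(1)] by blast
    have c: "b \<in> carrier G" "f \<in> carrier G" using b A f F(2) center_carrier by auto
    have "inv f \<otimes> a = (inv f \<otimes> b) \<otimes> inv (inv a \<otimes> b) \<otimes> \<one>"
      using ac c by (simp add: inv_mult_group m_assoc mult_inv_mult_cancel)
    also have "\<dots> \<in> W" using V f b by (auto simp: nhd_def)
    finally show ?thesis using f(1) by blast
  qed
  then show "\<exists>F. finite F \<and> F \<subseteq> center G \<and> (\<forall>a\<in>T closure_of A. \<exists>f\<in>F. inv f \<otimes> a \<in> W)"
    using F(1,2) by blast
qed

lemma compactin_centrally_bounded:
  assumes closed: "\<And>(Y :: ('a \<times> int) set monoid) S f. topological_group Y S \<Longrightarrow> f \<in> hom G Y \<Longrightarrow>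
      embedding_map T S f \<Longrightarrow> closedin S (f ` carrier G)"
    and K: "K \<subseteq> center G" "closedin T K" "centrally_bounded K"
  shows "compactin T K"
proof (rule compactin_ultrafilter)
  show "K \<subseteq> topspace T" by (rule closedin_subset[OF K(2)])
  fix p :: "'a filter" assume p: "ultrafilter p" and pK: "eventually (\<lambda>x. x \<in> K) p"
  have cauchy: "\<exists>a\<in>center G. eventually (\<lambda>x. inv a \<otimes> x \<in> U) p" if U: "nhd U" for U
  proof -
    obtain F where F: "finite F" "F \<subseteq> center G" "\<forall>a\<in>K. \<exists>f\<in>F. inv f \<otimes> a \<in> U"
      by (rule centrally_boundedE[OF K(3) U])
    have "eventually (\<lambda>x. \<exists>f\<in>F. inv f \<otimes> x \<in> U) p" by (rule eventually_mono[OF pK F(3)[rule_format]])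
    then obtain f where "f \<in> F" "eventually (\<lambda>x. inv f \<otimes> x \<in> U) p"
      by (rule ultrafilter_finite_cover[OF p F(1)])
    then show ?thesis using F(2) by blast
  qed
  have pz: "eventually (\<lambda>x. x \<in> center G) p" by (rule eventually_mono[OF pK]) (use K(1) in blast)
  obtain x where x: "x \<in> carrier G" "\<And>U. nhd U \<Longrightarrow> eventually (\<lambda>y. inv x \<otimes> y \<in> U) p"
  proof (rule central_ultrafilter_converges)
    show "closedin S (f ` carrier G)" if "topological_group Y S" "f \<in> hom G Y" "embedding_map T S f"
      for Y :: "('a \<times> int) set monoid" and S f by (rule closed[OF that])
    show "ultrafilter p" by (rule p)
    show "eventually (\<lambda>x. x \<in> center G) p" by (rule pz)
    show "\<exists>a\<in>center G. eventually (\<lambda>x. inv a \<otimes> x \<in> U) p" if "nhd U" for U by (rule cauchy[OF that])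
  qed (rule that)
  have W: "eventually (\<lambda>y. y \<in> W) p" if "openin T W" "x \<in> W" for W
  proof -
    have "eventually (\<lambda>y. inv x \<otimes> y \<in> {u \<in> carrier G. x \<otimes> u \<in> W}) p" by (rule x(2)[OF nhd_translate_left[OF that]])
    then show ?thesis using pK
    proof eventually_elim
      case (elim y)
      have "y \<in> carrier G" using elim(2) K(1) center_carrier by blast
      then show ?case using elim(1) x(1) by (simp add: mult_inv_mult_cancel)
    qed
  qed
  moreover have "x \<in> K"
  proof (rule ccontr)
    assume "x \<notin> K"
    then have "eventually (\<lambda>y. y \<in> topspace T - K) p"
      using W[of "topspace T - K"] K(2) x(1) topspace_eq by (simp add: closedin_def)
    with pK have "eventually (\<lambda>y. False) p" by eventually_elim simp
    then show False using p by (simp add: ultrafilter_def trivial_limit_def)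
  qed
  ultimately show "\<exists>x\<in>K. \<forall>W. openin T W \<and> x \<in> W \<longrightarrow> eventually (\<lambda>y. y \<in> W) p" by blast
qed

end

section \<open>Quotient groups\<close>

text \<open>All three properties follow from the fact that the quotient map is open. Closedness of
  \<open>N\<close> is needed to separate points.\<close>
lemma quotient_topological_group:
  assumes X: "topological_group X T" and N: "N \<lhd> X" "closedin T N"
  shows "topological_group (X Mod N) (quotient_group_topology X T N)"
proof -
  interpret hausdorff_group X T by (rule hausdorff_group.intro[OF X])
  interpret N: normal N X by (rule N(1))
  let ?Q = "quotient_group_topology X T N" and ?q = "\<lambda>x. N #>\<^bsub>X\<^esub> x"
  have gQ: "group (X Mod N)" by (rule N.factorgroup_is_group)
  have Qc: "carrier (X Mod N) = ?q ` carrier X" by (rule carrier_FactGroup)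
  have topQ: "topspace ?Q = ?q ` carrier X" by (simp add: topspace_quotient_topology topspace_eq)
  have qm: "?q x \<otimes>\<^bsub>X Mod N\<^esub> ?q y = ?q (x \<otimes>\<^bsub>X\<^esub> y)" if "x \<in> carrier X" "y \<in> carrier X" for x y
    using N.rcos_sum[OF that] by simp
  have qi: "inv\<^bsub>X Mod N\<^esub> (?q x) = ?q (inv\<^bsub>X\<^esub> x)" if "x \<in> carrier X" for x
    using that N.inv_FactGroup[of "?q x"] N.rcos_inv[of x] by (simp add: Qc)
  have q_eq: "?q x = ?q y \<longleftrightarrow> y \<otimes>\<^bsub>X\<^esub> inv\<^bsub>X\<^esub> x \<in> N" if "x \<in> carrier X" "y \<in> carrier X" for x y
  proof
    assume "?q x = ?q y"
    then have "y \<in> ?q x" using rcos_self[OF that(2) N.is_subgroup] by simp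
    then obtain n where "n \<in> N" "y = n \<otimes>\<^bsub>X\<^esub> x" by (auto simp: r_coset_def)
    then show "y \<otimes>\<^bsub>X\<^esub> inv\<^bsub>X\<^esub> x \<in> N" using that N.subset by (auto simp: m_assoc)
  next
    assume n: "y \<otimes>\<^bsub>X\<^esub> inv\<^bsub>X\<^esub> x \<in> N"
    then have "(y \<otimes>\<^bsub>X\<^esub> inv\<^bsub>X\<^esub> x) \<otimes>\<^bsub>X\<^esub> x \<in> ?q x" by (auto simp: r_coset_def)
    then have "y \<in> ?q x" using that by (simp add: m_assoc)
    then show "?q x = ?q y" by (rule repr_independence[OF _ that(1) N.is_subgroup])
  qed
  have opQ: "openin ?Q V \<longleftrightarrow> V \<subseteq> ?q ` carrier X \<and> openin T {x \<in> carrier X. ?q x \<in> V}" for V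
    by (simp add: openin_quotient_topology topspace_eq)
  \<comment> \<open>The saturation of \<open>A\<close> is the union of its translates by elements of \<open>N\<close>.\<close>
  have q_open: "openin ?Q (?q ` A)" if A: "openin T A" for A
    unfolding opQ
  proof (intro conjI)
    have Ac: "A \<subseteq> carrier X" by (rule open_carrier[OF A])
    then show "?q ` A \<subseteq> ?q ` carrier X" by blast
    have "{x \<in> carrier X. ?q x \<in> ?q ` A} = (\<Union>n\<in>N. {x \<in> carrier X. n \<otimes>\<^bsub>X\<^esub> x \<in> A})"
    proof (intro equalityI subsetI)
      fix x assume "x \<in> {x \<in> carrier X. ?q x \<in> ?q ` A}"
      then obtain a where a: "x \<in> carrier X" "a \<in> A" "?q x = ?q a" by blast
      then have "a \<otimes>\<^bsub>X\<^esub> inv\<^bsub>X\<^esub> x \<in> N" "(a \<otimes>\<^bsub>X\<^esub> inv\<^bsub>X\<^esub> x) \<otimes>\<^bsub>X\<^esub> x = a"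
        using q_eq[of x a] Ac by (auto simp: m_assoc subset_iff)
      then show "x \<in> (\<Union>n\<in>N. {x \<in> carrier X. n \<otimes>\<^bsub>X\<^esub> x \<in> A})"
        using a by (intro UN_I[of "a \<otimes>\<^bsub>X\<^esub> inv\<^bsub>X\<^esub> x"]) auto
    next
      fix x assume "x \<in> (\<Union>n\<in>N. {x \<in> carrier X. n \<otimes>\<^bsub>X\<^esub> x \<in> A})"
      then obtain n where n: "n \<in> N" "x \<in> carrier X" "n \<otimes>\<^bsub>X\<^esub> x \<in> A" by blast
      then have "n \<in> carrier X" using N.subset by blast
      then have "(n \<otimes>\<^bsub>X\<^esub> x) \<otimes>\<^bsub>X\<^esub> inv\<^bsub>X\<^esub> x \<in> N" using n by (simp add: m_assoc)
      then have "?q x = ?q (n \<otimes>\<^bsub>X\<^esub> x)" using q_eq n \<open>n \<in> carrier X\<close> by simp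
      then show "x \<in> {x \<in> carrier X. ?q x \<in> ?q ` A}" using n by blast
    qed
    moreover have "openin T (\<Union>n\<in>N. {x \<in> carrier X. n \<otimes>\<^bsub>X\<^esub> x \<in> A})"
      by (rule openin_Union) (use open_vimage[OF continuous_mult_left _] A N.subset in blast)
    ultimately show "openin T {x \<in> carrier X. ?q x \<in> ?q ` A}" by simp
  qed
  have "Hausdorff_space ?Q" unfolding Hausdorff_space_def
  proof (intro allI impI)
    fix c d assume "c \<in> topspace ?Q \<and> d \<in> topspace ?Q \<and> c \<noteq> d"
    then obtain x y where xy: "x \<in> carrier X" "y \<in> carrier X" "c = ?q x" "d = ?q y" "?q x \<noteq> ?q y"
      unfolding topQ by blast
    have "openin T (topspace T - N)" using N(2) by blast
    then have W: "openin T {z \<in> carrier X. inv\<^bsub>X\<^esub> z \<in> topspace T - N}" (is "openin T ?W")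
      by (rule open_vimage[OF continuous_inv])
    have n: "x \<otimes>\<^bsub>X\<^esub> inv\<^bsub>X\<^esub> y \<in> topspace T - N" using xy q_eq[of y x] by (auto simp: topspace_eq)
    obtain A B where AB: "openin T A" "x \<in> A" "openin T B" "inv\<^bsub>X\<^esub> y \<in> B"
      "\<And>a b. a \<in> A \<Longrightarrow> b \<in> B \<Longrightarrow> a \<otimes>\<^bsub>X\<^esub> b \<in> topspace T - N"
      by (rule mult_nhds[OF \<open>openin T (topspace T - N)\<close> xy(1) _ n]) (use xy that in auto)
    define B' where "B' = {z \<in> carrier X. inv\<^bsub>X\<^esub> z \<in> B}"
    have B': "openin T B'" "y \<in> B'" using open_vimage[OF continuous_inv AB(3)] AB(4) xy by (auto simp: B'_def)
    have "disjnt (?q ` A) (?q ` B')"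
    proof (clarsimp simp: disjnt_iff)
      fix a b assume ab: "a \<in> A" "b \<in> B'" "?q a = ?q b"
      have "a \<in> carrier X" "b \<in> carrier X" using ab open_carrier[OF AB(1)] by (auto simp: B'_def)
      then have "a \<otimes>\<^bsub>X\<^esub> inv\<^bsub>X\<^esub> b \<in> N" using q_eq[of b a] ab(3) by simp
      moreover have "a \<otimes>\<^bsub>X\<^esub> inv\<^bsub>X\<^esub> b \<in> topspace T - N" using AB(5) ab by (simp add: B'_def)
      ultimately show False by blast
    qed
    then show "\<exists>U V. openin ?Q U \<and> openin ?Q V \<and> c \<in> U \<and> d \<in> V \<and> disjnt U V"
      using q_open[OF AB(1)] q_open[OF B'(1)] AB(2) B'(2) xy(3,4) by blast
  qed
  moreover have "continuous_map (prod_topology ?Q ?Q) ?Q (\<lambda>(c, d). c \<otimes>\<^bsub>X Mod N\<^esub> d)"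
  proof (rule continuous_map_prodI)
    show "(\<lambda>(c, d). c \<otimes>\<^bsub>X Mod N\<^esub> d) (c, d) \<in> topspace ?Q" if "c \<in> topspace ?Q" "d \<in> topspace ?Q" for c d
      using that group.is_monoid[OF gQ] monoid.m_closed[of "X Mod N"] unfolding topQ Qc[symmetric] by simp
    fix V c d assume V: "openin ?Q V" and "c \<in> topspace ?Q" "d \<in> topspace ?Q"
      and cd: "(\<lambda>(c, d). c \<otimes>\<^bsub>X Mod N\<^esub> d) (c, d) \<in> V"
    then obtain x y where xy: "x \<in> carrier X" "y \<in> carrier X" "c = ?q x" "d = ?q y" unfolding topQ by blast
    have W: "openin T {x \<in> carrier X. ?q x \<in> V}" using V opQ by blast
    have m: "x \<otimes>\<^bsub>X\<^esub> y \<in> {x \<in> carrier X. ?q x \<in> V}" using cd xy qm[OF xy(1,2)] by simp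
    obtain A B where AB: "openin T A" "x \<in> A" "openin T B" "y \<in> B"
      "\<And>a b. a \<in> A \<Longrightarrow> b \<in> B \<Longrightarrow> a \<otimes>\<^bsub>X\<^esub> b \<in> {x \<in> carrier X. ?q x \<in> V}"
      by (rule mult_nhds[OF W xy(1,2) m]) (rule that)
    have "(\<lambda>(c, d). c \<otimes>\<^bsub>X Mod N\<^esub> d) (a, b) \<in> V" if a: "a \<in> ?q ` A" and b: "b \<in> ?q ` B" for a b
    proof -
      obtain a' b' where ab: "a' \<in> A" "b' \<in> B" "a = ?q a'" "b = ?q b'" using a b by blast
      then have "?q (a' \<otimes>\<^bsub>X\<^esub> b') \<in> V" using AB(5) by blast
      moreover have "a' \<in> carrier X" "b' \<in> carrier X" using ab open_carrier AB(1,3) by blast+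
      ultimately show ?thesis using qm ab by simp
    qed
    then show "\<exists>A B. openin ?Q A \<and> c \<in> A \<and> openin ?Q B \<and> d \<in> B \<and>
        (\<forall>a\<in>A. \<forall>b\<in>B. (\<lambda>(c, d). c \<otimes>\<^bsub>X Mod N\<^esub> d) (a, b) \<in> V)"
      using q_open[OF AB(1)] q_open[OF AB(3)] AB(2,4) xy(3,4)
      by (intro exI[of _ "?q ` A"] exI[of _ "?q ` B"]) auto
  qed
  moreover have "continuous_map ?Q ?Q (\<lambda>c. inv\<^bsub>X Mod N\<^esub> c)"
  proof (rule continuous_mapI_nhds)
    show "inv\<^bsub>X Mod N\<^esub> c \<in> topspace ?Q" if "c \<in> topspace ?Q" for c
      using that group.inv_closed[OF gQ] unfolding topQ Qc[symmetric] by simp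
    fix V c assume V: "openin ?Q V" and "c \<in> topspace ?Q" and c: "inv\<^bsub>X Mod N\<^esub> c \<in> V"
    then obtain x where x: "x \<in> carrier X" "c = ?q x" unfolding topQ by blast
    have W: "openin T {x \<in> carrier X. inv\<^bsub>X\<^esub> x \<in> {x \<in> carrier X. ?q x \<in> V}}"
      by (rule open_vimage[OF continuous_inv]) (use V opQ in blast)
    show "\<exists>A. openin ?Q A \<and> c \<in> A \<and> (\<forall>a\<in>A. inv\<^bsub>X Mod N\<^esub> a \<in> V)"
    proof (intro exI conjI ballI)
      show "openin ?Q (?q ` {x \<in> carrier X. inv\<^bsub>X\<^esub> x \<in> {x \<in> carrier X. ?q x \<in> V}})" by (rule q_open[OF W])
      show "c \<in> ?q ` {x \<in> carrier X. inv\<^bsub>X\<^esub> x \<in> {x \<in> carrier X. ?q x \<in> V}}"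
        using x c qi[OF x(1)] by auto
      show "inv\<^bsub>X Mod N\<^esub> a \<in> V" if "a \<in> ?q ` {x \<in> carrier X. inv\<^bsub>X\<^esub> x \<in> {x \<in> carrier X. ?q x \<in> V}}" for a
        using that qi by auto
    qed
  qed
  moreover interpret QG: group "X Mod N" by (rule gQ)
  have "topologized_semigroup (X Mod N) ?Q" unfolding topologized_semigroup_def topQ Qc[symmetric]
    using QG.m_closed QG.m_assoc by simp
  ultimately show ?thesis using gQ
    by (simp add: topological_group_def paratopological_group_def topological_semigroup_def)
qed

context hausdorff_group
begin

section \<open>Consequences of closedness\<close>

lemma centrally_bounded_imp_totally_bounded_in:
  assumes A: "A \<subseteq> center G" "centrally_bounded A"
  shows "totally_bounded_in (center_group G) (center_topology G T) A"
  unfolding totally_bounded_in_def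
proof (intro conjI allI impI)
  show "A \<subseteq> carrier (center_group G)" using A by simp
  fix U assume "U \<subseteq> carrier (center_group G) \<and> (\<exists>V. openin (center_topology G T) V \<and> \<one>\<^bsub>center_group G\<^esub> \<in> V \<and> V \<subseteq> U)"
  then obtain V where V: "openin T V" "\<one> \<in> V" "V \<inter> center G \<subseteq> U" unfolding openin_subtopology by auto
  then have "nhd V" by (simp add: nhd_def)
  then obtain F where F: "finite F" "F \<subseteq> center G" "\<forall>a\<in>A. \<exists>f\<in>F. inv f \<otimes> a \<in> V" by (rule centrally_boundedE[OF A(2)])
  have "a \<in> (F <#>\<^bsub>center_group G\<^esub> U) \<inter> (U <#>\<^bsub>center_group G\<^esub> F)" if a: "a \<in> A" for a
  proof -
    obtain f where f: "f \<in> F" "inv f \<otimes> a \<in> V" using F(3) a by blast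
    have z: "f \<in> center G" "a \<in> center G" using f F(2) a A(1) by auto
    then have c: "f \<in> carrier G" "a \<in> carrier G" using center_carrier by auto
    have "inv f \<otimes> a \<in> center G"
      using z by (meson center_subgroup subgroup.m_closed subgroup.m_inv_closed)
    then have u: "inv f \<otimes> a \<in> U" using f(2) V(3) by blast
    have e: "a = f \<otimes> (inv f \<otimes> a)" using c by (simp add: mult_inv_mult_cancel)
    moreover have "f \<otimes> (inv f \<otimes> a) = (inv f \<otimes> a) \<otimes> f" using center_comm[OF z(1), of "inv f \<otimes> a"] c by simp
    ultimately have e': "a = (inv f \<otimes> a) \<otimes> f" by (rule trans)
    have "\<exists>h\<in>F. \<exists>k\<in>U. a = h \<otimes> k" by (rule bexI[OF _ f(1)], rule bexI[OF _ u], rule e)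
    moreover have "\<exists>h\<in>U. \<exists>k\<in>F. a = h \<otimes> k" by (rule bexI[OF _ u], rule bexI[OF _ f(1)], rule e')
    ultimately show ?thesis by (simp add: set_mult_def)
  qed
  then show "\<exists>F. finite F \<and> F \<subseteq> carrier (center_group G) \<and>
      A \<subseteq> (F <#>\<^bsub>center_group G\<^esub> U) \<inter> (U <#>\<^bsub>center_group G\<^esub> F)" using F(1,2) by auto
qed

lemma center_int_powers:
  "(\<lambda>x. x [^] (d::int)) ` center G = (\<lambda>x. x [^] nat \<bar>d\<bar>) ` center G"
proof (cases "d \<ge> 0")
  case True
  then have "x [^] d = x [^] nat \<bar>d\<bar>" for x using int_pow_int[of G x "nat \<bar>d\<bar>"] by simp
  then show ?thesis by simp
next
  case False
  then have d: "d = - int (nat \<bar>d\<bar>)" by simp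
  have e: "x [^] d = inv x [^] nat \<bar>d\<bar>" if "x \<in> center G" for x
  proof -
    have "x \<in> carrier G" using that center_carrier by blast
    then show ?thesis by (subst d) (simp only: int_pow_neg_int nat_pow_inv)
  qed
  have i: "inv x \<in> center G" if "x \<in> center G" for x
    using that by (rule subgroup.m_inv_closed[OF center_subgroup])
  show ?thesis
  proof (intro equalityI subsetI)
    fix y assume "y \<in> (\<lambda>x. x [^] d) ` center G"
    then obtain x where "x \<in> center G" "y = inv x [^] nat \<bar>d\<bar>" using e by auto
    then show "y \<in> (\<lambda>x. x [^] nat \<bar>d\<bar>) ` center G" using i by blast
  next
    fix y assume "y \<in> (\<lambda>x. x [^] nat \<bar>d\<bar>) ` center G"
    then obtain x where x: "x \<in> center G" "y = x [^] nat \<bar>d\<bar>" by blast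
    then have "y = inv x [^] d" using e[OF i[OF x(1)]] center_carrier by (simp add: subset_iff)
    then show "y \<in> (\<lambda>x. x [^] d) ` center G" using i[OF x(1)] by blast
  qed
qed

text \<open>Without a bounded set of positive powers the hypothesis of \<open>separating_extension\<close> on the degree holds
  for all degrees, so that \<open>G \<times> \<int>\<close> itself becomes Hausdorff.\<close>
lemma separating_extension_if_unbounded:
  assumes "\<And>n::nat. n \<ge> 1 \<Longrightarrow> \<not> centrally_bounded ((\<lambda>x. x [^] n) ` center G)"
  obtains z :: "nat \<Rightarrow> 'a" and p where "ultrafilter p" "range z \<subseteq> center G"
    "\<And>g d. g \<in> carrier G \<Longrightarrow> (g, d) \<noteq> (\<one>, 0) \<Longrightarrow> \<exists>L. seminorm \<Gamma> L \<and> adapted z p L \<and> 0 < L (g, d)"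
proof (rule separating_extension)
  fix z :: "nat \<Rightarrow> 'a" and p
  assume zp: "ultrafilter p" "range z \<subseteq> center G"
    and sep: "\<And>g d. g \<in> carrier G \<Longrightarrow> (g, d) \<noteq> (\<one>, 0) \<Longrightarrow> d = 0 \<or> \<not> centrally_bounded ((\<lambda>x. x [^] d) ` center G) \<Longrightarrow>
      \<exists>L. seminorm \<Gamma> L \<and> adapted z p L \<and> 0 < L (g, d)"
  show thesis
  proof (rule that[OF zp])
    fix g and d :: int assume g: "g \<in> carrier G" "(g, d) \<noteq> (\<one>, 0)"
    show "\<exists>L. seminorm \<Gamma> L \<and> adapted z p L \<and> 0 < L (g, d)"
    proof (rule sep[OF g])
      have "\<not> centrally_bounded ((\<lambda>x. x [^] d) ` center G)" if "d \<noteq> 0"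
        unfolding center_int_powers by (rule assms) (use that in simp)
      then show "d = 0 \<or> \<not> centrally_bounded ((\<lambda>x. x [^] d) ` center G)" by blast
    qed
  qed
qed

lemma e_closed_paratopological_precompact_exponent:
  assumes closed: "\<And>S (f :: 'a \<Rightarrow> 'a \<times> int). paratopological_group \<Gamma> S \<Longrightarrow> f \<in> hom G \<Gamma> \<Longrightarrow>
      embedding_map T S f \<Longrightarrow> closedin S (f ` carrier G)"
  shows "\<exists>n::nat. n \<ge> 1 \<and> centrally_bounded ((\<lambda>x. x [^] n) ` center G)"
proof (rule ccontr)
  assume "\<not> ?thesis"
  then have no: "\<And>n::nat. n \<ge> 1 \<Longrightarrow> \<not> centrally_bounded ((\<lambda>x. x [^] n) ` center G)" by blast
  obtain z :: "nat \<Rightarrow> 'a" and p where zp: "ultrafilter p" "range z \<subseteq> center G"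
    and sep: "\<And>g d. g \<in> carrier G \<Longrightarrow> (g, d) \<noteq> (\<one>, 0) \<Longrightarrow> \<exists>L. seminorm \<Gamma> L \<and> adapted z p L \<and> 0 < L (g, d)"
    by (rule separating_extension_if_unbounded[OF no]) (assumption, rule that)
  have ev: "eventually (\<lambda>k. z k \<in> center G) p" using zp(2) by (simp add: image_subset_iff)
  let ?S = "norm_topology \<Gamma> (para_norms z p)"
  interpret E: norm_family \<Gamma> "para_norms z p" by (rule norm_family_para[OF ev])
  have "closedin ?S ((\<lambda>x. (x, 0)) ` carrier G)"
  proof (rule closed)
    show "paratopological_group \<Gamma> ?S" by (rule paratopological_extension[OF ev sep])
    show "(\<lambda>x. (x, 0)) \<in> hom G \<Gamma>" by (auto simp: hom_def)
    show "embedding_map T ?S (\<lambda>x. (x, 0))" by (rule base_embedding_para[OF ev])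
  qed
  then have "openin ?S (topspace ?S - (\<lambda>x. (x, 0)) ` carrier G)" by blast
  moreover have "(\<one>, 1) \<in> topspace ?S - (\<lambda>x. (x, 0)) ` carrier G" by (auto simp: E.topspace_norm_topology)
  moreover have "p \<noteq> bot" using zp by (simp add: ultrafilter_def)
  ultimately obtain x where "x \<in> carrier G" "(x, 0) \<in> topspace ?S - (\<lambda>x. (x, 0)) ` carrier G"
    using base_approaches_para[OF ev] by blast
  then show False by blast
qed

text \<open>If the center is not bounded, then degree 1 is separated from 0, which is all that
  \<open>non_closed_group_extension\<close> asks for. Other degrees may collapse in the Hausdorff reflection, for instance if
  the center has finite exponent.\<close>
lemma i_closed_centrally_bounded_center:
  assumes closed: "\<And>(Y :: ('a \<times> int) set monoid) S f. topological_group Y S \<Longrightarrow> f \<in> hom G Y \<Longrightarrow>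
      continuous_map T S f \<Longrightarrow> inj_on f (carrier G) \<Longrightarrow> closedin S (f ` carrier G)"
  shows "centrally_bounded (center G)"
proof (rule ccontr)
  assume no: "\<not> centrally_bounded (center G)"
  have pow1: "(\<lambda>x. x [^] (1::int)) ` center G = center G" using center_carrier by (force simp: image_iff)
  obtain z :: "nat \<Rightarrow> 'a" and p where zp: "ultrafilter p" "range z \<subseteq> center G"
    and sep: "\<And>g d. g \<in> carrier G \<Longrightarrow> (g, d) \<noteq> (\<one>, 0) \<Longrightarrow> d = 0 \<or> \<not> centrally_bounded ((\<lambda>x. x [^] d) ` center G) \<Longrightarrow>
      \<exists>L. seminorm \<Gamma> L \<and> adapted z p L \<and> 0 < L (g, d)"
    by (rule separating_extension) (rule that)
  obtain Y :: "('a \<times> int) set monoid" and S f where Y: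
    "topological_group Y S" "f \<in> hom G Y" "continuous_map T S f" "inj_on f (carrier G)"
    "\<not> closedin S (f ` carrier G)"
  proof (rule non_closed_group_extension[of z p])
    show "eventually (\<lambda>k. z k \<in> center G) p" using zp(2) by (simp add: image_subset_iff)
    show "p \<noteq> bot" using zp by (simp add: ultrafilter_def)
    show "\<exists>L. seminorm \<Gamma> L \<and> adapted z p L \<and> 0 < L (g, 0)" if "g \<in> carrier G" "g \<noteq> \<one>" for g
      by (rule sep) (use that in auto)
    show "\<exists>L. seminorm \<Gamma> L \<and> adapted z p L \<and> 0 < L (g, 1)" if "g \<in> carrier G" for g
      by (rule sep) (use that no pow1 in auto)
  qed (rule that)
  show False using closed[OF Y(1-4)] Y(5) by blast
qed

lemma compact_center_if_i_closed:
  assumes closed: "\<And>(Y :: ('a \<times> int) set monoid) S f. topological_group Y S \<Longrightarrow> f \<in> hom G Y \<Longrightarrow>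
      continuous_map T S f \<Longrightarrow> inj_on f (carrier G) \<Longrightarrow> closedin S (f ` carrier G)"
  shows "compact_space (center_topology G T)"
proof -
  have "compactin T (center G)"
  proof (rule compactin_centrally_bounded)
    show "closedin S (f ` carrier G)" if "topological_group Y S" "f \<in> hom G Y" "embedding_map T S f"
      for Y :: "('a \<times> int) set monoid" and S f
    proof (rule closed[OF that(1,2)])
      have "homeomorphic_map T (subtopology S (f ` topspace T)) f" using that(3) by (simp add: embedding_map_def)
      then show "continuous_map T S f" "inj_on f (carrier G)"
        using homeomorphic_imp_continuous_map[of T "subtopology S (f ` topspace T)" f]
          homeomorphic_imp_injective_map[of T "subtopology S (f ` topspace T)" f]
        by (simp_all add: continuous_map_in_subtopology topspace_eq)
    qed
    show "centrally_bounded (center G)" by (rule i_closed_centrally_bounded_center[OF closed])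
  qed (use closed_center in auto)
  then show ?thesis by (rule compact_space_subtopology)
qed

end

lemma topological_group_imp_semitopological:
  assumes "topological_group Y S"
  shows "semitopological_semigroup Y S"
proof -
  interpret hausdorff_group Y S by (rule hausdorff_group.intro[OF assms])
  show ?thesis unfolding semitopological_semigroup_def
    using continuous_mult_left continuous_mult_right hausdorff topological_group
    by (auto simp: topological_group_def paratopological_group_def topological_semigroup_def)
qed

text \<open>Homomorphisms from the quotient group compose with the quotient map to homomorphisms from \<open>X\<close> with
  the same image.\<close>
lemma compact_center_quotient:
  fixes X :: "('a, 'm) monoid_scheme"
  assumes X: "topological_group X T" and N: "N \<lhd> X \<and> closedin T N" and h: "h_closed topological_group X T"
  shows "compact_space (center_topology (X Mod N) (quotient_group_topology X T N))"
proof -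
  have Q: "topological_group (X Mod N) (quotient_group_topology X T N)"
    using quotient_topological_group[OF X] N by blast
  interpret Q: hausdorff_group "X Mod N" "quotient_group_topology X T N" by (rule hausdorff_group.intro[OF Q])
  interpret N: normal N X using N by blast
  show ?thesis
  proof (rule Q.compact_center_if_i_closed)
    fix Y :: "('a set \<times> int) set monoid" and S f
    assume Y: "topological_group Y S" "f \<in> hom (X Mod N) Y"
      "continuous_map (quotient_group_topology X T N) S f"
    have "closedin S ((f \<circ> (\<lambda>x. N #>\<^bsub>X\<^esub> x)) ` carrier X)"
    proof (rule h_closed_universal[OF X])
      show "f \<circ> (\<lambda>x. N #>\<^bsub>X\<^esub> x) \<in> hom X Y" by (rule hom_compose[OF N.r_coset_hom_Mod Y(2)])
      show "continuous_map T S (f \<circ> (\<lambda>x. N #>\<^bsub>X\<^esub> x))"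
        by (rule continuous_map_compose[OF quotient_imp_continuous_map[OF quotient_map_quotient_topology] Y(3)])
    qed (use h Y(1) in blast)
    then show "closedin S (f ` carrier (X Mod N))" by (simp add: carrier_FactGroup image_comp)
  qed
qed

lemma (in hausdorff_group) normal_closure:
  assumes H: "H \<lhd> G"
  shows "T closure_of H \<lhd> G"
proof -
  interpret H: normal H G by (rule H)
  let ?K = "T closure_of H"
  have sub: "H \<subseteq> ?K" by (rule closure_of_subset) (use H.subset topspace_eq in simp)
  have Kc: "x \<in> carrier G" if "x \<in> ?K" for x using that by (simp add: in_closure_of topspace_eq)
  have image: "f x \<in> ?K" if f: "continuous_map T T f" "\<And>h. h \<in> H \<Longrightarrow> f h \<in> ?K" and x: "x \<in> ?K" for f x
  proof -
    have "f x \<in> T closure_of f ` H" using continuous_map_image_closure_subset[OF f(1)] x by blast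
    moreover have "T closure_of f ` H \<subseteq> ?K" by (rule closure_of_minimal) (use f(2) in auto)
    ultimately show ?thesis by blast
  qed
  have left: "h \<otimes> x \<in> ?K" if h: "h \<in> H" and x: "x \<in> ?K" for h x
    by (rule image[OF continuous_mult_left _ x]) (use h sub H.m_closed H.subset in auto)
  have "subgroup ?K G"
  proof (rule subgroupI)
    show "?K \<subseteq> carrier G" using Kc by blast
    show "?K \<noteq> {}" using sub H.one_closed by blast
    show "inv a \<in> ?K" if "a \<in> ?K" for a
      by (rule image[OF continuous_inv _ that]) (use sub in auto)
    show "a \<otimes> b \<in> ?K" if "a \<in> ?K" "b \<in> ?K" for a b
      by (rule image[OF continuous_mult_right _ that(1)]) (use left that(2) Kc in auto)
  qed
  moreover have "x \<otimes> h \<otimes> inv x \<in> ?K" if x: "x \<in> carrier G" and h: "h \<in> ?K" for x h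
  proof (rule image[OF _ _ h, of "\<lambda>h. x \<otimes> h \<otimes> inv x"])
    show "continuous_map T T (\<lambda>h. x \<otimes> h \<otimes> inv x)"
      using continuous_map_compose[OF continuous_mult_left[OF x] continuous_mult_right[OF inv_closed[OF x]]]
      by (simp add: o_def)
    show "x \<otimes> h \<otimes> inv x \<in> ?K" if "h \<in> H" for h using H.inv_op_closed2[OF x that] sub by blast
  qed
  ultimately show ?thesis unfolding normal_inv_iff by blast
qed

lemma compact_abelization:
  fixes X :: "('a, 'm) monoid_scheme"
  assumes X: "topological_group X T" and h: "h_closed topological_group X T"
  shows "compact_space (quotient_group_topology X T (T closure_of derived X (carrier X)))"
proof -
  interpret hausdorff_group X T by (rule hausdorff_group.intro[OF X])
  let ?D = "derived X (carrier X)"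
  let ?N = "T closure_of ?D"
  have N: "?N \<lhd> X" by (rule normal_closure[OF derived_self_is_normal])
  interpret N: normal ?N X by (rule N)
  have cl: "closedin T ?N" by simp
  let ?Q = "quotient_group_topology X T ?N"
  have "?D \<subseteq> carrier X" using derived_self_is_normal[THEN normal_imp_subgroup] by (rule subgroup.subset)
  then have sub: "?D \<subseteq> ?N" by (intro closure_of_subset) (simp add: topspace_eq)
  have comm: "?N #>\<^bsub>X\<^esub> (x \<otimes>\<^bsub>X\<^esub> y) = ?N #>\<^bsub>X\<^esub> (y \<otimes>\<^bsub>X\<^esub> x)" if xy: "x \<in> carrier X" "y \<in> carrier X" for x y
  proof -
    have "x \<otimes>\<^bsub>X\<^esub> y \<otimes>\<^bsub>X\<^esub> inv\<^bsub>X\<^esub> x \<otimes>\<^bsub>X\<^esub> inv\<^bsub>X\<^esub> y \<in> ?D"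
      unfolding derived_def by (rule generate.incl) (use xy in blast)
    then have "x \<otimes>\<^bsub>X\<^esub> y \<otimes>\<^bsub>X\<^esub> inv\<^bsub>X\<^esub> x \<otimes>\<^bsub>X\<^esub> inv\<^bsub>X\<^esub> y \<in> ?N" using sub by blast
    then have "(x \<otimes>\<^bsub>X\<^esub> y \<otimes>\<^bsub>X\<^esub> inv\<^bsub>X\<^esub> x \<otimes>\<^bsub>X\<^esub> inv\<^bsub>X\<^esub> y) \<otimes>\<^bsub>X\<^esub> (y \<otimes>\<^bsub>X\<^esub> x) \<in> ?N #>\<^bsub>X\<^esub> (y \<otimes>\<^bsub>X\<^esub> x)"
      by (auto simp: r_coset_def)
    moreover have "(x \<otimes>\<^bsub>X\<^esub> y \<otimes>\<^bsub>X\<^esub> inv\<^bsub>X\<^esub> x \<otimes>\<^bsub>X\<^esub> inv\<^bsub>X\<^esub> y) \<otimes>\<^bsub>X\<^esub> (y \<otimes>\<^bsub>X\<^esub> x) = x \<otimes>\<^bsub>X\<^esub> y"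
      using xy mult_inv_mult_cancel[of "inv\<^bsub>X\<^esub> y" x] mult_inv_mult_cancel[of "inv\<^bsub>X\<^esub> x" "\<one>\<^bsub>X\<^esub>"] by (simp add: m_assoc)
    ultimately have "x \<otimes>\<^bsub>X\<^esub> y \<in> ?N #>\<^bsub>X\<^esub> (y \<otimes>\<^bsub>X\<^esub> x)" by simp
    then show ?thesis using repr_independence[OF _ _ N.is_subgroup] xy by simp
  qed
  have "center (X Mod ?N) = carrier (X Mod ?N)"
    unfolding center_def using comm by (auto simp: carrier_FactGroup N.rcos_sum)
  moreover have "topspace ?Q = carrier (X Mod ?N)"
    by (simp add: topspace_quotient_topology topspace_eq carrier_FactGroup)
  ultimately have "center_topology (X Mod ?N) ?Q = ?Q" by (metis subtopology_topspace)
  then show ?thesis using compact_center_quotient[OF X _ h, of ?N] N cl by simp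
qed

text \<open>In the second part the ideal consists of the elements of positive degree in the extension of the
  quotient group \<open>X/N\<close>, and \<open>x\<close> is sent to \<open>(N x, 0)\<close>. In the last part the center of
  the Abelization is the whole group.\<close>
theorem theorem1p9:
  fixes X :: "('a, 'm) monoid_scheme" and T :: "'a topology"
  assumes "topological_group X T"
  shows
    "(e_closed paratopological_group X T \<longrightarrow>
        compact_exponent (center_group X) (center_topology X T)) \<and>
     (e_closed topological_semigroup X T \<longrightarrow>
        (\<forall>N. N \<lhd> X \<and> closedin T N \<longrightarrow>
           precompact_exponent (center_group (X Mod N))
             (center_topology (X Mod N) (quotient_group_topology X T N)))) \<and>
     (i_closed topological_group X T \<or> e_closed semitopological_semigroup X T \<longrightarrow>
        compact_space (center_topology X T)) \<and>
     (h_closed topological_group X T \<longrightarrow>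
        (\<forall>N. N \<lhd> X \<and> closedin T N \<longrightarrow>
           compact_space (center_topology (X Mod N) (quotient_group_topology X T N))) \<and>
        compact_space (quotient_group_topology X T (T closure_of derived X (carrier X))))"
proof (intro conjI impI allI, goal_cases)
  interpret X: hausdorff_group X T by (rule hausdorff_group.intro[OF assms])
  have semi: "semitopological_semigroup Y S" if "topological_group Y S" for Y :: "('b, 'n) monoid_scheme" and S
    by (rule topological_group_imp_semitopological[OF that])
  have quotient: "topological_group (X Mod N) (quotient_group_topology X T N)" if "N \<lhd> X \<and> closedin T N" for N
    using quotient_topological_group[OF assms] that by blast
  {
    case 1
    have embed: "closedin S (f ` carrier X)"
      if "topological_group Y S" "f \<in> hom X Y" "embedding_map T S f" for Y :: "('a \<times> int) set monoid" and S f
      using e_closed_universal[OF assms that(2,3)] 1 that(1) by (simp add: topological_group_def)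
    obtain n :: nat where n: "n \<ge> 1" "X.centrally_bounded ((\<lambda>x. x [^]\<^bsub>X\<^esub> n) ` center X)"
      using X.e_closed_paratopological_precompact_exponent e_closed_universal[OF assms] 1 by meson
    define A where "A = (\<lambda>x. x [^]\<^bsub>X\<^esub> n) ` center X"
    have A: "A \<subseteq> center X" using X.C.nat_pow_closed[of _ n] by (auto simp: A_def X.center_pow)
    have cl: "T closure_of A \<subseteq> center X" by (rule closure_of_minimal[OF A X.closed_center])
    have "compactin T (T closure_of A)"
      by (rule X.compactin_centrally_bounded[OF embed cl closedin_closure_of X.centrally_bounded_closure])
        (use A X.center_carrier n(2) in \<open>auto simp: A_def\<close>)
    moreover have "center_topology X T closure_of A = T closure_of A"
      using A cl by (auto simp: closure_of_subtopology Int_absorb1)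
    ultimately have "compactin (center_topology X T) (center_topology X T closure_of A)"
      using cl by (simp add: compactin_subtopology)
    then show ?case unfolding compact_exponent_def using n(1) by (auto simp: A_def X.center_pow)
  next
    case (2 N)
    interpret Q: hausdorff_group "X Mod N" "quotient_group_topology X T N" by (rule hausdorff_group.intro[OF quotient[OF 2(2)]])
    interpret N: normal N X using 2(2) by blast
    show ?case
    proof (rule ccontr)
      assume np: "\<not> ?case"
      have no: "\<not> Q.centrally_bounded ((\<lambda>x. x [^]\<^bsub>X Mod N\<^esub> n) ` center (X Mod N))" if "n \<ge> 1" for n :: nat
      proof
        assume t: "Q.centrally_bounded ((\<lambda>x. x [^]\<^bsub>X Mod N\<^esub> n) ` center (X Mod N))"
        have "(\<lambda>x. x [^]\<^bsub>X Mod N\<^esub> n) ` center (X Mod N) \<subseteq> center (X Mod N)"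
          using Q.C.nat_pow_closed[of _ n] by (auto simp: Q.center_pow)
        from Q.centrally_bounded_imp_totally_bounded_in[OF this t] np that show False
          unfolding precompact_exponent_def by (auto simp: Q.center_pow)
      qed
      obtain z :: "nat \<Rightarrow> 'a set" and p where zp: "ultrafilter p" "range z \<subseteq> center (X Mod N)"
        and sep: "\<And>g d. g \<in> carrier (X Mod N) \<Longrightarrow> (g, d) \<noteq> (\<one>\<^bsub>X Mod N\<^esub>, 0) \<Longrightarrow>
          \<exists>L. seminorm Q.\<Gamma> L \<and> Q.adapted z p L \<and> 0 < L (g, d)"
        by (rule Q.separating_extension_if_unbounded[OF no]) (assumption, rule that)
      have ev: "eventually (\<lambda>k. z k \<in> center (X Mod N)) p" using zp(2) by (simp add: image_subset_iff)
      have p: "p \<noteq> bot" using zp by (simp add: ultrafilter_def)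
      let ?S = "norm_topology Q.\<Gamma> (Q.para_norms z p)"
      define \<theta> where "\<theta> x = (N #>\<^bsub>X\<^esub> x, 0 :: int)" for x
      define I where "I = {(q, d :: int). q \<in> carrier (X Mod N) \<and> d \<ge> 1}"
      have q: "N #>\<^bsub>X\<^esub> x \<in> carrier (X Mod N)" if "x \<in> carrier X" for x
        using that by (auto simp: carrier_FactGroup)
      have qhom: "(\<lambda>x. N #>\<^bsub>X\<^esub> x) \<in> hom X (X Mod N)" by (rule N.r_coset_hom_Mod)
      have qcont: "continuous_map T (quotient_group_topology X T N) (\<lambda>x. N #>\<^bsub>X\<^esub> x)"
        by (rule quotient_imp_continuous_map[OF quotient_map_quotient_topology])
      obtain P :: "('a + 'a set \<times> int) monoid" and R where P: "topological_semigroup P R" "Inl \<in> hom X P"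
        "embedding_map T R Inl" "\<not> closedin R (Inl ` carrier X)"
      proof (rule X.non_closed_semigroup_extension[of Q.\<Gamma> ?S \<theta> I "(\<one>\<^bsub>X Mod N\<^esub>, 1)"])
        show "paratopological_group Q.\<Gamma> ?S" by (rule Q.paratopological_extension[OF ev sep])
        show "\<theta> \<in> hom X Q.\<Gamma>" using qhom by (auto simp: hom_def \<theta>_def)
        show "continuous_map T ?S \<theta>"
          using continuous_map_compose[OF qcont Q.base_continuous_para[OF ev]] by (simp add: o_def \<theta>_def[abs_def])
        show "I \<subseteq> carrier Q.\<Gamma>" by (auto simp: I_def)
        show "x \<otimes>\<^bsub>Q.\<Gamma>\<^esub> y \<in> I" if "x \<in> I" "y \<in> I" for x y
          using that Q.m_closed by (auto simp: I_def simp del: mult_FactGroup)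
        show "\<theta> x \<otimes>\<^bsub>Q.\<Gamma>\<^esub> y \<in> I \<and> y \<otimes>\<^bsub>Q.\<Gamma>\<^esub> \<theta> x \<in> I" if "x \<in> carrier X" "y \<in> I" for x y
          using that q Q.m_closed by (auto simp: I_def \<theta>_def simp del: mult_FactGroup)
        show "\<theta> x \<notin> I" if "x \<in> carrier X" for x by (simp add: \<theta>_def I_def)
        show "(\<one>\<^bsub>X Mod N\<^esub>, 1) \<in> I" using Q.one_closed by (simp add: I_def del: one_FactGroup)
        show "\<exists>x\<in>carrier X. \<theta> x \<in> W" if W: "openin ?S W" "(\<one>\<^bsub>X Mod N\<^esub>, 1) \<in> W" for W
        proof -
          obtain c where "c \<in> carrier (X Mod N)" "(c, 0) \<in> W"
            by (rule Q.base_approaches_para[OF ev p W]) (rule that)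
          then show ?thesis by (auto simp: carrier_FactGroup \<theta>_def)
        qed
      qed (rule that)
      show False using e_closed_universal[OF assms P(2,3)] 2(1) P(1,4) by blast
    qed
  next
    case 3
    show ?case
    proof (cases "i_closed topological_group X T")
      case True
      show ?thesis
        by (rule X.compact_center_if_i_closed, rule i_closed_universal[OF assms]) (use True in auto)
    next
      case False
      then have E: "e_closed semitopological_semigroup X T" using 3 by blast
      have "X.centrally_bounded (center X)"
      proof (rule ccontr)
        assume "\<not> X.centrally_bounded (center X)"
        then obtain P :: "'a option monoid" and R where "semitopological_semigroup P R" "Some \<in> hom X P"
          "embedding_map T R Some" "\<not> closedin R (Some ` carrier X)"
          by (rule X.non_closed_one_point_extension) (rule that)
        then show False using e_closed_universal[OF assms] E by blast
      qed
      moreover have "closedin S (f ` carrier X)"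
        if "topological_group Y S" "f \<in> hom X Y" "embedding_map T S f" for Y :: "('a \<times> int) set monoid" and S f
        using e_closed_universal[OF assms that(2,3)] E semi[OF that(1)] by blast
      ultimately have "compactin T (center X)"
        by (intro X.compactin_centrally_bounded) (use X.closed_center in auto)
      then show ?thesis by (rule compact_space_subtopology)
    qed
  next
    case (4 N)
    show ?case by (rule compact_center_quotient[OF assms 4(2) 4(1)])
  next
    case 5
    show ?case by (rule compact_abelization[OF assms 5])
  }
qed

end
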